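(* Suppose that for each sequence of probabilities $P_n\in\mathcal P_n$ and each $w\in\Delta_{K-1}$ there exists a sequence of symmetric positive definite $(K+L-1)\times(K+L-1)$ matrices $\Omega_{P_n}(w)$ such that, for any sequence of weights $w_n\in\mathbb W_{P_n}$, the following hold. (i) For each $t\in\mathbf R^{K+L-1}$, $$P_n\left\{\Omega_{P_n}^{-1/2}(w_n)\sqrt n\begin{bmatrix}B_2'(\hat\varphi(w_n)-\varphi_{P_n}(w_n))\\ \hat\theta(w_n)-\theta_{P_n}(w_n)\end{bmatrix}\le t\right\}\to\Phi(t)\quad\text{as } n\to\infty,$$ where $\Phi$ is the CDF of the standard normal random vector in $\mathbf R^{K+L-1}$ and the vector inequality is entrywise. (ii) $\limsup_{n\to\infty}\|\Omega_{P_n}(w_n)\|<\infty$ and $\liminf_{n\to\infty}\lambda_{\min}(\Omega_{P_n}(w_n))>0$. (iii) For any $\epsilon>0$, and along any sequence $w_n\in\Delta_{K-1}$, $P_n\{\|\hat\Omega(w_n)-\Omega_{P_n}(w_n)\|>\epsilon\}\to0$. Then, for any $\alpha\in(0,1)$, $$\liminf_{n\to\infty}\ \inf_{P\in\mathcal P_n}\ \inf_{w\in\mathbb W_P}P\left\{(w,\theta_P(w))\in C^{\mathsf{joint}}_{1-\alpha}\right\}\ge1-\alpha,$$ where $C^{\mathsf{joint}}_{1-\alpha}$ is the joint confidence set defined in the context.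
   Context: $K,L$ are fixed positive integers (not depending on the sample size $n$). $\Delta_{K-1}=\{w\in\mathbf R^K: w\ge0,\ w'\mathbf 1=1\}$, where $\mathbf 1\in\mathbf R^K$ is the vector of ones and inequalities between vectors are entrywise. $B_2$ is a $K\times(K-1)$ matrix with orthonormal columns that are orthogonal to $\mathbf 1$. $\|\cdot\|$ for matrices is the Frobenius norm and $\lambda_{\min}$ denotes the minimum eigenvalue. For each $n$, $\mathcal P_n$ is a set of probability distributions of the data. For each $P$, $Q_P:\mathbf R^K\to\mathbf R$ is convex and differentiable, $\varphi_P(w)=\partial Q_P(w)/\partial w\in\mathbf R^K$ is its gradient, and $\mathbb W_P=\{w\in\Delta_{K-1}:Q_P(w)=\inf_{\tilde w\in\Delta_{K-1}}Q_P(\tilde w)\}$. Also $\theta_P:\Delta_{K-1}\to\Theta$ is a map, with $\Theta\subset\mathbf R^L$. From the data of sample size $n$ one has, for each $w\in\Delta_{K-1}$, estimators $\hat\varphi(w)\in\mathbf R^K$ of $\varphi_P(w)$, $\hat\theta(w)\in\mathbf R^L$ of $\theta_P(w)$, and a symmetric positive definite random $(K+L-1)\times(K+L-1)$ matrix $\hat\Omega(w)$. Construction of $C^{\mathsf{joint}}_{1-\alpha}$. Let $$\hat s(w,\theta,\lambda)=\begin{bmatrix}\hat\varphi(w)-\lambda\\ \hat\theta(w)-\theta\end{bmatrix},\quad \tilde B_2=\begin{bmatrix}B_2&0_{K\times L}\\0_{L\times(K-1)}&I\end{bmatrix},\quad B=[B_2,0_{K\times L}].$$ For each $(w,\theta)\in\Delta_{K-1}\times\Theta$: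 - let $\hat\lambda(w,\theta)$ be a minimizer of $\hat s(w,\theta,\lambda)'\tilde B_2\hat\Omega^{-1}(w)\tilde B_2'\hat s(w,\theta,\lambda)$ over $\lambda\in\mathbf R^K$ subject to $w'\lambda=0$ and $\lambda\ge0$; - let $\hat\gamma(w,\theta)=B\hat\Omega^{-1}(w)\tilde B_2'\hat s(w,\theta,\hat\lambda(w,\theta))\in\mathbf R^K$ and $\hat d(w,\theta)=|\{j\in\{1,\dots,K\}:\hat\gamma_j(w,\theta)=0\text{ and }w_j=0\}|$; - let $\hat c_{1-\alpha}(w,\theta)$ be the $1-\alpha$ quantile of the $\chi^2$ distribution with $\hat k(w,\theta)=\max\{K+L-1-\hat d(w,\theta),1\}$ degrees of freedom; - let $T(w,\theta)=n\,\hat s(w,\theta,\hat\lambda(w,\theta))'\tilde B_2\hat\Omega^{-1}(w)\tilde B_2'\hat s(w,\theta,\hat\lambda(w,\theta))$. Then $C^{\mathsf{joint}}_{1-\alpha}=\{(w,\theta)\in\Delta_{K-1}\times\Theta:T(w,\theta)\le\hat c_{1-\alpha}(w,\theta)\}$. *)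

theory Defs
  imports "HOL-Probability.Probability"
begin

text \<open>
  Throughout, \<open>K = CARD('k)\<close> and \<open>L = CARD('l)\<close>. Types are nonempty, so \<open>\<real>\<^sup>K\<^sup>-\<^sup>1\<close> cannot be
  indexed by a type of its own when \<open>K = 1\<close>. The coordinates of \<open>\<real>\<^sup>K\<^sup>-\<^sup>1 \<times> \<real>\<^sup>L\<close> do form a
  type, since \<open>L > 0\<close>: \<open>Inl i\<close> with \<open>i < K - 1\<close> for the first block, \<open>Inr l\<close> for the second.
  Correspondingly, the \<open>K \<times> (K - 1)\<close> matrix \<open>B\<^sub>2\<close> is given by its columns
  \<open>B2 0, \<dots>, B2 (K - 2)\<close>; the values \<open>B2 i\<close> for \<open>i \<ge> K - 1\<close> are never used.
\<close>

typedef ('k::finite, 'l::finite) coord = "{..<CARD('k) - 1} <+> (UNIV :: 'l set)"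
  by auto

instance coord :: (finite, finite) finite
proof
  have "finite ({..<CARD('a) - 1} <+> (UNIV :: 'b set))"
    by (intro finite_Plus) auto
  then show "finite (UNIV :: ('a, 'b) coord set)"
    by (simp add: type_definition.univ[OF type_definition_coord])
qed

lemma card_coord: "CARD(('k::finite, 'l::finite) coord) = CARD('k) + CARD('l) - 1"
proof -
  have "CARD(('k, 'l) coord) = card ({..<CARD('k) - 1} <+> (UNIV :: 'l set))"
    by (rule type_definition.card[OF type_definition_coord])
  moreover have "CARD('k) > 0" by simp
  ultimately show ?thesis by (simp add: card_Plus)
qed


subsection \<open>Matrices and vectors\<close>

text \<open>
  On \<open>real ^ 'n ^ 'm\<close> the library's \<open>norm\<close> is the Frobenius norm, on \<open>real ^ 'n\<close> the order
  \<open>\<le>\<close> is entrywise, and \<open>1\<close> is the vector of ones.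
\<close>

definition sym_pos_def :: "real ^ 'n ^ 'n::finite \<Rightarrow> bool" where
  "sym_pos_def A \<longleftrightarrow> transpose A = A \<and> (\<forall>x. x \<noteq> 0 \<longrightarrow> 0 < x \<bullet> (A *v x))"

definition inv_sqrt_mat :: "real ^ 'n ^ 'n::finite \<Rightarrow> real ^ 'n ^ 'n" where
  "inv_sqrt_mat A = (THE R. sym_pos_def R \<and> R ** R = matrix_inv A)"

definition eigenvalues :: "real ^ 'n ^ 'n::finite \<Rightarrow> real set" where
  "eigenvalues A = {c. \<exists>v. v \<noteq> 0 \<and> A *v v = c *\<^sub>R v}"

definition lambda_min :: "real ^ 'n ^ 'n::finite \<Rightarrow> real" where
  "lambda_min A = Min (eigenvalues A)"

definition stack :: "real ^ 'k::finite \<Rightarrow> real ^ 'l::finite \<Rightarrow> real ^ ('k + 'l)" where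
  "stack x y = (\<chi> i. case i of Inl k \<Rightarrow> x $ k | Inr l \<Rightarrow> y $ l)"

definition stack_coord :: "(nat \<Rightarrow> real) \<Rightarrow> real ^ 'l::finite \<Rightarrow> real ^ ('k::finite, 'l) coord" where
  "stack_coord u y = (\<chi> c. case Rep_coord c of Inl i \<Rightarrow> u i | Inr l \<Rightarrow> y $ l)"

definition orthonormal_contrasts :: "(nat \<Rightarrow> real ^ 'k::finite) \<Rightarrow> bool" where
  "orthonormal_contrasts B2 \<longleftrightarrow>
     (\<forall>i < CARD('k) - 1. \<forall>j < CARD('k) - 1. B2 i \<bullet> B2 j = (if i = j then 1 else 0)) \<and>
     (\<forall>i < CARD('k) - 1. B2 i \<bullet> 1 = 0)"

definition B_mat :: "(nat \<Rightarrow> real ^ 'k::finite) \<Rightarrow> real ^ ('k, 'l::finite) coord ^ 'k" where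
  "B_mat B2 = (\<chi> k c. case Rep_coord c of Inl i \<Rightarrow> B2 i $ k | Inr l \<Rightarrow> 0)"

definition B2_tilde :: "(nat \<Rightarrow> real ^ 'k::finite) \<Rightarrow> real ^ ('k, 'l::finite) coord ^ ('k + 'l)" where
  "B2_tilde B2 = (\<chi> r c. case (r, Rep_coord c) of
       (Inl k, Inl i) \<Rightarrow> B2 i $ k
     | (Inl k, Inr l) \<Rightarrow> 0
     | (Inr m, Inl i) \<Rightarrow> 0
     | (Inr m, Inr l) \<Rightarrow> (if m = l then 1 else 0))"


subsection \<open>Distributions\<close>

definition std_normal_vec :: "(real ^ 'n::finite) measure" where
  "std_normal_vec = density lborel (\<lambda>x. ennreal (\<Prod>i\<in>UNIV. std_normal_density (x $ i)))"

definition std_normal_vec_cdf :: "real ^ 'n::finite \<Rightarrow> real" where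
  "std_normal_vec_cdf t = measure std_normal_vec {x. x \<le> t}"

text \<open>The law of the sum of squares of \<open>k\<close> independent standard normal variables:\<close>

definition chi_squared :: "nat \<Rightarrow> real measure" where
  "chi_squared k =
     distr (\<Pi>\<^sub>M i\<in>{..<k}. density lborel std_normal_density) borel (\<lambda>z. \<Sum>i<k. (z i)\<^sup>2)"

definition quantile :: "real measure \<Rightarrow> real \<Rightarrow> real" where
  "quantile M p = Inf {x. p \<le> cdf M x}"


subsection \<open>Optimal weights\<close>

definition simplex_wts :: "(real ^ 'k::finite) set" where
  "simplex_wts = {w. 0 \<le> w \<and> w \<bullet> 1 = 1}"

definition opt_wts :: "(real ^ 'k::finite \<Rightarrow> real) \<Rightarrow> (real ^ 'k) set" where
  "opt_wts q = {w \<in> simplex_wts. q w = (INF v\<in>simplex_wts. q v)}"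


subsection \<open>The joint confidence set\<close>

text \<open>
  The arguments \<open>f\<close>, \<open>g\<close>, \<open>Om\<close> are the realized values, as functions of \<open>w\<close>, of the estimators
  \<open>\<phi>\<close>-hat, \<open>\<theta>\<close>-hat, \<open>\<Omega>\<close>-hat.
\<close>

definition s_hat ::
  "(real ^ 'k::finite \<Rightarrow> real ^ 'k) \<Rightarrow> (real ^ 'k \<Rightarrow> real ^ 'l::finite) \<Rightarrow>
   real ^ 'k \<Rightarrow> real ^ 'l \<Rightarrow> real ^ 'k \<Rightarrow> real ^ ('k + 'l)" where
  "s_hat f g w \<theta> lam = stack (f w - lam) (g w - \<theta>)"

definition criterion ::
  "(nat \<Rightarrow> real ^ 'k::finite) \<Rightarrow>
   (real ^ 'k \<Rightarrow> real ^ 'k) \<Rightarrow> (real ^ 'k \<Rightarrow> real ^ 'l::finite) \<Rightarrow>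
   (real ^ 'k \<Rightarrow> real ^ ('k, 'l) coord ^ ('k, 'l) coord) \<Rightarrow>
   real ^ 'k \<Rightarrow> real ^ 'l \<Rightarrow> real ^ 'k \<Rightarrow> real" where
  "criterion B2 f g Om w \<theta> lam =
     s_hat f g w \<theta> lam \<bullet>
       ((B2_tilde B2 ** matrix_inv (Om w) ** transpose (B2_tilde B2)) *v s_hat f g w \<theta> lam)"

text \<open>
  For \<open>w\<close> in the simplex and \<open>Om w\<close> symmetric positive definite the minimizer is unique, so that
  the choice made by \<open>arg_min\<close> is immaterial: two minimizers agree after multiplication by
  \<open>B\<^sub>2'\<close>, hence differ by a multiple of \<open>1\<close>, which vanishes because \<open>w \<bullet> \<lambda> = 0\<close> and \<open>w \<bullet> 1 = 1\<close>.
\<close>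

definition lambda_hat ::
  "(nat \<Rightarrow> real ^ 'k::finite) \<Rightarrow>
   (real ^ 'k \<Rightarrow> real ^ 'k) \<Rightarrow> (real ^ 'k \<Rightarrow> real ^ 'l::finite) \<Rightarrow>
   (real ^ 'k \<Rightarrow> real ^ ('k, 'l) coord ^ ('k, 'l) coord) \<Rightarrow>
   real ^ 'k \<Rightarrow> real ^ 'l \<Rightarrow> real ^ 'k" where
  "lambda_hat B2 f g Om w \<theta> =
     arg_min (criterion B2 f g Om w \<theta>) (\<lambda>lam. w \<bullet> lam = 0 \<and> 0 \<le> lam)"

definition gamma_hat ::
  "(nat \<Rightarrow> real ^ 'k::finite) \<Rightarrow>
   (real ^ 'k \<Rightarrow> real ^ 'k) \<Rightarrow> (real ^ 'k \<Rightarrow> real ^ 'l::finite) \<Rightarrow>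
   (real ^ 'k \<Rightarrow> real ^ ('k, 'l) coord ^ ('k, 'l) coord) \<Rightarrow>
   real ^ 'k \<Rightarrow> real ^ 'l \<Rightarrow> real ^ 'k" where
  "gamma_hat B2 f g Om w \<theta> =
     (B_mat B2 ** matrix_inv (Om w) ** transpose (B2_tilde B2)) *v
       s_hat f g w \<theta> (lambda_hat B2 f g Om w \<theta>)"

definition d_hat ::
  "(nat \<Rightarrow> real ^ 'k::finite) \<Rightarrow>
   (real ^ 'k \<Rightarrow> real ^ 'k) \<Rightarrow> (real ^ 'k \<Rightarrow> real ^ 'l::finite) \<Rightarrow>
   (real ^ 'k \<Rightarrow> real ^ ('k, 'l) coord ^ ('k, 'l) coord) \<Rightarrow>
   real ^ 'k \<Rightarrow> real ^ 'l \<Rightarrow> nat" where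
  "d_hat B2 f g Om w \<theta> = card {j. gamma_hat B2 f g Om w \<theta> $ j = 0 \<and> w $ j = 0}"

text \<open>The natural-number subtraction does not truncate, as \<open>d_hat \<le> K\<close> and \<open>L \<ge> 1\<close>.\<close>

definition k_hat ::
  "(nat \<Rightarrow> real ^ 'k::finite) \<Rightarrow>
   (real ^ 'k \<Rightarrow> real ^ 'k) \<Rightarrow> (real ^ 'k \<Rightarrow> real ^ 'l::finite) \<Rightarrow>
   (real ^ 'k \<Rightarrow> real ^ ('k, 'l) coord ^ ('k, 'l) coord) \<Rightarrow>
   real ^ 'k \<Rightarrow> real ^ 'l \<Rightarrow> nat" where
  "k_hat B2 f g Om w \<theta> = max (CARD('k) + CARD('l) - 1 - d_hat B2 f g Om w \<theta>) 1"

definition T_stat ::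
  "nat \<Rightarrow> (nat \<Rightarrow> real ^ 'k::finite) \<Rightarrow>
   (real ^ 'k \<Rightarrow> real ^ 'k) \<Rightarrow> (real ^ 'k \<Rightarrow> real ^ 'l::finite) \<Rightarrow>
   (real ^ 'k \<Rightarrow> real ^ ('k, 'l) coord ^ ('k, 'l) coord) \<Rightarrow>
   real ^ 'k \<Rightarrow> real ^ 'l \<Rightarrow> real" where
  "T_stat n B2 f g Om w \<theta> = real n * criterion B2 f g Om w \<theta> (lambda_hat B2 f g Om w \<theta>)"

definition C_joint ::
  "real \<Rightarrow> (real ^ 'l) set \<Rightarrow> nat \<Rightarrow> (nat \<Rightarrow> real ^ 'k::finite) \<Rightarrow>
   (real ^ 'k \<Rightarrow> real ^ 'k) \<Rightarrow> (real ^ 'k \<Rightarrow> real ^ 'l::finite) \<Rightarrow>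
   (real ^ 'k \<Rightarrow> real ^ ('k, 'l) coord ^ ('k, 'l) coord) \<Rightarrow>
   ((real ^ 'k) \<times> (real ^ 'l)) set" where
  "C_joint \<alpha> \<Theta> n B2 f g Om =
     {(w, \<theta>). w \<in> simplex_wts \<and> \<theta> \<in> \<Theta> \<and>
       T_stat n B2 f g Om w \<theta> \<le> quantile (chi_squared (k_hat B2 f g Om w \<theta>)) (1 - \<alpha>)}"

end

theory Submission
  imports Defs
begin

text \<open>
  First-order optimality of \<open>w\<close> writes \<open>\<phi> w\<close> as a vector \<open>\<lambda> \<ge> 0\<close> with \<open>w \<bullet> \<lambda> = 0\<close> plus a multiple
  of \<open>1\<close>, so that \<open>T\<close> is the squared distance of a shifted, asymptotically Gaussian vector from a
  polyhedral cone whose generators, the columns of \<open>B\<^sub>2'\<close> at the zeros of \<open>w\<close>, are linearly independent.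
  Along a subsequence violating the claim the covariance matrices and the zeros of \<open>w\<close> converge, and each
  scaled multiplier converges or tends to infinity. By the portmanteau theorem for closed sets it is enough
  to treat the Gaussian limit, where multipliers tending to infinity become free directions.

  There the sample space splits, up to null sets, according to the set \<open>J\<close> of generators orthogonal to the
  residual of the projection. On the piece belonging to \<open>J\<close> the residual is an orthogonal projection of a
  Gaussian vector to a space of dimension \<open>K + L - 1 - |J|\<close>, restricted to a cone, and its mean has a
  nonpositive inner product with that cone. Along each ray of the cone the density therefore falls
  off at least as fast as that of a standard Gaussian vector. Hence the conditional probability that
  the squared residual exceeds the \<open>1 - \<alpha>\<close> quantile of the chi-squared distribution is at most \<open>\<alpha>\<close>.
\<close>

section \<open>Matrices\<close>

text \<open>The obstacle is that the critical value depends on the data through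
  \<open>card J\<close>, which jumps, so the difference between statistic and quantile is not
  continuous. The proof therefore carries \<open>J\<close> along as an existential witness.
  \<open>perturbed_solution\<close> and \<open>active_solution\<close> contain only weak
  inequalities, so that a fixed \<open>J\<close> survives passage to the limit, at the price that
  one point may admit several \<open>J\<close>. Strictness, which makes the pieces of the Gaussian
  limit disjoint, is recovered outside finitely many hyperplanes. The estimated covariance matrix is
  treated in the same spirit: after whitening it is close to the identity, and one collects all
  points at which some matrix that close would lead to rejection. Each piece has its own quantile,
  hence the comparison is one of conditional probabilities; the bounds, \<alpha> times the masses of
  disjoint pieces, add up to at most \<alpha>.\<close>

lemma norm_matrix_vector_mult_le: "norm (A *v x) \<le> norm A * norm x"
  for A :: "real ^ 'n::finite ^ 'm::finite"
proof -
  have "norm (A *v x) = L2_set (\<lambda>i. \<bar>row i A \<bullet> x\<bar>) UNIV"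
    by (simp add: norm_vec_def matrix_vector_mult_def row_def inner_vec_def)
  also have "\<dots> \<le> L2_set (\<lambda>i. norm (A $ i) * norm x) UNIV"
    by (intro L2_set_mono) (auto simp: row_def Cauchy_Schwarz_ineq2 vec_lambda_eta)
  also have "\<dots> = norm A * norm x" by (simp add: norm_vec_def L2_set_left_distrib)
  finally show ?thesis .
qed

lemma tendsto_matrix_vector_mult:
  fixes A :: "'a \<Rightarrow> real ^ 'n::finite ^ 'm::finite"
  assumes "(A \<longlongrightarrow> A0) F" "(x \<longlongrightarrow> x0) F"
  shows "((\<lambda>i. A i *v x i) \<longlongrightarrow> A0 *v x0) F"
  unfolding matrix_vector_mult_def using assms by (intro vec_tendstoI) (auto intro!: tendsto_intros)

lemma tendsto_matrix_matrix_mult: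
  fixes A :: "'a \<Rightarrow> real ^ 'n::finite ^ 'm::finite" and B :: "'a \<Rightarrow> real ^ 'p::finite ^ 'n"
  assumes "(A \<longlongrightarrow> A0) F" "(B \<longlongrightarrow> B0) F"
  shows "((\<lambda>i. A i ** B i) \<longlongrightarrow> A0 ** B0) F"
  unfolding matrix_matrix_mult_def using assms by (intro vec_tendstoI) (auto intro!: tendsto_intros)

section \<open>Spectral theory of symmetric matrices and inverse square roots\<close>

lemma symmetric_inner: "transpose A = A \<Longrightarrow> x \<bullet> (A *v y) = (A *v x) \<bullet> y"
  for A :: "real ^ 'n::finite ^ 'n"
  by (metis dot_lmul_matrix vector_transpose_matrix)

text \<open>An eigenvector comes from maximizing the quadratic form over the compact unit sphere of
  \<open>S\<close>. Allowing an invariant subspace makes the induction in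
  \<open>symmetric_eigenbasis\<close> possible; applied to \<open>- A\<close> on
  \<open>UNIV\<close>, the maximality clause bounds the form below by the least eigenvalue.\<close>

lemma symmetric_Rayleigh_max:
  fixes A :: "real ^ 'n::finite ^ 'n"
  assumes A: "transpose A = A" and S: "subspace S" "S \<noteq> {0}" and inv: "\<And>x. x \<in> S \<Longrightarrow> A *v x \<in> S"
  obtains x where "x \<in> S" "norm x = 1" "A *v x = (x \<bullet> (A *v x)) *\<^sub>R x"
    "\<And>y. y \<in> S \<Longrightarrow> y \<bullet> (A *v y) \<le> (x \<bullet> (A *v x)) * (norm y)\<^sup>2"
proof -
  have cont: "continuous_on X (\<lambda>x. x \<bullet> (A *v x))" for X by (intro continuous_intros)
  have "closed S" using S(1) by (rule closed_subspace)
  then have "compact (S \<inter> sphere 0 1)" by (intro closed_Int_compact) auto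
  moreover have "S \<inter> sphere 0 1 \<noteq> {}"
  proof -
    obtain v where v: "v \<in> S" "v \<noteq> 0" using S subspace_0 by blast
    then have "v /\<^sub>R norm v \<in> S \<inter> sphere 0 1" using S(1) by (auto intro: subspace_scale)
    then show ?thesis by blast
  qed
  ultimately obtain x where x: "x \<in> S \<inter> sphere 0 1" and max: "\<And>y. y \<in> S \<inter> sphere 0 1 \<Longrightarrow> y \<bullet> (A *v y) \<le> x \<bullet> (A *v x)"
    using continuous_attains_sup[OF _ _ cont] by metis
  define c where "c = x \<bullet> (A *v x)"
  have xS: "x \<in> S" "norm x = 1" using x by auto
  have le: "y \<bullet> (A *v y) \<le> c * (norm y)\<^sup>2" if "y \<in> S" for y
  proof (cases "y = 0")
    case False
    have "y /\<^sub>R norm y \<in> S \<inter> sphere 0 1" using S(1) that False by (auto intro: subspace_scale)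
    from max[OF this] have "(y \<bullet> (A *v y)) / (norm y)\<^sup>2 \<le> c"
      by (simp add: c_def matrix_vector_mult_scaleR power2_eq_square divide_inverse mult_ac)
    then show ?thesis using False by (simp add: field_simps)
  qed simp
  text \<open>The form \<open>c \<bar>y\<bar>\<^sup>2 - y \<bullet> A y\<close> is nonnegative on \<open>S\<close> and vanishes at \<open>x\<close>, so its gradient vanishes there.\<close>
  define z where "z = A *v x - c *\<^sub>R x"
  have zS: "z \<in> S" unfolding z_def using S(1) xS inv by (intro subspace_diff subspace_scale)
  have "2 * e * (z \<bullet> z) \<le> e\<^sup>2 * (c * (norm z)\<^sup>2 - z \<bullet> (A *v z))" for e
  proof -
    have "x + e *\<^sub>R z \<in> S" using S(1) xS zS by (intro subspace_add subspace_scale)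
    from le[OF this] have *: "(x + e *\<^sub>R z) \<bullet> (A *v (x + e *\<^sub>R z)) \<le> c * ((x + e *\<^sub>R z) \<bullet> (x + e *\<^sub>R z))"
      by (simp add: power2_norm_eq_inner)
    have "x \<bullet> (A *v z) = z \<bullet> (A *v x)" using symmetric_inner[OF A, of x z] by (simp add: inner_commute)
    moreover have "z \<bullet> (A *v x) = z \<bullet> z + c * (x \<bullet> z)" by (simp add: z_def inner_diff_right inner_diff_left inner_commute) (simp add: algebra_simps)
    moreover have "x \<bullet> x = 1" using xS(2) by (simp add: norm_eq_1)
    ultimately show ?thesis using * unfolding power2_norm_eq_inner
      by (simp add: matrix_vector_right_distrib matrix_vector_mult_scaleR inner_add_left inner_add_right
          c_def[symmetric] algebra_simps power2_eq_square inner_commute[of z x])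
  qed
  note q = this
  define d where "d = c * (norm z)\<^sup>2 - z \<bullet> (A *v z)"
  have "d \<ge> 0" using le[OF zS] by (simp add: d_def)
  have "z \<bullet> z = 0"
  proof (rule ccontr)
    assume "z \<bullet> z \<noteq> 0"
    then have zz: "z \<bullet> z > 0" by simp
    \<comment> \<open>This choice gives \<open>e * d \<le> z \<bullet> z\<close>, whereas
      \<open>q\<close> demands \<open>2 * (z \<bullet> z) \<le> e * d\<close>; the summand 1 covers
      \<open>d = 0\<close>.\<close>
    define e where "e = (z \<bullet> z) / (d + 1)"
    have e: "e > 0" using zz \<open>d \<ge> 0\<close> by (simp add: e_def)
    have "2 * e * (z \<bullet> z) \<le> e * (e * d)" using q[of e] by (simp add: d_def power2_eq_square mult.assoc)
    then have "2 * (z \<bullet> z) \<le> e * d" using e by (simp add: mult.assoc mult.left_commute[of 2])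
    also have "e * d \<le> z \<bullet> z" using zz \<open>d \<ge> 0\<close> by (simp add: e_def field_simps)
    finally show False using zz by simp
  qed
  then have "A *v x = c *\<^sub>R x" by (simp add: z_def)
  then show ?thesis using that xS le unfolding c_def by blast
qed

text \<open>Induction on the dimension: a maximizer of the quadratic form is an eigenvector, and by
  symmetry its orthogonal complement within \<open>S\<close> is again invariant.\<close>

lemma symmetric_eigenbasis:
  fixes A :: "real ^ 'n::finite ^ 'n"
  assumes A: "transpose A = A"
  shows "subspace S \<Longrightarrow> (\<And>x. x \<in> S \<Longrightarrow> A *v x \<in> S) \<Longrightarrow>
    \<exists>B. B \<subseteq> S \<and> finite B \<and> pairwise orthogonal B \<and> (\<forall>b\<in>B. norm b = 1) \<and> span B = S \<and> (\<forall>b\<in>B. \<exists>c. A *v b = c *\<^sub>R b)"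
proof (induction "dim S" arbitrary: S rule: less_induct)
  case less
  show ?case
  proof (cases "S = {0}")
    case True
    then show ?thesis by (intro exI[of _ "{}"]) auto
  next
    case False
    obtain x where x: "x \<in> S" "norm x = 1" "A *v x = (x \<bullet> (A *v x)) *\<^sub>R x"
      using symmetric_Rayleigh_max[OF A less.prems(1) False less.prems(2)] by metis
    define S' where "S' = {y \<in> S. x \<bullet> y = 0}"
    have S': "subspace S'" using less.prems(1) by (auto simp: S'_def subspace_def inner_add_right)
    have inv: "A *v y \<in> S'" if "y \<in> S'" for y
    proof -
      have "x \<bullet> (A *v y) = (A *v x) \<bullet> y" by (rule symmetric_inner[OF A])
      also have "\<dots> = 0" using that by (subst x(3)) (simp add: S'_def)
      finally show ?thesis using that less.prems(2) by (simp add: S'_def)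
    qed
    have "x \<notin> S'" using x(2) by (auto simp: S'_def norm_eq_1)
    moreover have "S' \<subseteq> S" by (auto simp: S'_def)
    ultimately have "S' \<subset> S" using x(1) by blast
    then have "dim S' < dim S" using dim_psubset S' less.prems(1) by (metis span_eq_iff)
    then obtain B where B: "B \<subseteq> S'" "finite B" "pairwise orthogonal B" "\<forall>b\<in>B. norm b = 1" "span B = S'"
        "\<forall>b\<in>B. \<exists>c. A *v b = c *\<^sub>R b"
      using less.hyps[OF _ S' inv] by metis
    have "span (insert x B) = S"
    proof
      show "span (insert x B) \<subseteq> S" using x(1) B(1) less.prems(1) by (intro span_minimal) (auto simp: S'_def)
      show "S \<subseteq> span (insert x B)"
      proof
        fix y assume y: "y \<in> S"
        have "y - (x \<bullet> y) *\<^sub>R x \<in> S'"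
          using y x(1,2) less.prems(1) by (auto simp: S'_def inner_diff_right norm_eq_1 intro: subspace_diff subspace_scale)
        then have "y - (x \<bullet> y) *\<^sub>R x \<in> span B" using B(5) by simp
        then show "y \<in> span (insert x B)" by (auto simp: span_insert)
      qed
    qed
    moreover have "pairwise orthogonal (insert x B)"
      using B(1,3) by (auto simp: pairwise_insert S'_def orthogonal_def inner_commute)
    ultimately show ?thesis
      using B x by (intro exI[of _ "insert x B"]) (auto simp: S'_def)
  qed
qed

lemma sym_pos_defD:
  assumes "sym_pos_def A"
  shows "transpose A = A" "x \<noteq> 0 \<Longrightarrow> 0 < x \<bullet> (A *v x)" "0 \<le> x \<bullet> (A *v x)"
  using assms by (auto simp: sym_pos_def_def less_imp_le) (metis inner_zero_left less_imp_le order_refl)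

lemma sym_pos_def_invertible:
  assumes A: "sym_pos_def A"
  shows "invertible A" "A ** matrix_inv A = mat 1" "matrix_inv A ** A = mat 1"
proof -
  have "A *v x = 0 \<Longrightarrow> x = 0" for x using sym_pos_defD(2)[OF A, of x] by fastforce
  then show inv: "invertible A" by (simp add: invertible_left_inverse matrix_left_invertible_ker)
  then show "A ** matrix_inv A = mat 1" "matrix_inv A ** A = mat 1"
    unfolding matrix_inv_def invertible_def by (metis (mono_tags, lifting) someI_ex)+
qed

lemma sym_pos_def_matrix_inv:
  assumes A: "sym_pos_def A"
  shows "sym_pos_def (matrix_inv A)"
  unfolding sym_pos_def_def
proof (intro conjI allI impI)
  note inv = sym_pos_def_invertible[OF A]
  have "A ** transpose (matrix_inv A) = mat 1"
    using arg_cong[OF inv(3), of transpose] sym_pos_defD(1)[OF A] by (simp add: matrix_transpose_mul transpose_mat)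
  then have "matrix_inv A ** (A ** transpose (matrix_inv A)) = matrix_inv A" by simp
  then show "transpose (matrix_inv A) = matrix_inv A" by (simp add: matrix_mul_assoc inv)
  fix x :: "real ^ 'a" assume "x \<noteq> 0"
  let ?y = "matrix_inv A *v x"
  have Ay: "A *v ?y = x" by (simp add: matrix_vector_mul_assoc inv)
  then have "?y \<noteq> 0" using \<open>x \<noteq> 0\<close> by auto
  from sym_pos_defD(2)[OF A this] show "0 < x \<bullet> (matrix_inv A *v x)" unfolding Ay by (simp add: inner_commute)
qed

lemma sym_pos_def_sqrt_exists:
  fixes A :: "real ^ 'n::finite ^ 'n"
  assumes A: "sym_pos_def A"
  shows "\<exists>R. sym_pos_def R \<and> R ** R = A"
proof -
  obtain B where B: "finite B" "pairwise orthogonal B" "\<And>b. b \<in> B \<Longrightarrow> norm b = 1" "span B = UNIV"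
    "\<And>b. b \<in> B \<Longrightarrow> \<exists>c. A *v b = c *\<^sub>R b"
    using symmetric_eigenbasis[OF sym_pos_defD(1)[OF A] subspace_UNIV] by auto
  obtain c where c: "\<And>b. b \<in> B \<Longrightarrow> A *v b = c b *\<^sub>R b" using B(5) by metis
  have orth: "b \<bullet> b' = (if b = b' then 1 else 0)" if "b \<in> B" "b' \<in> B" for b b'
    using B(2,3) that by (auto simp: pairwise_def orthogonal_def norm_eq_1)
  have cpos: "0 < c b" if "b \<in> B" for b
  proof -
    have "b \<noteq> 0" using B(3)[OF that] by auto
    then show ?thesis using sym_pos_defD(2)[OF A, of b] c[OF that] orth[OF that that] by simp
  qed
  have expand: "x = (\<Sum>b\<in>B. (x \<bullet> b) *\<^sub>R b)" for x
    using orthonormal_basis_expand[OF B(2,3) _ B(1), of x] B(4) by simp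
  define f where "f x = (\<Sum>b\<in>B. (sqrt (c b) * (x \<bullet> b)) *\<^sub>R b)" for x
  have lin: "linear f"
    unfolding f_def
    by (intro linearI) (simp_all add: inner_add_left distrib_left scaleR_add_left sum.distrib scaleR_sum_right mult_ac)
  define R where "R = matrix f"
  have R: "R *v x = f x" for x unfolding R_def using lin by (simp add: matrix_works)
  have fb: "f x \<bullet> b = sqrt (c b) * (x \<bullet> b)" if "b \<in> B" for x b
  proof -
    have "f x \<bullet> b = (\<Sum>b'\<in>B. sqrt (c b') * (x \<bullet> b') * (if b' = b then 1 else 0))"
      unfolding f_def inner_sum_left using that by (intro sum.cong) (auto simp: orth)
    also have "\<dots> = sqrt (c b) * (x \<bullet> b)" using that B(1) by (simp add: mult.commute if_distrib sum.delta cong: if_cong)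
    finally show ?thesis .
  qed
  have inner_f: "y \<bullet> f x = (\<Sum>b\<in>B. sqrt (c b) * (x \<bullet> b) * (y \<bullet> b))" for x y
    by (simp add: f_def inner_sum_right)
  have "sym_pos_def R"
    unfolding sym_pos_def_def
  proof (intro conjI allI impI)
    have "(transpose R *v x) \<bullet> y = (R *v x) \<bullet> y" for x y
    proof -
      have "(transpose R *v x) \<bullet> y = x \<bullet> (R *v y)" by (metis dot_lmul_matrix inner_commute transpose_matrix_vector)
      also have "\<dots> = y \<bullet> (R *v x)" by (simp add: R inner_f mult_ac)
      finally show ?thesis by (simp add: inner_commute)
    qed
    then have "transpose R *v x = R *v x" for x by (metis vector_eq_rdot)
    then show "transpose R = R" by (simp add: matrix_eq del: transpose_matrix_vector)
    fix x :: "real ^ 'n" assume "x \<noteq> 0"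
    have eq: "x \<bullet> (R *v x) = (\<Sum>b\<in>B. sqrt (c b) * (x \<bullet> b)\<^sup>2)" by (simp add: R inner_f power2_eq_square mult.assoc)
    have "\<exists>b\<in>B. x \<bullet> b \<noteq> 0"
    proof (rule ccontr)
      assume "\<not> ?thesis"
      then have "x = 0" by (subst expand) simp
      then show False using \<open>x \<noteq> 0\<close> by simp
    qed
    then obtain b where b: "b \<in> B" "x \<bullet> b \<noteq> 0" by blast
    have "0 < (\<Sum>b\<in>B. sqrt (c b) * (x \<bullet> b)\<^sup>2)"
      using B(1) b cpos by (intro sum_pos2[of _ b]) (auto intro!: mult_pos_pos mult_nonneg_nonneg less_imp_le[OF cpos])
    then show "0 < x \<bullet> (R *v x)" by (simp add: eq)
  qed
  moreover have "R ** R = A"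
  proof -
    have "R *v (R *v x) = A *v x" for x
    proof -
      have "R *v (R *v x) = (\<Sum>b\<in>B. (sqrt (c b) * (sqrt (c b) * (x \<bullet> b))) *\<^sub>R b)"
        unfolding R by (subst f_def) (simp add: fb)
      also have "\<dots> = (\<Sum>b\<in>B. (x \<bullet> b) *\<^sub>R (A *v b))"
      proof (rule sum.cong)
        fix b assume b: "b \<in> B"
        have "sqrt (c b) * (sqrt (c b) * (x \<bullet> b)) = c b * (x \<bullet> b)"
          using cpos[OF b] by (simp add: mult.assoc[symmetric])
        then show "(sqrt (c b) * (sqrt (c b) * (x \<bullet> b))) *\<^sub>R b = (x \<bullet> b) *\<^sub>R (A *v b)" using c[OF b] by simp
      qed simp
      also have "\<dots> = A *v (\<Sum>b\<in>B. (x \<bullet> b) *\<^sub>R b)"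
        by (simp add: linear_sum[OF matrix_vector_mul_linear] matrix_vector_mult_scaleR)
      finally show ?thesis by (simp only: expand[symmetric])
    qed
    then show ?thesis by (simp add: matrix_eq matrix_vector_mul_assoc[symmetric])
  qed
  ultimately show ?thesis by blast
qed

text \<open>
  With \<open>D = R - S\<close> one has \<open>D R + S D = 0\<close>, so \<open>D R D\<close> and \<open>D S D\<close> have traces adding up to zero.
\<close>

lemma sym_pos_def_sqrt_unique:
  fixes R S :: "real ^ 'n::finite ^ 'n"
  assumes R: "sym_pos_def R" and S: "sym_pos_def S" and eq: "R ** R = S ** S"
  shows "R = S"
proof -
  define D where "D = R - S"
  have tD: "transpose D = D"
    using sym_pos_defD(1)[OF R] sym_pos_defD(1)[OF S] by (simp add: D_def transpose_def vec_eq_iff)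
  have "D ** R + S ** D = 0"
    using eq by (simp add: D_def matrix_matrix_mult_def vec_eq_iff left_diff_distrib right_diff_distrib sum_subtractf)
  moreover have "(D ** R + S ** D) ** D = D ** R ** D + S ** D ** D"
    by (simp add: matrix_matrix_mult_def vec_eq_iff distrib_right sum.distrib)
  ultimately have "D ** R ** D + S ** D ** D = 0"
    by (simp add: matrix_matrix_mult_def vec_eq_iff)
  from arg_cong[OF this, of trace] have "trace (D ** R ** D) + trace (S ** D ** D) = 0"
    by (simp add: trace_add) (simp add: trace_def)
  moreover have "trace (S ** D ** D) = trace (D ** S ** D)"
    by (metis matrix_mul_assoc trace_mul_sym)
  ultimately have sum0: "trace (D ** R ** D) + trace (D ** S ** D) = 0" by simp
  have tr: "trace (D ** X ** D) = (\<Sum>i\<in>UNIV. column i D \<bullet> (X *v column i D))" for X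
  proof -
    have "(D ** X ** D) $ i $ i = column i D \<bullet> (X *v column i D)" for i
    proof -
      have "(D ** X ** D) $ i $ i = axis i 1 \<bullet> ((D ** X ** D) *v axis i 1)"
        by (simp add: inner_axis' matrix_vector_mult_basis column_def)
      also have "\<dots> = (D *v axis i 1) \<bullet> (X *v (D *v axis i 1))"
        by (simp add: matrix_vector_mul_assoc[symmetric] symmetric_inner[OF tD])
      finally show ?thesis by (simp add: matrix_vector_mult_basis)
    qed
    then show ?thesis by (simp add: trace_def)
  qed
  have "trace (D ** R ** D) = 0"
    using sum0 unfolding tr using sym_pos_defD(3)[OF R] sym_pos_defD(3)[OF S]
    by (smt (verit) sum_nonneg)
  then have "column i D \<bullet> (R *v column i D) = 0" for i
    unfolding tr using sym_pos_defD(3)[OF R] by (subst (asm) sum_nonneg_eq_0_iff) auto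
  then have "column i D = 0" for i using sym_pos_defD(2)[OF R, of "column i D"] by fastforce
  then have "D = 0" by (simp add: column_def vec_eq_iff)
  then show ?thesis by (simp add: D_def)
qed

lemma inv_sqrt_mat:
  assumes A: "sym_pos_def A"
  shows "sym_pos_def (inv_sqrt_mat A)" "inv_sqrt_mat A ** inv_sqrt_mat A = matrix_inv A"
proof -
  have "\<exists>!R. sym_pos_def R \<and> R ** R = matrix_inv A"
    using sym_pos_def_sqrt_exists[OF sym_pos_def_matrix_inv[OF A]] sym_pos_def_sqrt_unique by metis
  from theI'[OF this] show "sym_pos_def (inv_sqrt_mat A)" "inv_sqrt_mat A ** inv_sqrt_mat A = matrix_inv A"
    by (simp_all add: inv_sqrt_mat_def)
qed

text \<open>\<open>lambda_min\<close> is a \<open>Min\<close>, which is informative only for a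
  finite set. Eigenvectors chosen one per eigenvalue are orthogonal, hence independent, hence finite
  in number.\<close>

lemma finite_eigenvalues:
  fixes A :: "real ^ 'n::finite ^ 'n"
  assumes A: "transpose A = A"
  shows "finite (eigenvalues A)"
proof -
  have "\<forall>c\<in>eigenvalues A. \<exists>v. v \<noteq> 0 \<and> A *v v = c *\<^sub>R v" by (auto simp: eigenvalues_def)
  from bchoice[OF this] obtain v where v: "\<And>c. c \<in> eigenvalues A \<Longrightarrow> v c \<noteq> 0 \<and> A *v v c = c *\<^sub>R v c"
    by blast
  have orth: "v c \<bullet> v d = 0" if "c \<in> eigenvalues A" "d \<in> eigenvalues A" "c \<noteq> d" for c d
  proof -
    have "v c \<bullet> (A *v v d) = (A *v v c) \<bullet> v d" by (rule symmetric_inner[OF A])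
    then have "(d - c) * (v c \<bullet> v d) = 0" using v that by (simp add: left_diff_distrib)
    then show ?thesis using that by simp
  qed
  have inj: "inj_on v (eigenvalues A)"
    using orth v by (intro inj_onI) (metis inner_eq_zero_iff)
  have "pairwise orthogonal (v ` eigenvalues A)"
    using orth by (auto simp: pairwise_def orthogonal_def)
  then have "independent (v ` eigenvalues A)" using v by (intro pairwise_orthogonal_independent) auto
  then have "finite (v ` eigenvalues A)" using independent_bound by blast
  then show ?thesis using inj by (simp add: finite_image_iff)
qed

text \<open>The minimum of the quadratic form on the unit sphere, found as a maximum for
  \<open>- A\<close>, is itself an eigenvalue and so is at least
  \<open>lambda_min A\<close>.\<close>

lemma lambda_min_le:
  fixes A :: "real ^ 'n::finite ^ 'n"
  assumes A: "transpose A = A"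
  shows "lambda_min A * (norm x)\<^sup>2 \<le> x \<bullet> (A *v x)"
proof -
  have neg: "(- A) *v y = - (A *v y)" for y by (simp add: vec_eq_iff matrix_vector_mult_def sum_negf)
  have t: "transpose (- A) = - A" using A by (simp add: transpose_def vec_eq_iff)
  have ne: "(UNIV :: (real ^ 'n) set) \<noteq> {0}" by (metis UNIV_I singletonD zero_neq_one)
  obtain u where u: "norm u = 1" "(- A) *v u = (u \<bullet> ((- A) *v u)) *\<^sub>R u"
    "\<And>y. y \<bullet> ((- A) *v y) \<le> (u \<bullet> ((- A) *v u)) * (norm y)\<^sup>2"
    using symmetric_Rayleigh_max[OF t subspace_UNIV ne] by auto
  let ?c = "u \<bullet> (A *v u)"
  have "A *v u = ?c *\<^sub>R u" using u(2) by (simp add: neg)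
  then have "?c \<in> eigenvalues A" using u(1) by (auto simp: eigenvalues_def intro!: exI[of _ u])
  then have "lambda_min A \<le> ?c" unfolding lambda_min_def by (intro Min_le finite_eigenvalues[OF A])
  then have "lambda_min A * (norm x)\<^sup>2 \<le> ?c * (norm x)\<^sup>2" by (rule mult_right_mono) simp
  also have "\<dots> \<le> x \<bullet> (A *v x)" using u(3)[of x] by (simp add: neg)
  finally show ?thesis .
qed

lemma continuous_on_matrix_vector_mult:
  fixes A :: "'a::topological_space \<Rightarrow> real ^ 'n::finite ^ 'm::finite"
  shows "continuous_on S A \<Longrightarrow> continuous_on S x \<Longrightarrow> continuous_on S (\<lambda>z. A z *v x z)"
  unfolding continuous_on_def by (intro ballI tendsto_matrix_vector_mult) auto

lemma matrix_diff_ldistrib: "A ** (B - C) = A ** B - A ** C"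
  and matrix_diff_rdistrib: "(D - E) ** F = D ** F - E ** F"
  for A :: "real ^ 'n::finite ^ 'm::finite" and D :: "real ^ 'n ^ 'm" and F :: "real ^ 'p::finite ^ 'n"
  by (simp_all add: matrix_matrix_mult_def vec_eq_iff left_diff_distrib right_diff_distrib sum_subtractf)

lemma norm_matrix_matrix_mult_le: "norm (A ** B) \<le> norm A * norm B"
  for A :: "real ^ 'n::finite ^ 'm::finite" and B :: "real ^ 'p::finite ^ 'n"
proof -
  have row: "norm ((A ** B) $ i) \<le> norm (A $ i) * norm B" for i
  proof -
    have "(A ** B) $ i = (\<Sum>k\<in>UNIV. A $ i $ k *\<^sub>R B $ k)"
      by (simp add: vec_eq_iff matrix_matrix_mult_def)
    then have "norm ((A ** B) $ i) \<le> (\<Sum>k\<in>UNIV. \<bar>A $ i $ k\<bar> * \<bar>norm (B $ k)\<bar>)"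
      by (simp add: sum_norm_le)
    also have "\<dots> \<le> L2_set (($) (A $ i)) UNIV * L2_set (\<lambda>k. norm (B $ k)) UNIV" by (rule L2_set_mult_ineq)
    also have "\<dots> = norm (A $ i) * norm B" by (simp add: norm_vec_def L2_set_def)
    finally show ?thesis .
  qed
  have "norm (A ** B) \<le> L2_set (\<lambda>i. norm (A $ i) * norm B) UNIV"
    unfolding norm_vec_def[of "A ** B"] by (intro L2_set_mono row) simp
  also have "\<dots> = norm A * norm B" by (simp add: norm_vec_def[of A] L2_set_left_distrib)
  finally show ?thesis .
qed

text \<open>These bounds make the whitening matrices precompact and keep their limits injective. The
  first adds the lengths of the rows, each the image of a unit vector; the second uses
  \<open>x = A *v (R *v (R *v x))\<close> for the inverse root \<open>R\<close>.\<close>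

lemma inv_sqrt_mat_bounds:
  fixes A :: "real ^ 'n::finite ^ 'n"
  assumes A: "sym_pos_def A" and c: "0 < c" "c \<le> lambda_min A"
  shows "norm (inv_sqrt_mat A) \<le> real CARD('n) * (1 / sqrt c)"
    and "norm x \<le> norm A * norm (inv_sqrt_mat A) * norm (inv_sqrt_mat A *v x)"
proof -
  let ?R = "inv_sqrt_mat A"
  note R = inv_sqrt_mat[OF A] and inv = sym_pos_def_invertible[OF A]
  have bound: "norm (?R *v x) \<le> norm x / sqrt c" for x
  proof -
    define y where "y = matrix_inv A *v x"
    have Ay: "A *v y = x" by (simp add: y_def matrix_vector_mul_assoc inv)
    have "c * (norm y)\<^sup>2 \<le> lambda_min A * (norm y)\<^sup>2" using c by (intro mult_right_mono) auto
    also have "\<dots> \<le> y \<bullet> (A *v y)" by (rule lambda_min_le[OF sym_pos_defD(1)[OF A]])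
    also have "\<dots> \<le> norm y * norm x" unfolding Ay by (rule norm_cauchy_schwarz)
    finally have "norm y * (c * norm y) \<le> norm y * norm x" by (simp add: power2_eq_square mult_ac)
    then have y: "c * norm y \<le> norm x" by (cases "y = 0") (auto simp: mult_le_cancel_left)
    have "(norm (?R *v x))\<^sup>2 = x \<bullet> (?R *v (?R *v x))"
      by (simp add: power2_norm_eq_inner symmetric_inner[OF sym_pos_defD(1)[OF R(1)]])
    also have "\<dots> = x \<bullet> y" by (simp add: y_def matrix_vector_mul_assoc R(2))
    also have "\<dots> \<le> norm x * norm y" by (rule norm_cauchy_schwarz)
    also have "\<dots> \<le> norm x * (norm x / c)" using y c(1) by (intro mult_left_mono) (auto simp: field_simps)
    also have "\<dots> = (norm x / sqrt c)\<^sup>2" using c(1) by (simp add: power_divide power2_eq_square)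
    finally show ?thesis by (rule power2_le_imp_le) (use c in simp)
  qed
  have row: "norm (?R $ i) \<le> 1 / sqrt c" for i
  proof -
    have "?R $ i = ?R *v axis i 1"
      using sym_pos_defD(1)[OF R(1)] by (simp add: matrix_vector_mult_basis column_def vec_eq_iff transpose_def)
    then show ?thesis using bound[of "axis i 1"] by (simp add: norm_axis_1)
  qed
  have "norm ?R \<le> (\<Sum>i\<in>UNIV. norm (?R $ i))" unfolding norm_vec_def[of ?R] by (intro L2_set_le_sum) simp
  also have "\<dots> \<le> (\<Sum>i\<in>(UNIV :: 'n set). 1 / sqrt c)" by (intro sum_mono row)
  finally show "norm ?R \<le> real CARD('n) * (1 / sqrt c)" by simp
  have "x = A *v (?R *v (?R *v x))"
    by (simp add: matrix_vector_mul_assoc matrix_mul_assoc[symmetric] R(2) inv)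
  then have "norm x \<le> norm A * norm (?R *v (?R *v x))" by (metis norm_matrix_vector_mult_le)
  also have "\<dots> \<le> norm A * (norm ?R * norm (?R *v x))" by (intro mult_left_mono norm_matrix_vector_mult_le) simp
  finally show "norm x \<le> norm A * norm ?R * norm (?R *v x)" by (simp add: mult.assoc)
qed

lemma inv_sqrt_mat_congruence:
  assumes A: "sym_pos_def A"
  shows "inv_sqrt_mat A ** A ** inv_sqrt_mat A = mat 1"
proof -
  have "inv_sqrt_mat A ** (inv_sqrt_mat A ** A) = mat 1"
    by (simp add: matrix_mul_assoc inv_sqrt_mat(2)[OF A] sym_pos_def_invertible(3)[OF A])
  then show ?thesis using matrix_left_right_inverse by blast
qed

section \<open>The standard Gaussian measure\<close>

text \<open>Uniqueness of Haar measure, by evaluating the double integral of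
  \<open>indicator A x * indicator B (x + y)\<close> in both orders. The cross-multiplied form
  avoids dividing by a measure that may be zero or infinite.\<close>

lemma translation_invariant_eq_scaled_lborel:
  fixes \<mu> :: "'a::euclidean_space measure"
  assumes sf: "sigma_finite_measure \<mu>" and [measurable_cong]: "sets \<mu> = sets borel"
    and inv: "\<And>a. distr \<mu> borel (\<lambda>x. x + a) = \<mu>" and A: "A \<in> sets borel" "B \<in> sets borel"
  shows "emeasure \<mu> A * emeasure lborel B = emeasure \<mu> B * emeasure lborel A"
proof -
  interpret \<mu>: sigma_finite_measure \<mu> by fact
  interpret pair_sigma_finite \<mu> lborel ..
  note [measurable] = A
  have sp: "space \<mu> = UNIV" using sets_eq_imp_space_eq[of \<mu> borel] assms(2) by simp
  have [measurable]: "indicator A \<in> borel_measurable \<mu>" "indicator B \<in> borel_measurable \<mu>" by measurable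
  have "emeasure \<mu> A * emeasure lborel B
      = (\<integral>\<^sup>+x. indicator A x * (\<integral>\<^sup>+y. indicator B y \<partial>lborel) \<partial>\<mu>)"
    by (simp add: nn_integral_multc)
  also have "\<dots> = (\<integral>\<^sup>+x. (\<integral>\<^sup>+y. indicator A x * indicator B (x + y) \<partial>lborel) \<partial>\<mu>)"
  proof (rule nn_integral_cong)
    fix x
    have "(\<integral>\<^sup>+y. indicator B y \<partial>lborel) = (\<integral>\<^sup>+y. indicator B y \<partial>distr lborel borel ((+) x))"
      by (simp add: lborel_distr_plus)
    also have "\<dots> = (\<integral>\<^sup>+y. indicator B (x + y) \<partial>lborel)" by (subst nn_integral_distr) auto
    finally show "indicator A x * (\<integral>\<^sup>+y. indicator B y \<partial>lborel) = (\<integral>\<^sup>+y. indicator A x * indicator B (x + y) \<partial>lborel)"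
      by (simp add: nn_integral_cmult)
  qed
  also have "\<dots> = (\<integral>\<^sup>+y. (\<integral>\<^sup>+x. indicator A x * indicator B (x + y) \<partial>\<mu>) \<partial>lborel)"
    by (subst Fubini') (auto simp: split_def)
  also have "\<dots> = (\<integral>\<^sup>+y. (\<integral>\<^sup>+x. indicator A (x - y) * indicator B x \<partial>\<mu>) \<partial>lborel)"
  proof (rule nn_integral_cong)
    fix y
    have "(\<integral>\<^sup>+x. indicator A x * indicator B (x + y) \<partial>\<mu>)
       = (\<integral>\<^sup>+x. indicator A x * indicator B (x + y) \<partial>distr \<mu> borel (\<lambda>x. x + - y))"
      by (simp only: inv)
    also have "\<dots> = (\<integral>\<^sup>+x. indicator A (x - y) * indicator B x \<partial>\<mu>)"
      by (subst nn_integral_distr) auto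
    finally show "(\<integral>\<^sup>+x. indicator A x * indicator B (x + y) \<partial>\<mu>) = (\<integral>\<^sup>+x. indicator A (x - y) * indicator B x \<partial>\<mu>)" .
  qed
  also have "\<dots> = (\<integral>\<^sup>+x. (\<integral>\<^sup>+y. indicator A (x - y) * indicator B x \<partial>lborel) \<partial>\<mu>)"
    by (subst Fubini') (auto simp: split_def)
  also have "\<dots> = (\<integral>\<^sup>+x. emeasure lborel A * indicator B x \<partial>\<mu>)"
  proof (rule nn_integral_cong)
    fix x
    \<comment> \<open>Reflection preserves Lebesgue measure too: the affine map has factor -1, of
      absolute value 1.\<close>
    have "distr lborel borel (\<lambda>y::'a. x - y) = lborel"
      using lborel_affine[of "- 1" x] by (simp add: one_ennreal_def[symmetric] density_1)
    then have "(\<integral>\<^sup>+y. indicator A y \<partial>lborel) = (\<integral>\<^sup>+y. indicator A y \<partial>distr lborel borel (\<lambda>y. x - y))"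
      by (simp only:)
    also have "\<dots> = (\<integral>\<^sup>+y. indicator A (x - y) \<partial>lborel)" by (subst nn_integral_distr) auto
    finally show "(\<integral>\<^sup>+y. indicator A (x - y) * indicator B x \<partial>lborel) = emeasure lborel A * indicator B x"
      by (simp add: nn_integral_multc)
  qed
  also have "\<dots> = emeasure \<mu> B * emeasure lborel A"
    by (subst nn_integral_cmult) (auto simp: mult.commute)
  finally show ?thesis .
qed

text \<open>The image measure is translation invariant because
  \<open>T x + a = T (T' a + x)\<close>. Only the existence of a finite positive factor is recorded;
  in the applications it either cancels or is read off from a ball.\<close>

lemma distr_lborel_linear:
  fixes T :: "'a::euclidean_space \<Rightarrow> 'a"
  assumes T: "linear T" and T': "linear T'" and inv: "\<And>x. T (T' x) = x" "\<And>x. T' (T x) = x"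
  obtains c where "0 < c" "c < \<infinity>" "distr lborel borel T = scale_measure c lborel"
proof -
  let ?\<mu> = "distr lborel borel T"
  have [measurable]: "T \<in> borel_measurable borel" "T' \<in> borel_measurable borel"
    using T T' by (auto intro!: borel_measurable_continuous_onI linear_continuous_on simp: linear_linear)
  have bnd: "emeasure ?\<mu> (cball 0 r) < \<infinity>" for r
  proof -
    obtain K where K: "\<And>x. norm (T' x) \<le> norm x * K"
      using bounded_linear.bounded T' linear_linear by metis
    have "T -` cball 0 r \<subseteq> cball 0 (r * \<bar>K\<bar>)"
    proof
      fix x assume "x \<in> T -` cball 0 r"
      then have "norm (T x) \<le> r" by simp
      moreover have "norm x \<le> norm (T x) * K" using K[of "T x"] inv by simp
      moreover have "norm (T x) * K \<le> r * \<bar>K\<bar>"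
        by (rule order_trans[OF mult_left_mono[of K "\<bar>K\<bar>"] mult_right_mono[OF \<open>norm (T x) \<le> r\<close>]]) auto
      ultimately show "x \<in> cball 0 (r * \<bar>K\<bar>)" by simp
    qed
    then have "emeasure lborel (T -` cball 0 r) \<le> emeasure lborel (cball (0::'a) (r * \<bar>K\<bar>))"
      by (intro emeasure_mono) auto
    also have "\<dots> < \<infinity>" by (rule emeasure_bounded_finite) simp
    finally show ?thesis by (simp add: emeasure_distr)
  qed
  have sf: "sigma_finite_measure ?\<mu>"
  proof
    show "\<exists>A. countable A \<and> A \<subseteq> sets ?\<mu> \<and> \<Union>A = space ?\<mu> \<and> (\<forall>a\<in>A. emeasure ?\<mu> a \<noteq> \<infinity>)"
    proof (intro exI[of _ "range (\<lambda>n::nat. cball 0 (real n))"] conjI)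
      show "\<Union>(range (\<lambda>n::nat. cball (0::'a) (real n))) = space ?\<mu>"
        using real_arch_simple by auto
    qed (use bnd in \<open>auto simp: less_top\<close>)
  qed
  have tr: "distr ?\<mu> borel (\<lambda>x. x + a) = ?\<mu>" for a
  proof -
    have "distr ?\<mu> borel (\<lambda>x. x + a) = distr lborel borel (\<lambda>x. T x + a)"
      by (simp add: distr_distr o_def)
    also have "(\<lambda>x. T x + a) = T \<circ> (\<lambda>x. T' a + x)"
      using T by (auto simp: linear_add inv)
    also have "distr lborel borel \<dots> = distr (distr lborel borel ((+) (T' a))) borel T"
      by (subst distr_distr) (auto simp: o_def)
    finally show ?thesis by (simp add: lborel_distr_plus)
  qed
  define B where "B = cball (0::'a) 1"
  define c where "c = emeasure ?\<mu> B / emeasure lborel B"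
  have B: "emeasure lborel B \<noteq> 0" "emeasure lborel B \<noteq> \<infinity>"
    using emeasure_cball[of 1 "0::'a"] unit_ball_vol_pos[of "real DIM('a)"]
    by (auto simp: B_def ennreal_eq_0_iff not_le)
  have eq: "emeasure ?\<mu> A = c * emeasure lborel A" if "A \<in> sets borel" for A
  proof -
    have "emeasure ?\<mu> A * emeasure lborel B = emeasure ?\<mu> B * emeasure lborel A"
      by (rule translation_invariant_eq_scaled_lborel[OF sf _ tr that]) (auto simp: B_def)
    then have "emeasure ?\<mu> A * emeasure lborel B / emeasure lborel B = emeasure ?\<mu> B * emeasure lborel A / emeasure lborel B"
      by simp
    then have "emeasure ?\<mu> A = emeasure ?\<mu> B * emeasure lborel A / emeasure lborel B"
      by (simp only: ennreal_mult_divide_eq[OF B(1) B(2)[unfolded infinity_ennreal_def]])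
    then show ?thesis unfolding c_def
      by (simp only: ennreal_times_divide mult.commute)
  qed
  have "c < \<infinity>" unfolding c_def using bnd[of 1] B
    by (auto simp: ennreal_divide_eq_top_iff top.not_eq_extremum[symmetric] B_def)
  moreover have "c \<noteq> 0"
  proof
    assume "c = 0"
    then have "emeasure ?\<mu> UNIV = 0" using eq[of UNIV] by simp
    then show False by (simp add: emeasure_distr)
  qed
  moreover have "?\<mu> = scale_measure c lborel"
    by (rule measure_eqI) (auto simp: eq)
  ultimately show ?thesis using that by (metis not_gr_zero)
qed

section \<open>Coordinates, rotations and chi-squared laws of the standard Gaussian vector\<close>

lemma prod_Basis_vec: "(\<Prod>b\<in>Basis. F b) = (\<Prod>i\<in>UNIV. F (axis i (1::real)))"
  for F :: "real ^ 'n::finite \<Rightarrow> 'c::comm_monoid_mult"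
proof -
  have "inj (\<lambda>i::'n. axis i (1::real))" by (auto simp: inj_on_def axis_eq_axis)
  moreover have "Basis = range (\<lambda>i::'n. axis i (1::real))" by (auto simp: Basis_vec_def)
  ultimately show ?thesis using prod.reindex[of "\<lambda>i::'n. axis i (1::real)" UNIV F] by (simp only: o_def)
qed

lemma std_normal_vec_eq:
  "(std_normal_vec :: (real ^ 'n::finite) measure) =
     density lborel (\<lambda>x. ennreal ((1 / sqrt (2 * pi)) ^ CARD('n) * exp (- (norm x)\<^sup>2 / 2)))"
proof -
  have "(\<Prod>i\<in>UNIV. std_normal_density (x $ i)) = (1 / sqrt (2 * pi)) ^ CARD('n) * exp (- (norm x)\<^sup>2 / 2)"
    for x :: "real ^ 'n"
  proof -
    have "(norm x)\<^sup>2 = (\<Sum>i\<in>UNIV. (x $ i)\<^sup>2)"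
      by (simp add: power2_norm_eq_inner inner_vec_def) (simp add: power2_eq_square)
    then have "- (norm x)\<^sup>2 / 2 = (\<Sum>i\<in>UNIV. - (x $ i)\<^sup>2 / 2)"
      by (simp add: sum_divide_distrib[symmetric] sum_negf)
    then show ?thesis by (simp add: std_normal_density_def exp_sum[symmetric] prod_dividef power_divide)
  qed
  then show ?thesis by (simp add: std_normal_vec_def)
qed

lemma sets_std_normal_vec [simp, measurable_cong]: "sets std_normal_vec = sets borel"
  and space_std_normal_vec [simp]: "space std_normal_vec = UNIV"
  by (simp_all add: std_normal_vec_def)

lemma emeasure_std_normal_vec_Pi:
  fixes A :: "'n::finite \<Rightarrow> real set"
  assumes [measurable]: "\<And>i. A i \<in> sets borel"
  shows "emeasure std_normal_vec {x. \<forall>i. x $ i \<in> A i} = (\<Prod>i\<in>UNIV. emeasure (density lborel std_normal_density) (A i))"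
proof -
  \<comment> \<open>The product formula for Lebesgue integrals runs over basis vectors;
    \<open>inv\<close> recovers the coordinate to which a basis vector belongs.\<close>
  define f where "f b y = ennreal (std_normal_density y) * indicator (A (inv (\<lambda>i. axis i 1) b)) y"
    for b :: "real ^ 'n" and y
  have inj: "inj (\<lambda>i::'n. axis i (1::real))" by (auto simp: inj_on_def axis_eq_axis)
  have [measurable]: "f b \<in> borel_measurable borel" for b
    unfolding f_def by measurable
  have 1: "(\<Prod>b\<in>Basis. f b (x \<bullet> b)) = ennreal (\<Prod>i\<in>UNIV. std_normal_density (x $ i)) * indicator {x. \<forall>i. x $ i \<in> A i} x" for x
  proof -
    have "(\<Prod>b\<in>Basis. f b (x \<bullet> b)) = (\<Prod>i\<in>UNIV. ennreal (std_normal_density (x $ i)) * indicator (A i) (x $ i))"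
      by (simp add: prod_Basis_vec f_def inv_f_f[OF inj] inner_axis)
    also have "\<dots> = ennreal (\<Prod>i\<in>UNIV. std_normal_density (x $ i)) * (\<Prod>i\<in>UNIV. indicator (A i) (x $ i))"
      by (simp add: prod.distrib prod_ennreal)
    also have "(\<Prod>i\<in>UNIV. indicator (A i) (x $ i)) = (indicator {x. \<forall>i. x $ i \<in> A i} x :: ennreal)"
      by (auto simp: indicator_def split: if_splits)
    finally show ?thesis .
  qed
  have [measurable]: "{x. \<forall>i. x $ i \<in> A i} \<in> sets borel"
    by measurable
  have "emeasure std_normal_vec {x. \<forall>i. x $ i \<in> A i} = (\<integral>\<^sup>+x. (\<Prod>b\<in>Basis. f b (x \<bullet> b)) \<partial>lborel)"
    by (simp add: std_normal_vec_def emeasure_density 1)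
  also have "\<dots> = (\<Prod>b\<in>Basis. (\<integral>\<^sup>+x. f b x \<partial>lborel))"
    by (rule nn_integral_lborel_prod) auto
  also have "\<dots> = (\<Prod>i\<in>UNIV. emeasure (density lborel std_normal_density) (A i))"
    by (simp add: prod_Basis_vec f_def inv_f_f[OF inj] emeasure_density)
  finally show ?thesis .
qed

lemma prob_space_std_normal_vec: "prob_space (std_normal_vec :: (real ^ 'n::finite) measure)"
proof
  have "emeasure (density lborel std_normal_density) UNIV = 1"
    using prob_space.emeasure_space_1[OF prob_space_normal_density[of 1 0]] by simp
  then show "emeasure std_normal_vec (space (std_normal_vec :: (real ^ 'n) measure)) = 1"
    using emeasure_std_normal_vec_Pi[of "\<lambda>_::'n. UNIV"] by simp
qed

text \<open>A rotation maps the unit ball to itself, which forces the factor of Lebesgue measure to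
  be 1; the Gaussian density depends on the norm alone.\<close>

lemma distr_std_normal_vec_orthogonal:
  fixes A :: "real ^ 'n::finite ^ 'n"
  assumes A: "orthogonal_matrix A"
  shows "distr std_normal_vec borel ((*v) A) = std_normal_vec"
proof -
  have inv: "transpose A *v (A *v x) = x" "A *v (transpose A *v x) = x" for x
    using A by (simp_all add: orthogonal_matrix_def matrix_vector_mul_assoc del: transpose_matrix_vector)
  have nrm: "norm (A *v x) = norm x" for x
    using A orthogonal_transformation_matrix[of "(*v) A"] by (simp add: orthogonal_transformation)
  have lin: "linear ((*v) A)" "linear ((*v) (transpose A))" by (rule matrix_vector_mul_linear)+
  obtain c where c: "0 < c" "c < \<infinity>" "distr lborel borel ((*v) A) = scale_measure c lborel"
    using distr_lborel_linear[OF lin] inv by metis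
  have [measurable]: "(*v) A \<in> borel_measurable borel"
    by (intro borel_measurable_continuous_onI linear_continuous_on) (simp add: linear_linear)
  have "(*v) A -` cball 0 1 = cball 0 1" by (auto simp: nrm)
  then have "emeasure lborel (cball (0::real^'n) 1) = c * emeasure lborel (cball (0::real^'n) 1)"
    using arg_cong[OF c(3), of "\<lambda>M. emeasure M (cball 0 1)"] by (simp add: emeasure_distr)
  moreover have "emeasure lborel (cball (0::real^'n) 1) = ennreal (unit_ball_vol (real DIM(real^'n)))"
    using emeasure_cball[of 1 "0::real^'n"] by simp
  moreover have "unit_ball_vol (real DIM(real^'n)) > 0" "unit_ball_vol (real CARD('n)) > 0"
    by (rule unit_ball_vol_pos, simp)+
  ultimately have "c = 1"
    using c by (cases c) (auto simp: ennreal_mult[symmetric])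
  then have c: "distr lborel borel ((*v) A) = lborel"
    using c(3) by (metis measure_eqI sets_scale_measure emeasure_scale_measure mult_1)
  let ?g = "\<lambda>x::real^'n. ennreal ((1 / sqrt (2 * pi)) ^ CARD('n) * exp (- (norm x)\<^sup>2 / 2))"
  show ?thesis
  proof (rule measure_eqI)
    fix B assume "B \<in> sets (distr (std_normal_vec :: (real^'n) measure) borel ((*v) A))"
    then have [measurable]: "B \<in> sets borel" by simp
    then have [measurable]: "(*v) A -` B \<in> sets borel" by (rule measurable_sets_borel[rotated]) simp
    have "emeasure (distr std_normal_vec borel ((*v) A)) B = (\<integral>\<^sup>+x. ?g (A *v x) * indicator B (A *v x) \<partial>lborel)"
      unfolding std_normal_vec_eq
      by (subst emeasure_distr, simp, simp, subst emeasure_density) (auto simp: nrm indicator_def intro!: nn_integral_cong)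
    also have "\<dots> = (\<integral>\<^sup>+x. ?g x * indicator B x \<partial>distr lborel borel ((*v) A))"
      by (subst nn_integral_distr) auto
    also have "\<dots> = emeasure std_normal_vec B"
      unfolding c std_normal_vec_eq by (subst emeasure_density) auto
    finally show "emeasure (distr std_normal_vec borel ((*v) A)) B = emeasure std_normal_vec B" .
  qed simp
qed

text \<open>Rotating by the matrix with rows \<open>b i\<close> turns the inner products into
  coordinates, and those in \<open>I\<close>, numbered by \<open>\<sigma>\<close>, have the product
  law that defines \<open>chi_squared\<close>.\<close>

lemma distr_std_normal_vec_chi_squared:
  fixes b :: "'n::finite \<Rightarrow> real ^ 'n"
  assumes b: "\<And>i j. b i \<bullet> b j = (if i = j then 1 else 0)"
  shows "distr std_normal_vec borel (\<lambda>x. \<Sum>i\<in>I. (b i \<bullet> x)\<^sup>2) = chi_squared (card I)"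
proof -
  let ?N = "density lborel std_normal_density"
  define A where "A = (\<chi> i. b i)"
  have "orthogonal_matrix A"
    by (auto simp: orthogonal_matrix_orthonormal_rows A_def row_def orthogonal_def b norm_eq_1 vec_lambda_eta)
  then have rot: "distr std_normal_vec borel ((*v) A) = std_normal_vec" by (rule distr_std_normal_vec_orthogonal)
  have [measurable]: "(*v) A \<in> borel_measurable borel"
    by (intro borel_measurable_continuous_onI linear_continuous_on) (simp add: linear_linear)
  have Ai: "(A *v x) $ i = b i \<bullet> x" for x i
    by (simp add: A_def matrix_vector_mult_def inner_vec_def)
  obtain \<sigma> where \<sigma>: "bij_betw \<sigma> {..<card I} I"
    using ex_bij_betw_nat_finite[of I] by (auto simp: atLeast0LessThan)
  let ?P = "Pi\<^sub>M {..<card I} (\<lambda>_. ?N)"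
  interpret N: prob_space ?N by (rule prob_space_normal_density) simp
  interpret product_sigma_finite "\<lambda>_::nat. ?N" ..
  let ?r = "\<lambda>x::real^'n. \<lambda>k\<in>{..<card I}. x $ \<sigma> k"
  have [measurable]: "?r \<in> measurable borel ?P"
    by (rule measurable_restrict) simp
  have eq: "distr std_normal_vec ?P ?r = ?P"
  proof (rule PiM_eqI)
    fix C assume C: "\<And>i. i \<in> {..<card I} \<Longrightarrow> C i \<in> sets ?N"
    \<comment> \<open>Carries the sides of the rectangle to the coordinates in \<open>I\<close>; the
      full line elsewhere contributes factors equal to 1.\<close>
    define D where "D i = (if i \<in> I then C (inv_into {..<card I} \<sigma> i) else UNIV)" for i
    have D: "D (\<sigma> k) = C k" if "k < card I" for k
      using that \<sigma> bij_betw_inv_into_left[OF \<sigma>, of k] by (auto simp: D_def bij_betw_def)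
    have [measurable]: "D i \<in> sets borel" for i
      using C \<sigma> bij_betw_inv_into[OF \<sigma>] by (auto simp: D_def bij_betw_def)
    have "?r -` (Pi\<^sub>E {..<card I} C) = {x. \<forall>i. x $ i \<in> D i}"
    proof (intro set_eqI)
      fix x
      have "x \<in> ?r -` (Pi\<^sub>E {..<card I} C) \<longleftrightarrow> (\<forall>k<card I. x $ \<sigma> k \<in> D (\<sigma> k))"
        by (auto simp: PiE_iff D)
      also have "\<dots> \<longleftrightarrow> (\<forall>i\<in>I. x $ i \<in> D i)"
        using bij_betw_imp_surj_on[OF \<sigma>] by (metis imageE image_eqI lessThan_iff)
      also have "\<dots> \<longleftrightarrow> x \<in> {x. \<forall>i. x $ i \<in> D i}" by (auto simp: D_def)
      finally show "x \<in> ?r -` (Pi\<^sub>E {..<card I} C) \<longleftrightarrow> x \<in> {x. \<forall>i. x $ i \<in> D i}" .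
    qed
    moreover have "Pi\<^sub>E {..<card I} C \<in> sets ?P" using C by (intro sets_PiM_I_finite) auto
    ultimately have "emeasure (distr std_normal_vec ?P ?r) (Pi\<^sub>E {..<card I} C) = emeasure std_normal_vec {x. \<forall>i. x $ i \<in> D i}"
      by (subst emeasure_distr) auto
    also have "\<dots> = (\<Prod>i\<in>UNIV. emeasure ?N (D i))" by (rule emeasure_std_normal_vec_Pi) simp
    also have "\<dots> = (\<Prod>i\<in>I. emeasure ?N (D i))"
      by (rule prod.mono_neutral_right) (use N.emeasure_space_1 in \<open>auto simp: D_def\<close>)
    also have "\<dots> = (\<Prod>k<card I. emeasure ?N (D (\<sigma> k)))"
      by (rule prod.reindex_bij_betw[OF \<sigma>, symmetric])
    also have "\<dots> = (\<Prod>k<card I. emeasure ?N (C k))" by (simp add: D)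
    finally show "emeasure (distr std_normal_vec ?P ?r) (Pi\<^sub>E {..<card I} C) = (\<Prod>k<card I. emeasure ?N (C k))" .
  qed auto
  have "distr std_normal_vec borel (\<lambda>x. \<Sum>i\<in>I. (b i \<bullet> x)\<^sup>2)
      = distr (distr std_normal_vec borel ((*v) A)) borel (\<lambda>x. \<Sum>i\<in>I. (x $ i)\<^sup>2)"
    by (subst distr_distr) (auto simp: o_def Ai)
  also have "(\<lambda>x. \<Sum>i\<in>I. (x $ i)\<^sup>2) = (\<lambda>x::real^'n. \<Sum>k<card I. (x $ \<sigma> k)\<^sup>2)"
    by (simp add: sum.reindex_bij_betw[OF \<sigma>, of "\<lambda>i. (_ $ i)\<^sup>2"])
  also have "\<dots> = (\<lambda>z. \<Sum>k<card I. (z k)\<^sup>2) \<circ> ?r" by (auto simp: o_def)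
  also have "distr (distr std_normal_vec borel ((*v) A)) borel \<dots> = distr (distr std_normal_vec ?P ?r) borel (\<lambda>z. \<Sum>k<card I. (z k)\<^sup>2)"
    unfolding rot by (subst distr_distr) auto
  also have "\<dots> = chi_squared (card I)" by (simp add: eq chi_squared_def)
  finally show ?thesis .
qed

text \<open>With \<open>a = norm (M x)\<close> this represents the radial Gaussian factor as a
  mixture of indicators of \<open>norm (M x) \<le> s\<close>; the weight is minus the derivative of
  \<open>exp (- s\<^sup>2 / 2)\<close>.\<close>

lemma nn_integral_layer_exp:
  assumes "0 \<le> a"
  shows "(\<integral>\<^sup>+s. ennreal (s * exp (- s\<^sup>2 / 2)) * indicator {a..} s \<partial>lborel) = ennreal (exp (- a\<^sup>2 / 2))"
proof -
  have "((\<lambda>s::real. - exp (- s\<^sup>2 / 2)) \<longlongrightarrow> 0) at_top" by real_asymp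
  then have "(\<integral>\<^sup>+s. ennreal (s * exp (- s\<^sup>2 / 2)) * indicator {a..} s \<partial>lborel) = 0 - (- exp (- a\<^sup>2 / 2))"
    using assms
    by (intro nn_integral_FTC_atLeast) (auto intro!: derivative_eq_intros)
  then show ?thesis by simp
qed

text \<open>
  Scaling the component along the range of \<open>M\<close> shows that the mass which \<open>f\<close> puts on
  \<open>{x. norm (M x) \<le> s}\<close> grows in \<open>s\<close> no faster than that of the standard Gaussian factor; integrating
  against the radial weight \<open>s exp (- s\<^sup>2 / 2)\<close> turns this into the comparison of tails.
\<close>

lemma gaussian_ray_monotone_tail:
  fixes M :: "'a::euclidean_space \<Rightarrow> 'a" and f :: "'a \<Rightarrow> ennreal"
  assumes M: "linear M" and idem: "\<And>x. M (M x) = M x"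
    and pyth: "\<And>x. (norm x)\<^sup>2 = (norm (x - M x))\<^sup>2 + (norm (M x))\<^sup>2"
    and f [measurable]: "f \<in> borel_measurable borel"
    and ray: "\<And>x s. 0 < s \<Longrightarrow> s \<le> 1 \<Longrightarrow> f x \<le> f (x - M x + s *\<^sub>R M x)"
    and fin: "(\<integral>\<^sup>+x. f x * ennreal (exp (- (norm (M x))\<^sup>2 / 2)) \<partial>lborel) < \<infinity>"
    and fin0: "(\<integral>\<^sup>+x. ennreal (exp (- (norm (x::'a))\<^sup>2 / 2)) \<partial>lborel) < \<infinity>"
    and t: "0 < t"
  shows "(\<integral>\<^sup>+x. f x * ennreal (exp (- (norm (M x))\<^sup>2 / 2)) * indicator {x. t < norm (M x)} x \<partial>lborel) *
         (\<integral>\<^sup>+x. ennreal (exp (- (norm x)\<^sup>2 / 2)) * indicator {x. norm (M x) \<le> t} x \<partial>lborel) \<le>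
         (\<integral>\<^sup>+x. f x * ennreal (exp (- (norm (M x))\<^sup>2 / 2)) * indicator {x. norm (M x) \<le> t} x \<partial>lborel) *
         (\<integral>\<^sup>+x. ennreal (exp (- (norm x)\<^sup>2 / 2)) * indicator {x. t < norm (M x)} x \<partial>lborel)"
proof -
  have [measurable]: "M \<in> borel_measurable borel"
    using M by (intro borel_measurable_continuous_onI linear_continuous_on) (simp add: linear_linear)
  \<comment> \<open>The reference weight with which \<open>f\<close> is compared: it depends on the
    residual \<open>x - M x\<close> only, and multiplied by the radial factor it is the full
    Gaussian density up to a constant.\<close>
  define f0 where "f0 x = ennreal (exp (- (norm (x - M x))\<^sup>2 / 2))" for x
  have [measurable]: "f0 \<in> borel_measurable borel" unfolding f0_def by measurable
  let ?E = "\<lambda>x. ennreal (exp (- (norm (M x))\<^sup>2 / 2))"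
  have f0E: "f0 x * ?E x = ennreal (exp (- (norm x)\<^sup>2 / 2))" for x
    unfolding f0_def pyth[of x] by (simp add: ennreal_mult[symmetric] exp_add[symmetric] add_divide_distrib)
  define h where "h g s = (\<integral>\<^sup>+x. g x * indicator {x. norm (M x) \<le> s} x \<partial>lborel)" for g :: "'a \<Rightarrow> ennreal" and s
  define a where "a g s = (\<integral>\<^sup>+x. g x * indicator {x. t < norm (M x) \<and> norm (M x) \<le> s} x \<partial>lborel)" for g :: "'a \<Rightarrow> ennreal" and s
  define w where "w s = ennreal (s * exp (- s\<^sup>2 / 2)) * indicator {0..} s" for s :: real
  define I where "I g S = (\<integral>\<^sup>+x. g x * ?E x * indicator S x \<partial>lborel)" for g S
  have [measurable]: "w \<in> borel_measurable borel" unfolding w_def by measurable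
  have layer: "?E x = (\<integral>\<^sup>+s. w s * indicator {x. norm (M x) \<le> s} x \<partial>lborel)" for x
    by (subst nn_integral_layer_exp[of "norm (M x)", symmetric])
       (auto intro!: nn_integral_cong simp: w_def indicator_def intro: order_trans[OF norm_ge_zero])
  have meas[measurable]: "Measurable.pred (lborel \<Otimes>\<^sub>M lborel) (\<lambda>z::'a \<times> real. norm (M (fst z)) \<le> snd z)" by measurable
  have I_layer: "I g S = (\<integral>\<^sup>+s. w s * (\<integral>\<^sup>+x. g x * indicator S x * indicator {x. norm (M x) \<le> s} x \<partial>lborel) \<partial>lborel)"
    if [measurable]: "g \<in> borel_measurable borel" "S \<in> sets borel" for g S
  proof -
    have "I g S = (\<integral>\<^sup>+x. (\<integral>\<^sup>+s. w s * (g x * indicator S x * indicator {x. norm (M x) \<le> s} x) \<partial>lborel) \<partial>lborel)"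
      unfolding I_def layer
    proof (rule nn_integral_cong)
      fix x
      show "g x * (\<integral>\<^sup>+s. w s * indicator {x. norm (M x) \<le> s} x \<partial>lborel) * indicator S x =
          (\<integral>\<^sup>+s. w s * (g x * indicator S x * indicator {x. norm (M x) \<le> s} x) \<partial>lborel)"
        by (subst nn_integral_cmult[symmetric], simp, subst nn_integral_multc[symmetric], simp)
          (simp add: mult_ac)
    qed
    also have "\<dots> = (\<integral>\<^sup>+s. (\<integral>\<^sup>+x. w s * (g x * indicator S x * indicator {x. norm (M x) \<le> s} x) \<partial>lborel) \<partial>lborel)"
      by (rule lborel_pair.Fubini') (simp add: split_def)
    also have "\<dots> = (\<integral>\<^sup>+s. w s * (\<integral>\<^sup>+x. g x * indicator S x * indicator {x. norm (M x) \<le> s} x \<partial>lborel) \<partial>lborel)"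
      by (intro nn_integral_cong nn_integral_cmult) measurable
    finally show ?thesis .
  qed
  have I_le: "I g {x. norm (M x) \<le> t} = (\<integral>\<^sup>+s. w s * h g (min s t) \<partial>lborel)"
    if [measurable]: "g \<in> borel_measurable borel" for g
    unfolding h_def
    by (subst I_layer, simp, simp, intro nn_integral_cong arg_cong[where f="\<lambda>u. w _ * u"], auto simp: indicator_def)
  have I_gt: "I g {x. t < norm (M x)} = (\<integral>\<^sup>+s. w s * a g s \<partial>lborel)"
    if [measurable]: "g \<in> borel_measurable borel" for g
    unfolding a_def
    by (subst I_layer, simp, simp, intro nn_integral_cong arg_cong[where f="\<lambda>u. w _ * u"], auto simp: indicator_def)

  \<comment> \<open>\<open>T r\<close> scales the component along the range of \<open>M\<close> and
    fixes the residual. Shrinking does not decrease \<open>f\<close>, while \<open>f0\<close> is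
    unchanged by every \<open>T r\<close>.\<close>
  define T where "T r x = x - M x + r *\<^sub>R M x" for r :: real and x
  have MT: "M (T r x) = r *\<^sub>R M x" for r x
    using M by (simp add: T_def linear_add linear_diff linear_cmul idem)
  have TT: "T r (T r' x) = T (r * r') x" for r r' x
    unfolding T_def[of r] MT by (simp add: T_def)
  have T1: "T 1 x = x" for x by (simp add: T_def)
  have linT: "linear (T r)" for r
    unfolding T_def using M by (intro linear_compose_add linear_compose_sub linear_compose_scale_right linear_ident)
  have [measurable]: "T r \<in> borel_measurable borel" for r unfolding T_def by measurable
  have rayT: "f x \<le> f (T r x)" if "0 < r" "r \<le> 1" for x r using ray[OF that] by (simp add: T_def)
  have f0T: "f0 (T r x) = f0 x" for r x by (simp add: f0_def MT) (simp add: T_def)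
  have scale: "\<exists>c. 0 < c \<and> c < \<infinity> \<and> (\<forall>g \<in> borel_measurable borel. (\<integral>\<^sup>+x. g (T (s / t) x) * indicator {x. norm (M x) \<le> t} x \<partial>lborel) = c * h g s)"
    if "0 < s" for s
  proof -
    have "T (s / t) (T (t / s) x) = x" "T (t / s) (T (s / t) x) = x" for x
      using that t by (simp_all add: TT T1)
    then obtain c where c: "0 < c" "c < \<infinity>" "distr lborel borel (T (s / t)) = scale_measure c lborel"
      using distr_lborel_linear[OF linT linT] by metis
    have "(\<integral>\<^sup>+x. g (T (s / t) x) * indicator {x. norm (M x) \<le> t} x \<partial>lborel) = c * h g s"
      if [measurable]: "g \<in> borel_measurable borel" for g
    proof -
      have "(s / t) * norm (M x) \<le> s \<longleftrightarrow> norm (M x) \<le> t" for x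
        using t \<open>0 < s\<close> by (simp add: field_simps)
      then have "(\<integral>\<^sup>+x. g (T (s / t) x) * indicator {x. norm (M x) \<le> t} x \<partial>lborel)
        = (\<integral>\<^sup>+x. g (T (s / t) x) * indicator {x. norm (M x) \<le> s} (T (s / t) x) \<partial>lborel)"
        using t \<open>0 < s\<close> by (intro nn_integral_cong) (simp add: indicator_def MT)
      also have "\<dots> = (\<integral>\<^sup>+x. g x * indicator {x. norm (M x) \<le> s} x \<partial>distr lborel borel (T (s / t)))"
        by (subst nn_integral_distr) auto
      also have "\<dots> = c * h g s" unfolding c(3) h_def by (subst nn_integral_scale_measure) auto
      finally show ?thesis .
    qed
    with c show ?thesis by blast
  qed
  \<comment> \<open>Together with \<open>down\<close> this compares the ratio
    \<open>h f s / h f0 s\<close> with its value at \<open>t\<close>: not larger beyond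
    \<open>t\<close>, not smaller before it. The unknown scaling factor \<open>c\<close> affects
    \<open>f\<close> and \<open>f0\<close> alike and disappears.\<close>
  have up: "h f s * h f0 t \<le> h f t * h f0 s" if "t \<le> s" for s
  proof -
    have s: "0 < s" using t that by simp
    obtain c where c: "0 < c" "c < \<infinity>" "\<And>g. g \<in> borel_measurable borel \<Longrightarrow>
        (\<integral>\<^sup>+x. g (T (s / t) x) * indicator {x. norm (M x) \<le> t} x \<partial>lborel) = c * h g s"
      using scale[OF s] by metis
    have "f (T (s / t) x) \<le> f x" for x
      using rayT[of "t / s" "T (s / t) x"] t s that by (simp add: TT T1)
    then have 1: "c * h f s \<le> h f t"
      unfolding c(3)[OF f, symmetric] unfolding h_def by (intro nn_integral_mono mult_right_mono) auto
    have 2: "h f0 t = c * h f0 s"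
      by (subst c(3)[symmetric]) (auto simp: f0T h_def)
    have "h f s * h f0 t = (c * h f s) * h f0 s" unfolding 2 by (simp add: mult_ac)
    also have "\<dots> \<le> h f t * h f0 s" by (intro mult_right_mono 1) simp
    finally show ?thesis .
  qed
  have down: "h f t * h f0 s \<le> h f s * h f0 t" if "s \<le> t" "0 < s" for s
  proof -
    obtain c where c: "0 < c" "c < \<infinity>" "\<And>g. g \<in> borel_measurable borel \<Longrightarrow>
        (\<integral>\<^sup>+x. g (T (s / t) x) * indicator {x. norm (M x) \<le> t} x \<partial>lborel) = c * h g s"
      using scale[OF \<open>0 < s\<close>] by metis
    have "f x \<le> f (T (s / t) x)" for x
      using rayT[of "s / t" x] t that by simp
    then have 1: "h f t \<le> c * h f s"
      unfolding c(3)[OF f, symmetric] unfolding h_def by (intro nn_integral_mono mult_right_mono) auto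
    have 2: "h f0 t = c * h f0 s"
      by (subst c(3)[symmetric]) (auto simp: f0T h_def)
    have "h f t * h f0 s \<le> c * h f s * h f0 s" by (intro mult_right_mono 1) simp
    also have "\<dots> = h f s * h f0 t" unfolding 2 by (simp add: mult_ac)
    finally show ?thesis .
  qed

  have hfin: "h g t < \<infinity>" if [measurable]: "g \<in> borel_measurable borel" and "(\<integral>\<^sup>+x. g x * ?E x \<partial>lborel) < \<infinity>" for g
  proof -
    have "h g t \<le> (\<integral>\<^sup>+x. ennreal (exp (t\<^sup>2 / 2)) * (g x * ?E x) \<partial>lborel)"
      unfolding h_def
    proof (rule nn_integral_mono)
      fix x
      show "g x * indicator {x. norm (M x) \<le> t} x \<le> ennreal (exp (t\<^sup>2 / 2)) * (g x * ?E x)"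
      proof (cases "norm (M x) \<le> t")
        case True
        then have "(norm (M x))\<^sup>2 \<le> t\<^sup>2" by (intro power_mono) auto
        then have "1 \<le> exp (t\<^sup>2 / 2) * exp (- (norm (M x))\<^sup>2 / 2)" by (simp add: exp_add[symmetric])
        then have "1 \<le> ennreal (exp (t\<^sup>2 / 2)) * ?E x" by (simp add: ennreal_mult[symmetric])
        then have "g x * 1 \<le> g x * (ennreal (exp (t\<^sup>2 / 2)) * ?E x)" by (intro mult_left_mono) auto
        then show ?thesis using True by (simp add: mult_ac)
      qed simp
    qed
    also have "\<dots> = ennreal (exp (t\<^sup>2 / 2)) * (\<integral>\<^sup>+x. g x * ?E x \<partial>lborel)"
      by (rule nn_integral_cmult) measurable
    also have "\<dots> < \<infinity>" using that by (simp add: ennreal_mult_less_top)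
    finally show ?thesis .
  qed
  have hf: "h f t < \<infinity>" using fin by (intro hfin) auto
  have hf0: "h f0 t < \<infinity>" using fin0 by (intro hfin) (simp_all only: f0E, simp)
  have split: "h g s = h g t + a g s" if "t \<le> s" and [measurable]: "g \<in> borel_measurable borel" for g s
    unfolding h_def a_def using that
    by (subst nn_integral_add[symmetric]) (auto intro!: nn_integral_cong simp: indicator_def)
  have ann: "a f s * h f0 t \<le> h f t * a f0 s" for s
  proof (cases "t \<le> s")
    case True
    have "(h f t + a f s) * h f0 t \<le> h f t * (h f0 t + a f0 s)"
      using up[OF True] True by (simp add: split[symmetric])
    then have "h f t * h f0 t + a f s * h f0 t \<le> h f t * h f0 t + h f t * a f0 s"
      by (simp add: distrib_left distrib_right)
    moreover have "h f t * h f0 t < \<infinity>" using hf hf0 by (simp add: ennreal_mult_less_top)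
    ultimately show ?thesis by (auto simp: ennreal_add_left_cancel_le)
  next
    case False
    then have "{x. t < norm (M x) \<and> norm (M x) \<le> s} = {}" by auto
    then show ?thesis by (simp add: a_def)
  qed
  have [measurable]: "(\<lambda>s. h g s) \<in> borel_measurable borel" "(\<lambda>s. a g s) \<in> borel_measurable borel"
    if [measurable]: "g \<in> borel_measurable borel" for g
    unfolding h_def a_def by measurable
  have A: "I f {x. t < norm (M x)} * h f0 t \<le> h f t * I f0 {x. t < norm (M x)}"
  proof -
    have "I f {x. t < norm (M x)} * h f0 t = (\<integral>\<^sup>+s. w s * (a f s * h f0 t) \<partial>lborel)"
      by (simp add: I_gt nn_integral_multc[symmetric] mult.assoc)
    also have "\<dots> \<le> (\<integral>\<^sup>+s. w s * (h f t * a f0 s) \<partial>lborel)"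
      by (intro nn_integral_mono mult_left_mono ann) simp
    also have "\<dots> = h f t * I f0 {x. t < norm (M x)}"
      by (simp add: I_gt nn_integral_cmult[symmetric] mult.left_commute)
    finally show ?thesis .
  qed
  have B: "h f t * I f0 {x. norm (M x) \<le> t} \<le> I f {x. norm (M x) \<le> t} * h f0 t"
  proof -
    have "h f t * I f0 {x. norm (M x) \<le> t} = (\<integral>\<^sup>+s. w s * (h f t * h f0 (min s t)) \<partial>lborel)"
      by (simp add: I_le nn_integral_cmult[symmetric] mult.left_commute)
    also have "\<dots> \<le> (\<integral>\<^sup>+s. w s * (h f (min s t) * h f0 t) \<partial>lborel)"
    proof (intro nn_integral_mono)
      fix s show "w s * (h f t * h f0 (min s t)) \<le> w s * (h f (min s t) * h f0 t)"
        using t by (cases "0 < s") (auto intro!: mult_left_mono down simp: w_def indicator_def)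
    qed
    also have "\<dots> = I f {x. norm (M x) \<le> t} * h f0 t"
      by (simp add: I_le nn_integral_multc[symmetric] mult.assoc)
    finally show ?thesis .
  qed
  have pos: "h f0 t \<noteq> 0"
  proof
    assume "h f0 t = 0"
    then have "AE x in lborel. f0 x * indicator {x. norm (M x) \<le> t} x = 0"
      unfolding h_def by (subst (asm) nn_integral_0_iff_AE) auto
    moreover have "x \<notin> ball 0 t" if "f0 x * indicator {x. norm (M x) \<le> t} x = 0" for x
    proof -
      have "t < norm (M x)" using that by (auto simp: f0_def indicator_def split: if_splits)
      moreover have "(norm (M x))\<^sup>2 \<le> (norm x)\<^sup>2" using pyth[of x] by simp
      then have "norm (M x) \<le> norm x" by (rule power2_le_imp_le) simp
      ultimately show "x \<notin> ball 0 t" by simp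
    qed
    ultimately have "AE x in lborel. x \<notin> ball (0::'a) t" by (rule eventually_mono)
    then have "emeasure lborel (ball (0::'a) t) = 0"
      by (subst (asm) AE_iff_measurable[of "ball 0 t"]) (simp, auto simp del: mem_ball)
    then show False using emeasure_ball[of t "0::'a"] unit_ball_vol_pos[of "real DIM('a)"] t by simp
  qed
  \<comment> \<open>Chaining \<open>A\<close> and \<open>B\<close> eliminates \<open>h f t\<close>;
    the common factor \<open>h f0 t\<close> is positive and finite and may be cancelled.\<close>
  have "I f {x. t < norm (M x)} * I f0 {x. norm (M x) \<le> t} * h f0 t
      \<le> h f t * I f0 {x. t < norm (M x)} * I f0 {x. norm (M x) \<le> t}"
    using mult_right_mono[OF A, of "I f0 {x. norm (M x) \<le> t}"] by (simp add: mult_ac)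
  also have "\<dots> \<le> I f {x. norm (M x) \<le> t} * I f0 {x. t < norm (M x)} * h f0 t"
    using mult_right_mono[OF B, of "I f0 {x. t < norm (M x)}"] by (simp add: mult_ac)
  finally have "h f0 t * (I f {x. t < norm (M x)} * I f0 {x. norm (M x) \<le> t}) \<le> h f0 t * (I f {x. norm (M x) \<le> t} * I f0 {x. t < norm (M x)})"
    by (simp only: mult.commute[of "h f0 t"])
  then have "I f {x. t < norm (M x)} * I f0 {x. norm (M x) \<le> t} \<le> I f {x. norm (M x) \<le> t} * I f0 {x. t < norm (M x)}"
    using pos hf0 by (subst (asm) ennreal_mult_le_mult_iff) auto
  then show ?thesis by (simp only: I_def f0E)
qed

section \<open>Orthogonal projections of a Gaussian vector\<close>

definition orth_proj :: "'a::euclidean_space set \<Rightarrow> ('a \<Rightarrow> 'a) \<Rightarrow> bool" where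
  "orth_proj V M \<longleftrightarrow> subspace V \<and> linear M \<and> (\<forall>x. M x \<in> V) \<and> (\<forall>x. \<forall>v\<in>V. (x - M x) \<bullet> v = 0)"

lemma orth_projD:
  assumes "orth_proj V M"
  shows "subspace V" "linear M" "M x \<in> V" "v \<in> V \<Longrightarrow> (x - M x) \<bullet> v = 0" "v \<in> V \<Longrightarrow> v \<bullet> (x - M x) = 0"
  using assms by (auto simp: orth_proj_def inner_commute)

lemma orth_proj_exists:
  assumes "subspace V"
  obtains M where "orth_proj V M"
proof -
  obtain B where B: "B \<subseteq> V" "pairwise orthogonal B" "\<And>x. x \<in> B \<Longrightarrow> norm x = 1" "independent B"
    "card B = dim V" "span B = V"
    using orthonormal_basis_subspace[OF assms] by metis
  then have fin: "finite B" using independent_bound by blast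
  define M where "M x = (\<Sum>b\<in>B. (x \<bullet> b) *\<^sub>R b)" for x
  have "linear M" unfolding M_def
    by (intro linearI) (simp_all add: inner_left_distrib scaleR_add_left sum.distrib scaleR_sum_right)
  moreover have "M x \<in> V" for x unfolding M_def B(6)[symmetric] by (intro span_sum span_scale span_base)
  moreover have "(x - M x) \<bullet> v = 0" if "v \<in> V" for x v
  proof -
    have "v = (\<Sum>b\<in>B. (v \<bullet> b) *\<^sub>R b)"
      using orthonormal_basis_expand[OF B(2,3) _ fin] that B(6) by metis
    then have "x \<bullet> v = (\<Sum>b\<in>B. (v \<bullet> b) * (x \<bullet> b))" by (metis (no_types, lifting) inner_scaleR_right inner_sum_right sum.cong)
    moreover have "M x \<bullet> v = (\<Sum>b\<in>B. (v \<bullet> b) * (x \<bullet> b))"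
      unfolding M_def inner_sum_left inner_scaleR_left
      by (intro sum.cong refl) (simp add: inner_commute[of v] mult.commute)
    ultimately show ?thesis by (simp add: inner_diff_left)
  qed
  ultimately show ?thesis using that assms unfolding orth_proj_def by blast
qed

lemma orth_proj_unique:
  assumes "orth_proj V M" "y \<in> V" "\<And>v. v \<in> V \<Longrightarrow> (x - y) \<bullet> v = 0"
  shows "M x = y"
proof -
  note M = orth_projD[OF assms(1)]
  have "M x - y \<in> V" using M(1,3) assms(2) by (rule subspace_diff)
  then have "(M x - y) \<bullet> (M x - y) = 0"
    using M(4)[of "M x - y" x] assms(3)[of "M x - y"] by (simp add: inner_diff_left)
  then show ?thesis by simp
qed

lemma orth_proj_fix: "orth_proj V M \<Longrightarrow> v \<in> V \<Longrightarrow> M v = v"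
  by (rule orth_proj_unique) auto

lemma orth_proj_pyth:
  assumes "orth_proj V M"
  shows "(norm x)\<^sup>2 = (norm (x - M x))\<^sup>2 + (norm (M x))\<^sup>2"
  using norm_add_Pythagorean[of "x - M x" "M x"] orth_projD[OF assms] by (simp add: orthogonal_def)

lemma orth_proj_selfadjoint:
  assumes "orth_proj V M"
  shows "M x \<bullet> M y = M x \<bullet> y"
  using orth_projD(5)[OF assms orth_projD(3)[OF assms], of x y] by (simp add: inner_diff_right)

text \<open>Orthonormal bases of \<open>V\<close> and of its orthogonal complement together can be
  indexed by \<open>'n\<close>, and the squared length of \<open>M x\<close> is the sum over the
  indices belonging to \<open>V\<close>.\<close>

lemma distr_norm_orth_proj_chi_squared:
  fixes M :: "real ^ 'n::finite \<Rightarrow> real ^ 'n"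
  assumes M: "orth_proj V M"
  shows "distr std_normal_vec borel (\<lambda>x. (norm (M x))\<^sup>2) = chi_squared (dim V)"
proof -
  note MD = orth_projD[OF M]
  obtain B where B: "B \<subseteq> V" "pairwise orthogonal B" "\<And>x. x \<in> B \<Longrightarrow> norm x = 1" "independent B"
    "card B = dim V" "span B = V"
    using orthonormal_basis_subspace[OF MD(1)] by metis
  define V' where "V' = {y \<in> UNIV. \<forall>x\<in>V. orthogonal x y}"
  have "subspace V'" by (auto simp: V'_def subspace_def orthogonal_def inner_right_distrib)
  then obtain B' where B': "B' \<subseteq> V'" "pairwise orthogonal B'" "\<And>x. x \<in> B' \<Longrightarrow> norm x = 1" "independent B'"
    "card B' = dim V'" "span B' = V'"
    using orthonormal_basis_subspace by metis
  have fin: "finite B" "finite B'" using B(4) B'(4) independent_bound by blast+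
  have disj: "B \<inter> B' = {}"
  proof -
    have "x \<bullet> x = 0" if "x \<in> B" "x \<in> B'" for x
      using that B(1) B'(1) unfolding V'_def orthogonal_def by blast
    then have "x = 0" if "x \<in> B" "x \<in> B'" for x using that by simp
    then show ?thesis using B(3) by force
  qed
  have "card (B \<union> B') = dim V' + dim V" using fin disj B(5) B'(5) by (simp add: card_Un_disjoint)
  also have "\<dots> = CARD('n)"
    using dim_subspace_orthogonal_to_vectors[OF MD(1) subspace_UNIV] by (simp add: V'_def)
  finally obtain b where b: "bij_betw b (UNIV :: 'n set) (B \<union> B')"
    using fin finite_same_card_bij[of "UNIV :: 'n set" "B \<union> B'"] by auto
  have inj: "inj b" and im: "range b = B \<union> B'" using b by (auto simp: bij_betw_def)
  have mix: "orthogonal u v" if "u \<in> B" "v \<in> B'" for u v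
    using that B(1) B'(1) unfolding V'_def by blast
  have orth: "orthogonal u v" if "u \<in> B \<union> B'" "v \<in> B \<union> B'" "u \<noteq> v" for u v
    using that mix B(2) B'(2) unfolding pairwise_def by (metis UnE orthogonal_commute)
  have "b i \<bullet> b j = (if i = j then 1 else 0)" for i j
  proof (cases "i = j")
    case True
    have "norm (b i) = 1" using im B(3) B'(3) by blast
    then show ?thesis using True by (simp add: norm_eq_1)
  next
    case False
    then show ?thesis using orth[of "b i" "b j"] im inj by (auto simp: orthogonal_def inj_def)
  qed
  note chi = distr_std_normal_vec_chi_squared[OF this, of "b -` B"]
  have "b ` (b -` B) = B" using im by (auto simp: image_def vimage_def) (metis UnCI im rangeE)
  then have bb: "bij_betw b (b -` B) B" using inj by (auto simp: bij_betw_def intro: inj_on_subset)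
  have "card (b -` B) = dim V" using bij_betw_same_card[OF bb] B(5) by simp
  moreover have "(norm (M x))\<^sup>2 = (\<Sum>i\<in>b -` B. (b i \<bullet> x)\<^sup>2)" for x
  proof -
    have "(\<Sum>v\<in>B. (M x \<bullet> v) *\<^sub>R v) = M x"
      using orthonormal_basis_expand[OF B(2,3) _ fin(1)] MD(3) B(6) by metis
    then have "M x \<bullet> M x = (\<Sum>v\<in>B. (M x \<bullet> v) * (M x \<bullet> v))"
      by (metis (no_types, lifting) inner_scaleR_right inner_sum_right sum.cong)
    also have "\<dots> = (\<Sum>v\<in>B. (v \<bullet> x)\<^sup>2)"
    proof (rule sum.cong)
      fix v assume "v \<in> B"
      then have "v \<bullet> (x - M x) = 0" using B(1) MD(5) by blast
      then show "(M x \<bullet> v) * (M x \<bullet> v) = (v \<bullet> x)\<^sup>2"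
        by (simp add: inner_diff_right inner_commute power2_eq_square)
    qed simp
    also have "\<dots> = (\<Sum>i\<in>b -` B. (b i \<bullet> x)\<^sup>2)"
      by (rule sum.reindex_bij_betw[OF bb, symmetric])
    finally show ?thesis by (simp add: power2_norm_eq_inner)
  qed
  ultimately show ?thesis using chi by simp
qed

lemma null_sets_std_normal_vec: "negligible S \<Longrightarrow> S \<in> sets borel \<Longrightarrow> S \<in> null_sets (std_normal_vec :: (real ^ 'n::finite) measure)"
proof -
  assume S: "negligible S" "S \<in> sets borel"
  then have "S \<in> null_sets lborel" by (simp add: negligible_iff_null_sets null_sets_completion_iff)
  then have "AE x in lborel. x \<notin> S" by (rule AE_not_in)
  then show ?thesis
    unfolding std_normal_vec_def using S(2) by (subst null_sets_density_iff) (auto elim!: eventually_mono)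
qed

text \<open>The level set lies on the frontier of the convex set where the norm is at most
  \<open>t\<close>, and such frontiers are negligible. A nonzero vector of \<open>V\<close> handles
  \<open>t = 0\<close>, where the level set is an affine subspace.\<close>

lemma negligible_norm_orth_proj_eq:
  fixes M :: "real ^ 'n::finite \<Rightarrow> real ^ 'n"
  assumes M: "orth_proj V M" and V: "dim V \<ge> 1" and t: "0 \<le> t"
  shows "negligible {x. norm (M (x + m)) = t}"
proof -
  note MD = orth_projD[OF M]
  let ?C = "{x. norm (M (x + m)) \<le> t}"
  have cM: "continuous_on UNIV M" using MD(2) by (simp add: linear_continuous_on linear_linear)
  have "convex ?C"
  proof (rule convexI)
    fix x y :: "real ^ 'n" and u v :: real
    assume *: "x \<in> ?C" "y \<in> ?C" "0 \<le> u" "0 \<le> v" "u + v = 1"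
    have "u *\<^sub>R x + v *\<^sub>R y + m = u *\<^sub>R (x + m) + v *\<^sub>R (y + m)"
      using *(5) by (simp add: algebra_simps scaleR_left_distrib[symmetric])
    then have "M (u *\<^sub>R x + v *\<^sub>R y + m) = u *\<^sub>R M (x + m) + v *\<^sub>R M (y + m)"
      using MD(2) by (simp only: linear_add linear_cmul)
    then have "norm (M (u *\<^sub>R x + v *\<^sub>R y + m)) \<le> u * norm (M (x + m)) + v * norm (M (y + m))"
      using * norm_triangle_ineq[of "u *\<^sub>R M (x + m)" "v *\<^sub>R M (y + m)"] by simp
    also have "\<dots> \<le> u * t + v * t" using * by (intro add_mono mult_left_mono) auto
    also have "\<dots> = t" using *(5) by (metis distrib_right mult_1)
    finally show "u *\<^sub>R x + v *\<^sub>R y \<in> ?C" by simp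
  qed
  then have "negligible (frontier ?C)" by (rule negligible_convex_frontier)
  moreover have "{x. norm (M (x + m)) = t} \<subseteq> frontier ?C"
  proof
    fix x assume "x \<in> {x. norm (M (x + m)) = t}"
    then have x: "norm (M (x + m)) = t" by simp
    obtain v0 where v0: "v0 \<in> V" "v0 \<noteq> 0" using V by (metis One_nat_def dim_eq_0 not_one_le_zero subsetI singletonI)
    \<comment> \<open>A direction that leaves the convex set at once: radial where
      \<open>M (x + m)\<close> is nonzero, an arbitrary nonzero vector of \<open>V\<close> where it
      vanishes.\<close>
    define u where "u = (if M (x + m) = 0 then v0 else M (x + m))"
    have u: "M u = u" "u \<noteq> 0" using v0 MD(3) by (auto simp: u_def orth_proj_fix[OF M])
    have out: "x + e *\<^sub>R u \<notin> ?C" if "e > 0" for e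
    proof -
      have eq: "M (x + e *\<^sub>R u + m) = M (x + m) + e *\<^sub>R u"
        using MD(2) u(1) by (simp add: linear_add linear_cmul)
      show ?thesis
      proof (cases "M (x + m) = 0")
        case True then show ?thesis using eq x u that by simp
      next
        case False
        then have "M (x + m) + e *\<^sub>R u = (1 + e) *\<^sub>R M (x + m)" by (simp add: u_def scaleR_left_distrib)
        then have "norm (M (x + e *\<^sub>R u + m)) = (1 + e) * t" using eq x that by simp
        then show ?thesis using False x that by (simp add: algebra_simps) (smt (verit) mult_pos_pos zero_less_norm_iff)
      qed
    qed
    have "x \<notin> interior ?C"
    proof
      assume "x \<in> interior ?C"
      then obtain e where e: "e > 0" "ball x e \<subseteq> ?C" by (metis mem_interior)
      have "x + (e / (2 * norm u)) *\<^sub>R u \<in> ball x e" using u(2) e(1) by (simp add: dist_norm)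
      then show False using out[of "e / (2 * norm u)"] e u(2) by auto
    qed
    moreover have "closed ?C"
      by (intro closed_Collect_le continuous_intros continuous_on_compose2[OF cM]) auto
    ultimately show "x \<in> frontier ?C" using x by (simp add: frontier_def)
  qed
  ultimately show ?thesis by (rule negligible_subset)
qed

text \<open>By right-continuity of the distribution function the infimum defining the quantile
  belongs to its set, whence the tail bound. The kernel of \<open>M\<close> is null, so the
  distribution function vanishes at 0 and \<open>c\<close> is positive, which makes
  \<open>sqrt c\<close> an admissible radius in the tail comparison.\<close>

lemma measure_orth_proj_quantile:
  fixes M :: "real ^ 'n::finite \<Rightarrow> real ^ 'n"
  assumes M: "orth_proj V M" and V: "dim V \<ge> 1" and \<alpha>: "0 < \<alpha>" "\<alpha> < 1"
  defines "c \<equiv> quantile (chi_squared (dim V)) (1 - \<alpha>)"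
  shows "0 < c" and "measure std_normal_vec {x. sqrt c < norm (M x)} \<le> \<alpha>"
proof -
  note MD = orth_projD[OF M]
  interpret N: prob_space "std_normal_vec :: (real ^ 'n) measure" by (rule prob_space_std_normal_vec)
  have [measurable]: "M \<in> borel_measurable borel"
    using MD(2) by (intro borel_measurable_continuous_onI linear_continuous_on) (simp add: linear_linear)
  let ?Q = "chi_squared (dim V)"
  have Q: "?Q = distr std_normal_vec borel (\<lambda>x. (norm (M x))\<^sup>2)"
    using distr_norm_orth_proj_chi_squared[OF M] by simp
  interpret Q: real_distribution ?Q
    unfolding Q by (intro real_distribution.intro N.prob_space_distr) (simp_all add: real_distribution_axioms_def)
  have cdf: "cdf ?Q y = measure std_normal_vec {x. (norm (M x))\<^sup>2 \<le> y}" for y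
    unfolding cdf_def by (subst Q, subst measure_distr) (auto simp: vimage_def)
  have cdf0: "cdf ?Q y = 0" if "y \<le> 0" for y
  proof -
    have "negligible {x. norm (M x) = 0}" using negligible_norm_orth_proj_eq[OF M V, of 0 0] by simp
    then have "{x. norm (M x) = 0} \<in> null_sets std_normal_vec" by (rule null_sets_std_normal_vec) measurable
    then have "measure std_normal_vec {x. norm (M x) = 0} = 0"
      by (auto simp: measure_def dest: null_setsD1)
    moreover have "measure std_normal_vec {x. (norm (M x))\<^sup>2 \<le> y} \<le> measure std_normal_vec {x. norm (M x) = 0}"
    proof (rule N.finite_measure_mono)
      show "{x. (norm (M x))\<^sup>2 \<le> y} \<subseteq> {x. norm (M x) = 0}"
        using that by (auto dest!: order_trans[OF _ that])
    qed measurable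
    ultimately show ?thesis using cdf[of y] Q.cdf_nonneg[of y] by linarith
  qed
  let ?S = "{x. 1 - \<alpha> \<le> cdf ?Q x}"
  have "eventually (\<lambda>x. 1 - \<alpha> < cdf ?Q x) at_top"
    using \<alpha> by (intro order_tendstoD(1)[OF Q.cdf_lim_at_top_prob]) simp
  then have ne: "?S \<noteq> {}" by (auto simp: eventually_at_top_linorder intro: less_imp_le)
  have pos: "0 < x" if "x \<in> ?S" for x using that cdf0[of x] \<alpha> by (cases "x \<le> 0") auto
  have bdd: "bdd_below ?S" using pos by (auto intro!: bdd_belowI[of _ 0] less_imp_le)
  have c_def': "c = Inf ?S" by (simp add: c_def quantile_def)
  have ev: "1 - \<alpha> \<le> cdf ?Q x" if "c < x" for x
  proof -
    have "Inf ?S < x" using that c_def' by simp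
    from cInf_lessD[OF ne this] obtain y where "y \<in> ?S" "y < x" by blast
    then show ?thesis using Q.cdf_nondecreasing[of y x] by auto
  qed
  have "1 - \<alpha> \<le> cdf ?Q c"
  proof (rule tendsto_lowerbound)
    show "(cdf ?Q \<longlongrightarrow> cdf ?Q c) (at_right c)"
      using Q.cdf_is_right_cont[of c] by (simp add: continuous_within)
    show "\<forall>\<^sub>F x in at_right c. 1 - \<alpha> \<le> cdf ?Q x"
      using ev by (auto simp: eventually_at_right_field intro!: exI[of _ "c + 1"])
  qed simp
  then show c: "0 < c" using pos by simp
  have "measure std_normal_vec (space std_normal_vec - {x. norm (M x) \<le> sqrt c})
      = 1 - measure std_normal_vec {x. norm (M x) \<le> sqrt c}"
    by (rule N.prob_compl) measurable
  moreover have "space std_normal_vec - {x. norm (M x) \<le> sqrt c} = {x. sqrt c < norm (M x)}" by auto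
  moreover have "{x. norm (M x) \<le> sqrt c} = {x. (norm (M x))\<^sup>2 \<le> c}"
    using c by (auto simp: real_le_rsqrt sqrt_ge_absD intro: real_le_rsqrt dest: sqrt_ge_absD)
  ultimately show "measure std_normal_vec {x. sqrt c < norm (M x)} \<le> \<alpha>"
    using \<open>1 - \<alpha> \<le> cdf ?Q c\<close> cdf[of c] by simp
qed

text \<open>In terms of \<open>y = x + m\<close> the density on \<open>A\<close> is, up to a
  constant, the radial factor in \<open>M y\<close> times the weight \<open>f\<close> below, which
  contains \<open>exp (M y \<bullet> m)\<close>. As \<open>M y \<bullet> m \<le> 0\<close> on
  \<open>A\<close>, shrinking \<open>M y\<close> does not decrease \<open>f\<close>, and
  \<open>gaussian_ray_monotone_tail\<close> applies.\<close>

lemma std_normal_vec_shifted_ray_monotone_tail: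
  fixes M :: "real ^ 'n::finite \<Rightarrow> real ^ 'n"
  assumes M: "orth_proj V M" and V: "dim V \<ge> 1" and \<alpha>: "0 < \<alpha>" "\<alpha> < 1"
    and A [measurable]: "A \<in> sets borel"
    and ray: "\<And>y s. y \<in> A \<Longrightarrow> 0 < s \<Longrightarrow> s \<le> 1 \<Longrightarrow> y - M y + s *\<^sub>R M y \<in> A"
    and neg: "\<And>y. y \<in> A \<Longrightarrow> M y \<bullet> m \<le> 0"
  defines "t \<equiv> sqrt (quantile (chi_squared (dim V)) (1 - \<alpha>))"
  shows "measure std_normal_vec {x. x + m \<in> A \<and> t \<le> norm (M (x + m))} \<le> \<alpha> * measure std_normal_vec {x. x + m \<in> A}"
proof -
  note MD = orth_projD[OF M]
  let ?N = "std_normal_vec :: (real ^ 'n) measure"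
  interpret N: prob_space ?N by (rule prob_space_std_normal_vec)
  have [measurable]: "M \<in> borel_measurable borel"
    using MD(2) by (intro borel_measurable_continuous_onI linear_continuous_on) (simp add: linear_linear)
  have t: "0 < t" and tail: "measure ?N {x. t < norm (M x)} \<le> \<alpha>"
    using measure_orth_proj_quantile[OF M V \<alpha>] by (simp_all add: t_def)
  define C where "C = (1 / sqrt (2 * pi)) ^ CARD('n)"
  have C: "0 < C" by (simp add: C_def)
  let ?e = "\<lambda>x::real^'n. ennreal (exp (- (norm x)\<^sup>2 / 2))"
  have N_eq: "emeasure ?N S = C * (\<integral>\<^sup>+x. ?e x * indicator S x \<partial>lborel)" if [measurable]: "S \<in> sets borel" for S
    unfolding std_normal_vec_eq C_def[symmetric] using C
    by (subst emeasure_density) (auto simp: ennreal_mult nn_integral_cmult mult.assoc)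
  have N_shift: "emeasure ?N {x. x + m \<in> S} = C * (\<integral>\<^sup>+y. ?e (y - m) * indicator S y \<partial>lborel)"
    if [measurable]: "S \<in> sets borel" for S
  proof -
    have "(\<integral>\<^sup>+y. ?e (y - m) * indicator S y \<partial>lborel) = (\<integral>\<^sup>+y. ?e (y - m) * indicator S y \<partial>distr lborel borel ((+) m))"
      by (simp only: lborel_distr_plus)
    also have "\<dots> = (\<integral>\<^sup>+x. ?e x * indicator {x. x + m \<in> S} x \<partial>lborel)"
      by (subst nn_integral_distr) (auto simp: indicator_def add.commute intro!: nn_integral_cong)
    finally show ?thesis by (subst N_eq) auto
  qed
  \<comment> \<open>Obtained by expanding \<open>(norm (y - m))\<^sup>2\<close> along the range of
    \<open>M\<close> and its complement and leaving out the term
    \<open>(norm (M y))\<^sup>2\<close>.\<close>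
  define f where "f y = ennreal (exp (- (norm (y - M y - (m - M m)))\<^sup>2 / 2 + M y \<bullet> m - (norm (M m))\<^sup>2 / 2)) * indicator A y" for y
  have [measurable]: "f \<in> borel_measurable borel" unfolding f_def by measurable
  have fE: "f y * ?e (M y) = ?e (y - m) * indicator A y" for y
  proof -
    have lin: "M (y - m) = M y - M m" using MD(2) by (rule linear_diff)
    have "(norm (y - m))\<^sup>2 = (norm (y - M y - (m - M m)))\<^sup>2 + (norm (M y - M m))\<^sup>2"
      using orth_proj_pyth[OF M, of "y - m"] unfolding lin by (simp add: algebra_simps)
    also have "(norm (M y - M m))\<^sup>2 = (norm (M y))\<^sup>2 - 2 * (M y \<bullet> m) + (norm (M m))\<^sup>2"
      using orth_proj_selfadjoint[OF M, of y m]
      by (simp add: power2_norm_eq_inner inner_diff_left inner_diff_right inner_commute)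
    finally have "- (norm (y - m))\<^sup>2 / 2 = (- (norm (y - M y - (m - M m)))\<^sup>2 / 2 + M y \<bullet> m - (norm (M m))\<^sup>2 / 2) + - (norm (M y))\<^sup>2 / 2"
      by (simp add: field_simps)
    then show ?thesis unfolding f_def by (simp only: exp_add ennreal_mult exp_ge_zero mult_ac)
  qed
  have total: "(\<integral>\<^sup>+x. ?e x \<partial>lborel) < \<infinity>"
  proof -
    have "C * (\<integral>\<^sup>+x. ?e x \<partial>lborel) = 1" using N_eq[of UNIV] N.emeasure_space_1 by simp
    then show ?thesis using C by (auto simp: less_top[symmetric] ennreal_mult_eq_top_iff)
  qed
  have fin: "(\<integral>\<^sup>+x. f x * ?e (M x) \<partial>lborel) < \<infinity>"
  proof -
    have "C * (\<integral>\<^sup>+x. f x * ?e (M x) \<partial>lborel) = emeasure ?N {x. x + m \<in> A}"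
      unfolding fE by (rule N_shift[symmetric]) simp
    also have "\<dots> < \<infinity>" by (simp add: less_top[symmetric])
    finally show ?thesis using C by (auto simp: less_top[symmetric] ennreal_mult_eq_top_iff)
  qed
  have idem: "M (M x) = M x" for x using orth_proj_fix[OF M MD(3)] .
  have f_ray: "f y \<le> f (y - M y + s *\<^sub>R M y)" if s: "0 < s" "s \<le> 1" for y s
  proof (cases "y \<in> A")
    case True
    let ?y = "y - M y + s *\<^sub>R M y"
    have My: "M ?y = s *\<^sub>R M y" using MD(2) by (simp add: linear_add linear_diff linear_cmul idem)
    have "M y \<bullet> m \<le> s * (M y \<bullet> m)" using neg[OF True] s mult_right_mono_neg[of s 1 "M y \<bullet> m"] by simp
    moreover have "?y \<in> A" by (rule ray[OF True s])
    moreover have "?y - M ?y = y - M y" unfolding My by simp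
    ultimately show ?thesis using True unfolding f_def My by (auto intro!: ennreal_leI)
  qed (simp add: f_def)
  have key: "(\<integral>\<^sup>+x. f x * ?e (M x) * indicator {x. t < norm (M x)} x \<partial>lborel) *
         (\<integral>\<^sup>+x. ?e x * indicator {x. norm (M x) \<le> t} x \<partial>lborel) \<le>
         (\<integral>\<^sup>+x. f x * ?e (M x) * indicator {x. norm (M x) \<le> t} x \<partial>lborel) *
         (\<integral>\<^sup>+x. ?e x * indicator {x. t < norm (M x)} x \<partial>lborel)"
    by (rule gaussian_ray_monotone_tail[OF MD(2) idem orth_proj_pyth[OF M] _ f_ray fin total t]) auto
  define X where "X = measure ?N {x. x + m \<in> A \<and> t < norm (M (x + m))}"
  define Y where "Y = measure ?N {x. x + m \<in> A \<and> norm (M (x + m)) \<le> t}"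
  define \<beta> where "\<beta> = measure ?N {x. t < norm (M x)}"
  have XY: "emeasure ?N {x. x + m \<in> A \<and> R (x + m)} = C * (\<integral>\<^sup>+x. f x * ?e (M x) * indicator {x. R x} x \<partial>lborel)"
    if [measurable]: "Measurable.pred borel R" for R
  proof -
    have "emeasure ?N {x. x + m \<in> {y. y \<in> A \<and> R y}} = C * (\<integral>\<^sup>+y. ?e (y - m) * indicator {y. y \<in> A \<and> R y} y \<partial>lborel)"
      by (rule N_shift) measurable
    also have "(\<integral>\<^sup>+y. ?e (y - m) * indicator {y. y \<in> A \<and> R y} y \<partial>lborel) = (\<integral>\<^sup>+x. f x * ?e (M x) * indicator {x. R x} x \<partial>lborel)"
      unfolding fE by (intro nn_integral_cong) (auto simp: indicator_def)
    finally show ?thesis by simp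
  qed
  have compl: "measure ?N {x. norm (M x) \<le> t} = 1 - \<beta>"
  proof -
    have "measure ?N (space ?N - {x. t < norm (M x)}) = 1 - \<beta>" unfolding \<beta>_def by (rule N.prob_compl) measurable
    moreover have "space ?N - {x. t < norm (M x)} = {x. norm (M x) \<le> t}" by auto
    ultimately show ?thesis by simp
  qed
  have "ennreal X * ennreal (1 - \<beta>) \<le> ennreal Y * ennreal \<beta>"
  proof -
    have "ennreal X * ennreal (1 - \<beta>) = (ennreal C * ennreal C) * ((\<integral>\<^sup>+x. f x * ?e (M x) * indicator {x. t < norm (M x)} x \<partial>lborel) *
         (\<integral>\<^sup>+x. ?e x * indicator {x. norm (M x) \<le> t} x \<partial>lborel))"
      unfolding X_def compl[symmetric] N.emeasure_eq_measure[symmetric] by (subst XY, simp, subst N_eq) (auto simp: mult_ac)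
    also have "\<dots> \<le> (ennreal C * ennreal C) * ((\<integral>\<^sup>+x. f x * ?e (M x) * indicator {x. norm (M x) \<le> t} x \<partial>lborel) *
         (\<integral>\<^sup>+x. ?e x * indicator {x. t < norm (M x)} x \<partial>lborel))"
      by (intro mult_left_mono key) simp
    also have "\<dots> = ennreal Y * ennreal \<beta>"
      unfolding Y_def \<beta>_def N.emeasure_eq_measure[symmetric] by (subst XY, simp, subst N_eq) (auto simp: mult_ac)
    finally show ?thesis .
  qed
  moreover have nn: "0 \<le> X" "0 \<le> Y" "0 \<le> \<beta>" "\<beta> \<le> 1" by (simp_all add: X_def Y_def \<beta>_def)
  ultimately have "X * (1 - \<beta>) \<le> Y * \<beta>" by (simp add: ennreal_mult[symmetric])
  then have "X \<le> \<beta> * (X + Y)" by (simp add: algebra_simps)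
  also have "\<dots> \<le> \<alpha> * (X + Y)" using tail nn by (intro mult_right_mono) (auto simp: \<beta>_def)
  finally have XXY: "X \<le> \<alpha> * (X + Y)" .
  have split: "measure ?N {x. x + m \<in> A} = X + Y"
    unfolding X_def Y_def
    by (subst N.finite_measure_Union[symmetric]) (auto intro!: arg_cong[where f="measure ?N"])
  \<comment> \<open>The comparison concerned the open tail; as the sphere is null, it extends to the
    weak inequality, which is the one that survives limits.\<close>
  have "{x. norm (M (x + m)) = t} \<in> null_sets ?N"
    using negligible_norm_orth_proj_eq[OF M V, of t m] t by (intro null_sets_std_normal_vec) auto
  then have "measure ?N {x. norm (M (x + m)) = t} = 0" by (auto simp: measure_def dest: null_setsD1)
  moreover have "measure ?N {x. x + m \<in> A \<and> t \<le> norm (M (x + m))} \<le> measure ?N ({x. x + m \<in> A \<and> t < norm (M (x + m))} \<union> {x. norm (M (x + m)) = t})"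
    by (intro N.finite_measure_mono) auto
  moreover have "\<dots> \<le> X + measure ?N {x. norm (M (x + m)) = t}"
    unfolding X_def by (intro measure_Un_le) auto
  ultimately show ?thesis using XXY split by simp
qed

section \<open>The Gaussian limit problem\<close>

text \<open>
  The projection problem in the limit: the coefficients of \<open>a j\<close> are free for \<open>j \<in> F\<close>
  and bounded by \<open>\<mu> j\<close> for \<open>j \<in> J0 - F\<close>; \<open>\<rho>\<close> is the residual.
\<close>

definition active_solution ::
  "('k \<Rightarrow> 'v::euclidean_space) \<Rightarrow> 'k set \<Rightarrow> 'k set \<Rightarrow> ('k \<Rightarrow> real) \<Rightarrow> 'k set \<Rightarrow> 'v \<Rightarrow> ('k \<Rightarrow> real) \<Rightarrow> 'v \<Rightarrow> bool" where
  "active_solution a J0 F \<mu> J x \<delta> \<rho> \<longleftrightarrow>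
     \<rho> = x + (\<Sum>j\<in>J0. \<delta> j *\<^sub>R a j) \<and> (\<forall>j\<in>J. a j \<bullet> \<rho> = 0) \<and> (\<forall>j\<in>J0. a j \<bullet> \<rho> \<le> 0) \<and>
     (\<forall>j\<in>J0 - J. \<delta> j = \<mu> j) \<and> (\<forall>j\<in>J - F. \<delta> j \<le> \<mu> j)"

lemma active_solutionD:
  assumes "active_solution a J0 F \<mu> J x \<delta> \<rho>"
  shows "\<rho> = x + (\<Sum>j\<in>J0. \<delta> j *\<^sub>R a j)" "j \<in> J \<Longrightarrow> a j \<bullet> \<rho> = 0" "j \<in> J0 \<Longrightarrow> a j \<bullet> \<rho> \<le> 0"
    "j \<in> J0 \<Longrightarrow> j \<notin> J \<Longrightarrow> \<delta> j = \<mu> j" "j \<in> J \<Longrightarrow> j \<notin> F \<Longrightarrow> \<delta> j \<le> \<mu> j"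
  using assms unfolding active_solution_def by blast+

text \<open>The variational argument for projections:
  \<open>(\<rho> - \<rho>') \<bullet> \<rho>\<close> is at most 0 term by term, and so is its mirror
  image; their sum is a squared norm. Generators in \<open>F\<close> drop out because
  \<open>F\<close> lies in both active sets. The active sets themselves may differ.\<close>

lemma active_solution_unique:
  assumes "finite J0" "F \<subseteq> J" "F \<subseteq> J'" "J \<subseteq> J0" "J' \<subseteq> J0"
    and *: "active_solution a J0 F \<mu> J x \<delta> \<rho>" "active_solution a J0 F \<mu> J' x \<delta>' \<rho>'"
  shows "\<rho> = \<rho>'"
proof -
  have le: "(\<rho> - \<rho>') \<bullet> \<rho> \<le> 0"
    if "F \<subseteq> J" "F \<subseteq> J'" "J \<subseteq> J0" "J' \<subseteq> J0" "active_solution a J0 F \<mu> J x \<delta> \<rho>" "active_solution a J0 F \<mu> J' x \<delta>' \<rho>'"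
    for J J' \<delta> \<delta>' \<rho> \<rho>'
  proof -
    have "\<rho> - \<rho>' = (\<Sum>j\<in>J0. (\<delta> j - \<delta>' j) *\<^sub>R a j)"
      using that by (simp add: active_solution_def scaleR_left_diff_distrib sum_subtractf)
    then have "(\<rho> - \<rho>') \<bullet> \<rho> = (\<Sum>j\<in>J0. (\<delta> j - \<delta>' j) * (a j \<bullet> \<rho>))"
      by (simp add: inner_sum_left)
    also have "\<dots> \<le> 0"
    proof (rule sum_nonpos)
      fix j assume j: "j \<in> J0"
      show "(\<delta> j - \<delta>' j) * (a j \<bullet> \<rho>) \<le> 0"
      proof (cases "j \<in> J")
        case True
        then have "a j \<bullet> \<rho> = 0" using active_solutionD(2)[OF that(5)] by blast
        then show ?thesis by simp
      next
        case False
        then have "\<delta> j = \<mu> j" "a j \<bullet> \<rho> \<le> 0" using active_solutionD(3,4)[OF that(5)] j by blast+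
        moreover have "\<delta>' j \<le> \<mu> j"
          using active_solutionD(4,5)[OF that(6), of j] that(1) j False by (cases "j \<in> J'") auto
        ultimately show ?thesis by (simp add: mult_nonneg_nonpos)
      qed
    qed
    finally show ?thesis .
  qed
  have "(\<rho> - \<rho>') \<bullet> (\<rho> - \<rho>') \<le> 0"
    using le[OF assms(2,3,4,5) *] le[OF assms(3,2,5,4) *(2,1)] by (simp add: inner_diff_left inner_diff_right inner_commute)
  then show ?thesis by (metis inner_eq_zero_iff inner_ge_zero order_antisym eq_iff_diff_eq_0)
qed

text \<open>For fixed \<open>J\<close> the multipliers outside \<open>J\<close> sit at their bounds
  and contribute the shift \<open>m\<close>, so the residual is the projection
  \<open>M (x + m)\<close> onto the orthogonal complement of the active generators. \<open>G\<close>
  is the piece of the sample space belonging to \<open>J\<close>; \<open>D\<close> contains every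
  point whose residual for \<open>J\<close> reaches the quantile, ties included.\<close>

lemma active_solution_region:
  fixes a :: "'k::finite \<Rightarrow> real ^ 'n::finite"
  assumes inj: "inj_on a J0" and indep: "independent (a ` J0)" and J: "F \<subseteq> J" "J \<subseteq> J0"
    and card: "card J0 < CARD('n)" and \<mu>: "\<And>j. j \<in> J0 \<Longrightarrow> 0 \<le> \<mu> j" and \<alpha>: "0 < \<alpha>" "\<alpha> < 1"
  shows "\<exists>G D. G \<in> sets borel \<and> D \<in> sets borel \<and>
    measure std_normal_vec D \<le> \<alpha> * measure std_normal_vec G \<and>
    (\<forall>x \<delta> \<rho>. active_solution a J0 F \<mu> J x \<delta> \<rho> \<and>
      quantile (chi_squared (CARD('n) - card J)) (1 - \<alpha>) \<le> (norm \<rho>)\<^sup>2 \<longrightarrow> x \<in> D) \<and>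
    (\<forall>x\<in>G. \<exists>\<delta> \<rho>. active_solution a J0 F \<mu> J x \<delta> \<rho> \<and> (\<forall>j\<in>J0 - J. a j \<bullet> \<rho> < 0))"
proof -
  let ?N = "std_normal_vec :: (real ^ 'n) measure"
  interpret N: prob_space ?N by (rule prob_space_std_normal_vec)
  have fin: "finite J0" by simp
  define U where "U = span (a ` J)"
  define V where "V = {v. \<forall>u\<in>U. orthogonal u v}"
  have injJ: "inj_on a J" using inj J(2) inj_on_subset by blast
  have indJ: "independent (a ` J)" using indep J(2) by (meson image_mono independent_mono)
  have U: "subspace U" by (simp add: U_def)
  have V: "subspace V" by (auto simp: V_def subspace_def orthogonal_def inner_right_distrib)
  have "dim V + dim U = CARD('n)"
    using dim_subspace_orthogonal_to_vectors[OF U subspace_UNIV] by (simp add: V_def)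
  moreover have "dim U = card J"
    unfolding U_def dim_span using indJ injJ by (simp add: dim_eq_card_independent card_image)
  ultimately have dimV: "dim V = CARD('n) - card J" by simp
  have "card J \<le> card J0" using J by (simp add: card_mono)
  then have dimV1: "dim V \<ge> 1" using dimV card by simp
  obtain P where P: "orth_proj U P" using orth_proj_exists[OF U] by blast
  define M where "M x = x - P x" for x
  have M: "orth_proj V M"
    unfolding orth_proj_def
  proof (intro conjI allI ballI V)
    show "linear M" unfolding M_def by (intro linear_compose_sub linear_ident orth_projD(2)[OF P])
    show "M x \<in> V" for x
      unfolding M_def V_def orthogonal_def using orth_projD(5)[OF P] by blast
    show "(x - M x) \<bullet> v = 0" if "v \<in> V" for x v
      using that orth_projD(3)[OF P, of x] by (simp add: M_def V_def orthogonal_def)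
  qed
  note MD = orth_projD[OF M]
  have [measurable]: "M \<in> borel_measurable borel"
    using MD(2) by (intro borel_measurable_continuous_onI linear_continuous_on) (simp add: linear_linear)
  have inV: "v \<in> V \<longleftrightarrow> (\<forall>j\<in>J. a j \<bullet> v = 0)" for v
  proof
    assume "v \<in> V"
    then show "\<forall>j\<in>J. a j \<bullet> v = 0" by (auto simp: V_def U_def orthogonal_def intro: span_base)
  next
    assume v: "\<forall>j\<in>J. a j \<bullet> v = 0"
    have "orthogonal v u" if "u \<in> U" for u
      using that v by (intro orthogonal_to_span[of u "a ` J"]) (auto simp: U_def orthogonal_def inner_commute)
    then show "v \<in> V" by (auto simp: V_def orthogonal_commute)
  qed
  \<comment> \<open>The coefficient of \<open>a j\<close> in the active part \<open>P y\<close>; at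
    \<open>y = x + m\<close> the multiplier is its negative.\<close>
  define L where "L j y = representation (a ` J) (P y) (a j)" for j y
  have PU: "P y \<in> span (a ` J)" for y using orth_projD(3)[OF P] by (simp add: U_def)
  have linP: "linear P" by (rule orth_projD(2)[OF P])
  have "linear (L j)" for j
    unfolding L_def using linP
    by (intro linearI) (simp_all add: linear_add linear_cmul representation_add[OF indJ PU PU] representation_scale[OF indJ PU])
  then have [measurable]: "L j \<in> borel_measurable borel" for j
    by (intro borel_measurable_continuous_onI linear_continuous_on) (simp add: linear_linear)
  have L_sum: "P y = (\<Sum>j\<in>J. L j y *\<^sub>R a j)" for y
    using sum_representation_eq[OF indJ PU[of y], of "a ` J"] J fin
    by (simp add: L_def sum.reindex[OF injJ])
  have L_eq: "L j y = \<beta> j" if "P y = (\<Sum>i\<in>J. \<beta> i *\<^sub>R a i)" "j \<in> J" for y \<beta> j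
  proof -
    have "(\<Sum>i\<in>J. (L i y - \<beta> i) *\<^sub>R a i) = 0"
      using that(1) L_sum[of y] by (simp add: scaleR_left_diff_distrib sum_subtractf)
    then have "(\<Sum>v\<in>a ` J. (L (the_inv_into J a v) y - \<beta> (the_inv_into J a v)) *\<^sub>R v) = 0"
      by (simp add: sum.reindex[OF injJ] the_inv_into_f_f[OF injJ])
    then have "L (the_inv_into J a (a j)) y - \<beta> (the_inv_into J a (a j)) = 0"
      using independentD[OF indJ, of "a ` J" "\<lambda>v. L (the_inv_into J a v) y - \<beta> (the_inv_into J a v)" "a j"] that(2) by simp
    then show ?thesis using that(2) by (simp add: the_inv_into_f_f[OF injJ])
  qed
  define m where "m = (\<Sum>j\<in>J0 - J. \<mu> j *\<^sub>R a j)"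
  \<comment> \<open>Scaling \<open>M y\<close> leaves \<open>L j y\<close> alone and preserves the
    signs of \<open>a j \<bullet> M y\<close>, so rays stay in \<open>A\<close>. Strictness is what
    makes the pieces for different \<open>J\<close> disjoint.\<close>
  define A where "A = {y. (\<forall>j\<in>J0 - J. a j \<bullet> M y < 0) \<and> (\<forall>j\<in>J - F. - L j y \<le> \<mu> j)}"
  have [measurable]: "A \<in> sets borel" unfolding A_def by measurable
  define G where "G = {x. x + m \<in> A}"
  have [measurable]: "G \<in> sets borel" unfolding G_def by measurable
  define t where "t = sqrt (quantile (chi_squared (dim V)) (1 - \<alpha>))"
  define D1 where "D1 = {x. x + m \<in> A \<and> t \<le> norm (M (x + m))}"
  \<comment> \<open>The ties, where an inactive generator is orthogonal to the residual as well.
    Linear independence gives \<open>M (a j) \<noteq> 0\<close>, so these are genuine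
    hyperplanes.\<close>
  define H where "H = (\<Union>j\<in>J0 - J. {x. M (a j) \<bullet> x = - (M (a j) \<bullet> m)})"
  have [measurable]: "D1 \<in> sets borel" unfolding D1_def by measurable
  have Hm[measurable]: "H \<in> sets borel" unfolding H_def by (intro sets.finite_UN) (auto intro!: borel_closed closed_hyperplane)
  have PM: "P (y - M y + s *\<^sub>R M y) = P y" "M (y - M y + s *\<^sub>R M y) = s *\<^sub>R M y" for y s
  proof -
    have "P (M y) = 0" using orth_proj_fix[OF P orth_projD(3)[OF P]] linP by (simp add: M_def linear_diff)
    moreover have "P (P y) = P y" by (rule orth_proj_fix[OF P orth_projD(3)[OF P]])
    moreover have "y - M y = P y" by (simp add: M_def)
    ultimately show "P (y - M y + s *\<^sub>R M y) = P y" using linP by (simp add: linear_add linear_cmul)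
    then show "M (y - M y + s *\<^sub>R M y) = s *\<^sub>R M y" by (simp add: M_def)
  qed
  have D1: "measure ?N D1 \<le> \<alpha> * measure ?N G"
    unfolding D1_def G_def t_def
  proof (rule std_normal_vec_shifted_ray_monotone_tail[OF M dimV1 \<alpha>])
    fix y and s :: real assume y: "y \<in> A" and s: "0 < s" "s \<le> 1"
    show "y - M y + s *\<^sub>R M y \<in> A"
      using y s by (auto simp: A_def PM L_def mult_pos_neg)
  next
    fix y assume y: "y \<in> A"
    have "M y \<bullet> m = (\<Sum>j\<in>J0 - J. \<mu> j * (a j \<bullet> M y))"
      by (simp add: m_def inner_sum_right inner_commute)
    also have "\<dots> \<le> 0" using y \<mu> by (intro sum_nonpos mult_nonneg_nonpos) (auto simp: A_def less_imp_le)
    finally show "M y \<bullet> m \<le> 0" .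
  qed simp
  have "negligible H"
    unfolding H_def
  proof (intro negligible_Union ballI)
    show "finite ((\<lambda>j. {x. M (a j) \<bullet> x = - (M (a j) \<bullet> m)}) ` (J0 - J))" by simp
    fix S assume "S \<in> (\<lambda>j. {x. M (a j) \<bullet> x = - (M (a j) \<bullet> m)}) ` (J0 - J)"
    then obtain j where j: "j \<in> J0" "j \<notin> J" and S: "S = {x. M (a j) \<bullet> x = - (M (a j) \<bullet> m)}" by auto
    have "M (a j) \<noteq> 0"
    proof
      assume "M (a j) = 0"
      then have "a j = P (a j)" by (simp add: M_def)
      then have "a j \<in> span (a ` J)" using PU[of "a j"] by simp
      moreover have "a ` J \<subseteq> a ` J0 - {a j}" using j J inj by (auto simp: inj_on_def)
      ultimately have "a j \<in> span (a ` J0 - {a j})" using span_mono by blast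
      then show False using indep j(1) by (auto simp: dependent_def)
    qed
    then show "negligible S" unfolding S by (intro negligible_hyperplane) simp
  qed
  then have "measure ?N H = 0"
    using null_sets_std_normal_vec[of H] Hm by (auto simp: measure_def dest: null_setsD1)
  then have "measure ?N (D1 \<union> H) \<le> \<alpha> * measure ?N G"
    using D1 measure_Un_le[of D1 ?N H] by simp
  moreover have "x \<in> D1 \<union> H" if act: "active_solution a J0 F \<mu> J x \<delta> \<rho>"
    and q: "quantile (chi_squared (CARD('n) - card J)) (1 - \<alpha>) \<le> (norm \<rho>)\<^sup>2" for x \<delta> \<rho>
  proof (cases "x \<in> H")
    case False
    have "(\<Sum>j\<in>J0. \<delta> j *\<^sub>R a j) = (\<Sum>j\<in>J0 - J. \<delta> j *\<^sub>R a j) + (\<Sum>j\<in>J. \<delta> j *\<^sub>R a j)"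
      by (rule sum.subset_diff[OF J(2) fin])
    also have "(\<Sum>j\<in>J0 - J. \<delta> j *\<^sub>R a j) = m"
      unfolding m_def using act by (intro sum.cong) (auto simp: active_solution_def)
    finally have xm: "x + m - \<rho> = (\<Sum>j\<in>J. (- \<delta> j) *\<^sub>R a j)"
      using act by (simp add: active_solution_def sum_negf)
    have "\<rho> \<in> V" using act by (auto simp: inV active_solution_def)
    moreover have "(x + m - \<rho>) \<bullet> v = 0" if "v \<in> V" for v
      unfolding xm using that by (simp add: inV inner_sum_left)
    ultimately have M\<rho>: "M (x + m) = \<rho>" by (rule orth_proj_unique[OF M])
    then have "P (x + m) = (\<Sum>j\<in>J. (- \<delta> j) *\<^sub>R a j)" using xm by (simp add: M_def algebra_simps)
    then have Lj: "L j (x + m) = - \<delta> j" if "j \<in> J" for j by (rule L_eq) (rule that)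
    have "a j \<bullet> \<rho> < 0" if "j \<in> J0 - J" for j
    proof -
      have "M (a j) \<bullet> x \<noteq> - (M (a j) \<bullet> m)" using False that by (auto simp: H_def)
      then have "M (a j) \<bullet> (x + m) \<noteq> 0" by (simp add: inner_add_right)
      then have "a j \<bullet> M (x + m) \<noteq> 0"
        using orth_proj_selfadjoint[OF M, of "a j" "x + m"] orth_proj_selfadjoint[OF M, of "x + m" "a j"]
        by (simp add: inner_commute)
      then show ?thesis using act that unfolding M\<rho> by (auto simp: active_solution_def less_le)
    qed
    then have "x + m \<in> A" using act Lj by (auto simp: A_def M\<rho> active_solution_def)
    moreover have "t \<le> norm (M (x + m))"
      unfolding M\<rho> t_def dimV using q by (metis norm_ge_zero real_sqrt_le_mono real_sqrt_unique)
    ultimately show ?thesis by (simp add: D1_def)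
  qed simp
  moreover have "\<exists>\<delta> \<rho>. active_solution a J0 F \<mu> J x \<delta> \<rho> \<and> (\<forall>j\<in>J0 - J. a j \<bullet> \<rho> < 0)" if "x \<in> G" for x
  proof (intro exI conjI)
    let ?\<delta> = "\<lambda>j. if j \<in> J then - L j (x + m) else \<mu> j"
    have xA: "x + m \<in> A" using that by (simp add: G_def)
    show "\<forall>j\<in>J0 - J. a j \<bullet> M (x + m) < 0" using xA by (simp add: A_def)
    have "(\<Sum>j\<in>J0. ?\<delta> j *\<^sub>R a j) = (\<Sum>j\<in>J0 - J. ?\<delta> j *\<^sub>R a j) + (\<Sum>j\<in>J. ?\<delta> j *\<^sub>R a j)"
      by (rule sum.subset_diff[OF J(2) fin])
    also have "(\<Sum>j\<in>J0 - J. ?\<delta> j *\<^sub>R a j) = m" unfolding m_def by (intro sum.cong) auto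
    also have "(\<Sum>j\<in>J. ?\<delta> j *\<^sub>R a j) = - P (x + m)" unfolding L_sum by (simp add: sum_negf)
    finally have "M (x + m) = x + (\<Sum>j\<in>J0. ?\<delta> j *\<^sub>R a j)" by (simp add: M_def)
    moreover have "\<forall>j\<in>J. a j \<bullet> M (x + m) = 0" using MD(3)[of "x + m"] inV by blast
    ultimately show "active_solution a J0 F \<mu> J x ?\<delta> (M (x + m))"
      unfolding active_solution_def using xA J by (auto simp: A_def)
        (metis DiffI less_eq_real_def)
  qed
  moreover have "D1 \<union> H \<in> sets borel" by measurable
  ultimately show ?thesis
    using \<open>G \<in> sets borel\<close> by (intro exI[of _ G] exI[of _ "D1 \<union> H"] conjI allI impI ballI) blast+
qed

text \<open>On \<open>G J\<close> the set \<open>J\<close> is recovered as the generators orthogonal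
  to the residual, and the residual is unique; hence the pieces are disjoint and the bounds add up.
  A single \<open>D\<close> serves all \<open>J\<close>, since the limit argument does not know in
  advance which \<open>J\<close> occurs.\<close>

lemma measure_active_solutions_le:
  fixes a :: "'k::finite \<Rightarrow> real ^ 'n::finite"
  assumes inj: "inj_on a J0" and indep: "independent (a ` J0)"
    and card: "card J0 < CARD('n)" and \<mu>: "\<And>j. j \<in> J0 \<Longrightarrow> 0 \<le> \<mu> j" and \<alpha>: "0 < \<alpha>" "\<alpha> < 1"
  shows "\<exists>D\<in>sets borel. measure std_normal_vec D \<le> \<alpha> \<and>
    (\<forall>J x \<delta> \<rho>. F \<subseteq> J \<longrightarrow> J \<subseteq> J0 \<longrightarrow> active_solution a J0 F \<mu> J x \<delta> \<rho> \<longrightarrow>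
      quantile (chi_squared (CARD('n) - card J)) (1 - \<alpha>) \<le> (norm \<rho>)\<^sup>2 \<longrightarrow> x \<in> D)"
proof -
  let ?N = "std_normal_vec :: (real ^ 'n) measure"
  interpret N: prob_space ?N by (rule prob_space_std_normal_vec)
  define \<J> where "\<J> = {J. F \<subseteq> J \<and> J \<subseteq> J0}"
  have finJ: "finite \<J>" by simp
  define R where "R J G D \<longleftrightarrow> G \<in> sets borel \<and> D \<in> sets borel \<and>
    measure ?N D \<le> \<alpha> * measure ?N G \<and>
    (\<forall>x \<delta> \<rho>. active_solution a J0 F \<mu> J x \<delta> \<rho> \<and>
      quantile (chi_squared (CARD('n) - card J)) (1 - \<alpha>) \<le> (norm \<rho>)\<^sup>2 \<longrightarrow> x \<in> D) \<and>
    (\<forall>x\<in>G. \<exists>\<delta> \<rho>. active_solution a J0 F \<mu> J x \<delta> \<rho> \<and> (\<forall>j\<in>J0 - J. a j \<bullet> \<rho> < 0))" for J G D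
  have "\<exists>G D. R J G D" if "J \<in> \<J>" for J
    unfolding R_def using that
    by (intro active_solution_region[OF inj indep _ _ card \<mu> \<alpha>]) (auto simp: \<J>_def)
  then obtain G D where "\<And>J. J \<in> \<J> \<Longrightarrow> R J (G J) (D J)" by metis
  note RGD = this[unfolded R_def]
  have GD: "\<And>J. J \<in> \<J> \<Longrightarrow> G J \<in> sets borel" "\<And>J. J \<in> \<J> \<Longrightarrow> D J \<in> sets borel"
    "\<And>J. J \<in> \<J> \<Longrightarrow> measure ?N (D J) \<le> \<alpha> * measure ?N (G J)"
    "\<And>J x \<delta> \<rho>. J \<in> \<J> \<Longrightarrow> active_solution a J0 F \<mu> J x \<delta> \<rho> \<Longrightarrow>
      quantile (chi_squared (CARD('n) - card J)) (1 - \<alpha>) \<le> (norm \<rho>)\<^sup>2 \<Longrightarrow> x \<in> D J"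
    "\<And>J x. J \<in> \<J> \<Longrightarrow> x \<in> G J \<Longrightarrow> \<exists>\<delta> \<rho>. active_solution a J0 F \<mu> J x \<delta> \<rho> \<and> (\<forall>j\<in>J0 - J. a j \<bullet> \<rho> < 0)"
    by (simp_all add: RGD[THEN conjunct1] RGD[THEN conjunct2, THEN conjunct1]
      RGD[THEN conjunct2, THEN conjunct2, THEN conjunct1]
      RGD[THEN conjunct2, THEN conjunct2, THEN conjunct2, THEN conjunct1, rule_format]
      RGD[THEN conjunct2, THEN conjunct2, THEN conjunct2, THEN conjunct2, rule_format])
  have disj: "disjoint_family_on G \<J>"
    unfolding disjoint_family_on_def
  proof (intro ballI impI)
    fix J J' assume J: "J \<in> \<J>" "J' \<in> \<J>" "J \<noteq> J'"
    have False if x: "x \<in> G J" "x \<in> G J'" for x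
    proof -
      obtain \<delta> \<rho> where 1: "active_solution a J0 F \<mu> J x \<delta> \<rho>" "\<forall>j\<in>J0 - J. a j \<bullet> \<rho> < 0" using GD(5)[OF J(1) x(1)] by blast
      obtain \<delta>' \<rho>' where 2: "active_solution a J0 F \<mu> J' x \<delta>' \<rho>'" "\<forall>j\<in>J0 - J'. a j \<bullet> \<rho>' < 0" using GD(5)[OF J(2) x(2)] by blast
      have sub: "F \<subseteq> J" "F \<subseteq> J'" "J \<subseteq> J0" "J' \<subseteq> J0" using J(1,2) by (auto simp: \<J>_def)
      have "\<rho> = \<rho>'" by (rule active_solution_unique[OF _ sub 1(1) 2(1)]) simp
      moreover have "j \<in> J \<longleftrightarrow> j \<in> J0 \<and> a j \<bullet> \<rho> = 0" for j
        using active_solutionD(2)[OF 1(1)] 1(2) sub(3) by (metis DiffI less_irrefl subsetD)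
      moreover have "j \<in> J' \<longleftrightarrow> j \<in> J0 \<and> a j \<bullet> \<rho>' = 0" for j
        using active_solutionD(2)[OF 2(1)] 2(2) sub(4) by (metis DiffI less_irrefl subsetD)
      ultimately have "J = J'" by blast
      then show False using J(3) by simp
    qed
    then show "G J \<inter> G J' = {}" by blast
  qed
  have "measure ?N (\<Union>J\<in>\<J>. D J) \<le> (\<Sum>J\<in>\<J>. measure ?N (D J))"
    using finJ GD(2) by (intro measure_UNION_le) auto
  also have "\<dots> \<le> (\<Sum>J\<in>\<J>. \<alpha> * measure ?N (G J))" by (intro sum_mono GD(3))
  also have "\<dots> = \<alpha> * measure ?N (\<Union>J\<in>\<J>. G J)"
    using finJ GD(1) disj by (subst N.finite_measure_finite_Union) (auto simp: sum_distrib_left)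
  also have "\<dots> \<le> \<alpha> * 1" using \<alpha> by (intro mult_left_mono N.prob_le_1) simp
  finally have "measure ?N (\<Union>J\<in>\<J>. D J) \<le> \<alpha>" by simp
  moreover have "(\<Union>J\<in>\<J>. D J) \<in> sets borel" using GD(2) finJ by (intro sets.finite_UN) auto
  moreover have "x \<in> (\<Union>J\<in>\<J>. D J)" if "F \<subseteq> J" "J \<subseteq> J0" "active_solution a J0 F \<mu> J x \<delta> \<rho>"
    "quantile (chi_squared (CARD('n) - card J)) (1 - \<alpha>) \<le> (norm \<rho>)\<^sup>2" for J x \<delta> \<rho>
    using GD(4)[of J x \<delta> \<rho>] that by (auto simp: \<J>_def)
  ultimately show ?thesis by (intro bexI[of _ "\<Union>J\<in>\<J>. D J"] conjI allI impI)
qed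

section \<open>Portmanteau theorem from multivariate distribution functions\<close>

text \<open>Half-open boxes arise from the orthants \<open>x \<le> t\<close> by successive
  differences, without any concern about boundaries. They are stable under intersection, and open
  sets are countable unions of them.\<close>

definition halfopen_box :: "real ^ 'n::finite \<Rightarrow> real ^ 'n \<Rightarrow> (real ^ 'n) set" where
  "halfopen_box a b = {x. \<forall>i. a $ i < x $ i \<and> x $ i \<le> b $ i}"

lemma sets_halfopen_box [measurable]: "halfopen_box a b \<in> sets borel"
  unfolding halfopen_box_def by measurable

lemma halfopen_box_Int:
  "halfopen_box a b \<inter> halfopen_box c d = halfopen_box (\<chi> i. max (a $ i) (c $ i)) (\<chi> i. min (b $ i) (d $ i))"
  by (auto simp: halfopen_box_def)

lemma open_eq_Union_halfopen_box:
  fixes U :: "(real ^ 'n::finite) set"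
  assumes "open U"
  obtains a b :: "nat \<Rightarrow> real ^ 'n" where "U = (\<Union>n. halfopen_box (a n) (b n))"
proof -
  define D where "D = {x :: real ^ 'n. \<forall>i. x $ i \<in> \<rat>}"
  have "D \<subseteq> (\<lambda>f. \<chi> i. f i) ` (UNIV \<rightarrow>\<^sub>E \<rat>)"
  proof
    fix x assume "x \<in> D"
    then have "($) x \<in> UNIV \<rightarrow>\<^sub>E \<rat>" by (simp add: D_def PiE_UNIV_domain Pi_iff)
    moreover have "x = (\<chi> i. ($) x i)" by simp
    ultimately show "x \<in> (\<lambda>f. \<chi> i. f i) ` (UNIV \<rightarrow>\<^sub>E \<rat>)" by (intro image_eqI[of x _ "($) x"])
  qed
  then have cD: "countable D"
    by (rule countable_subset) (intro countable_image countable_PiE countable_rat finite)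
  define Q where "Q = {(a, b) \<in> D \<times> D. halfopen_box a b \<subseteq> U}"
  have "countable Q" using cD by (auto simp: Q_def intro: countable_subset[of _ "D \<times> D"])
  \<comment> \<open>The box with equal corners is empty, hence admissible even for empty
    \<open>U\<close>; \<open>Q\<close> must be nonempty to be the range of a sequence.\<close>
  have ne: "Q \<noteq> {}"
  proof -
    have "halfopen_box (0::real^'n) 0 \<subseteq> U" by (auto simp: halfopen_box_def)
    then have "(0, 0) \<in> Q" by (auto simp: Q_def D_def)
    then show ?thesis by blast
  qed
  have "U = (\<Union>(a, b)\<in>Q. halfopen_box a b)"
  proof
    show "U \<subseteq> (\<Union>(a, b)\<in>Q. halfopen_box a b)"
    proof
      fix x assume "x \<in> U"
      then obtain e where e: "e > 0" "cball x e \<subseteq> U"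
        using assms open_contains_cball by metis
      obtain a b where ab: "\<forall>i\<in>Basis. a \<bullet> i \<in> \<rat> \<and> b \<bullet> i \<in> \<rat>" "x \<in> box a b" "box a b \<subseteq> ball x e"
        using rational_boxes[OF e(1)] by blast
      have "axis i (1::real) \<in> Basis" for i :: 'n by (simp add: axis_in_Basis_iff)
      then have "a $ i \<in> \<rat>" "b $ i \<in> \<rat>" for i
        using ab(1) by (simp_all add: cart_eq_inner_axis)
      then have "a \<in> D" "b \<in> D" by (simp_all add: D_def)
      moreover have "halfopen_box a b \<subseteq> cbox a b" by (auto simp: halfopen_box_def mem_box_cart less_imp_le)
      moreover have "box a b \<noteq> {}" using ab(2) by blast
      then have "cbox a b = closure (box a b)" by (simp add: closure_box)
      moreover have "closure (box a b) \<subseteq> cball x e"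
        by (intro closure_minimal order_trans[OF ab(3)]) auto
      ultimately have "(a, b) \<in> Q" using e(2) unfolding Q_def by blast
      moreover have "x \<in> halfopen_box a b" using ab(2) by (auto simp: halfopen_box_def mem_box_cart less_imp_le)
      ultimately show "x \<in> (\<Union>(a, b)\<in>Q. halfopen_box a b)" by blast
    qed
  qed (auto simp: Q_def)
  moreover obtain g :: "nat \<Rightarrow> _" where g: "range g = Q"
    using range_from_nat_into[OF ne \<open>countable Q\<close>] by blast
  ultimately have "U = (\<Union>n. halfopen_box (fst (g n)) (snd (g n)))"
    unfolding g[symmetric] by (simp add: case_prod_unfold)
  then show ?thesis by (rule that[of "\<lambda>n. fst (g n)" "\<lambda>n. snd (g n)"])
qed

lemma measure_Un_prob:
  assumes "prob_space P" "A \<in> sets P" "B \<in> sets P"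
  shows "measure P (A \<union> B) = measure P A + measure P B - measure P (A \<inter> B)"
proof -
  interpret prob_space P by fact
  show ?thesis using measure_Un3[of A P B] assms by (simp add: fmeasurable_eq_sets)
qed

context
  fixes M :: "nat \<Rightarrow> (real ^ 'n::finite) measure" and N :: "(real ^ 'n) measure"
  assumes M: "\<And>n. prob_space (M n)" "\<And>n. sets (M n) = sets borel"
    and N: "prob_space N" "sets N = sets borel"
    and cdf: "\<And>t. (\<lambda>n. measure (M n) {x. x \<le> t}) \<longlonglongrightarrow> measure N {x. x \<le> t}"
begin

text \<open>The lower constraints are imposed one coordinate at a time, each as a difference of
  nested sets. The induction starts from the orthants, where convergence is assumed at every
  point.\<close>

lemma measure_halfopen_box_tendsto:
  "(\<lambda>n. measure (M n) (halfopen_box a b)) \<longlonglongrightarrow> measure N (halfopen_box a b)"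
proof -
  define R where "R S b = {x::real^'n. (\<forall>i\<in>S. a $ i < x $ i) \<and> x \<le> b}" for S b
  have meas: "R S b \<in> sets borel" for S b
    unfolding R_def less_eq_vec_def by measurable
  have "(\<lambda>n. measure (M n) (R S b)) \<longlonglongrightarrow> measure N (R S b)" for S b
  using finite[of S] proof (induction S arbitrary: b rule: finite_induct)
    case empty
    then show ?case using cdf by (simp add: R_def)
  next
    case (insert i S)
    \<comment> \<open>Capping at the minimum keeps the sets nested also when
      \<open>b $ i < a $ i\<close>, where the difference is empty.\<close>
    define b' where "b' = (\<chi> j. if j = i then min (a $ i) (b $ i) else b $ j)"
    have eq: "R (insert i S) b = R S b - R S b'"
      by (auto simp: R_def b'_def less_eq_vec_def split: if_splits)
    have sub: "R S b' \<subseteq> R S b"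
      by (auto simp: R_def b'_def less_eq_vec_def split: if_splits)
    have "measure P (R (insert i S) b) = measure P (R S b) - measure P (R S b')" if "prob_space P" "sets P = sets borel" for P
      unfolding eq using finite_measure.finite_measure_Diff[of P "R S b" "R S b'"] that meas sub
      by (simp add: prob_space.finite_measure)
    then show ?case using insert.IH M N by (simp add: tendsto_diff)
  qed
  moreover have "R UNIV b = halfopen_box a b"
    by (auto simp: R_def halfopen_box_def less_eq_vec_def)
  ultimately show ?thesis by metis
qed

text \<open>Inclusion-exclusion: adding a box produces its intersection with the earlier union, so
  the auxiliary claim concerns unions cut down to an arbitrary box.\<close>

lemma measure_UN_halfopen_box_tendsto:
  fixes a b :: "nat \<Rightarrow> real ^ 'n"
  shows "(\<lambda>n. measure (M n) (\<Union>k<m. halfopen_box (a k) (b k))) \<longlonglongrightarrow> measure N (\<Union>k<m. halfopen_box (a k) (b k))"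
proof -
  have "(\<lambda>n. measure (M n) (halfopen_box c d \<inter> (\<Union>k<m. halfopen_box (a k) (b k)))) \<longlonglongrightarrow>
     measure N (halfopen_box c d \<inter> (\<Union>k<m. halfopen_box (a k) (b k)))" for c d m
  proof (induction m arbitrary: c d)
    case (Suc m)
    let ?A = "\<lambda>c d. halfopen_box c d \<inter> (\<Union>k<m. halfopen_box (a k) (b k))"
    let ?B = "halfopen_box c d \<inter> halfopen_box (a m) (b m)"
    have eq: "measure P (halfopen_box c d \<inter> (\<Union>k<Suc m. halfopen_box (a k) (b k))) =
        measure P (?A c d) + measure P ?B
         - measure P (?B \<inter> (\<Union>k<m. halfopen_box (a k) (b k)))"
      if "prob_space P" "sets P = sets borel" for P
    proof -
      have "halfopen_box c d \<inter> (\<Union>k<Suc m. halfopen_box (a k) (b k)) = ?A c d \<union> ?B"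
        by (auto simp: less_Suc_eq)
      moreover have "?A c d \<inter> ?B = ?B \<inter> (\<Union>k<m. halfopen_box (a k) (b k))" by blast
      moreover have "?A c d \<in> sets P" "?B \<in> sets P"
        unfolding that(2) by (intro sets.Int sets.finite_UN sets_halfopen_box finite_lessThan)+
      ultimately show ?thesis using measure_Un_prob[OF that(1), of "?A c d" ?B] by (simp only:)
    qed
    have "(\<lambda>n. measure (M n) (?A c d) + measure (M n) ?B
         - measure (M n) (?B \<inter> (\<Union>k<m. halfopen_box (a k) (b k)))) \<longlonglongrightarrow>
        measure N (?A c d) + measure N ?B - measure N (?B \<inter> (\<Union>k<m. halfopen_box (a k) (b k)))"
      unfolding halfopen_box_Int by (intro tendsto_intros Suc measure_halfopen_box_tendsto)
    then show ?case unfolding eq[OF M] eq[OF N] .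
  qed simp
  note A = this
  show ?thesis
  proof (induction m)
    case (Suc m)
    let ?A = "\<Union>k<m. halfopen_box (a k) (b k)"
    let ?B = "halfopen_box (a m) (b m)"
    have eq: "measure P (\<Union>k<Suc m. halfopen_box (a k) (b k)) = measure P ?A + measure P ?B - measure P (?B \<inter> ?A)"
      if "prob_space P" "sets P = sets borel" for P
    proof -
      have "(\<Union>k<Suc m. halfopen_box (a k) (b k)) = ?A \<union> ?B" by (auto simp: less_Suc_eq)
      moreover have "?A \<inter> ?B = ?B \<inter> ?A" by blast
      moreover have "?A \<in> sets P" "?B \<in> sets P"
        unfolding that(2) by (intro sets.finite_UN sets_halfopen_box finite_lessThan)+
      ultimately show ?thesis using measure_Un_prob[OF that(1), of ?A ?B] by (simp only:)
    qed
    have "(\<lambda>n. measure (M n) ?A + measure (M n) ?B - measure (M n) (?B \<inter> ?A)) \<longlonglongrightarrow>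
        measure N ?A + measure N ?B - measure N (?B \<inter> ?A)"
      by (intro tendsto_intros Suc A measure_halfopen_box_tendsto)
    then show ?case unfolding eq[OF M] eq[OF N] .
  qed simp
qed

text \<open>By continuity from below, finitely many boxes inside \<open>U\<close> already carry mass
  above \<open>c\<close>, and for finite unions of boxes convergence is known.\<close>

lemma eventually_measure_open_gt:
  assumes "open U" "c < measure N U"
  shows "\<forall>\<^sub>F n in sequentially. c < measure (M n) U"
proof -
  interpret N: prob_space N by (rule N)
  obtain a b where U: "U = (\<Union>n::nat. halfopen_box (a n) (b n))"
    by (rule open_eq_Union_halfopen_box[OF \<open>open U\<close>])
  let ?V = "\<lambda>m. \<Union>k<m. halfopen_box (a k) (b k)"
  have V: "?V m \<in> sets borel" for m by measurable
  have "(\<lambda>m. measure N (?V m)) \<longlonglongrightarrow> measure N (\<Union>m. ?V m)"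
  proof (rule N.finite_Lim_measure_incseq)
    show "range ?V \<subseteq> sets N" unfolding N(2) using V by (rule image_subsetI)
    show "incseq ?V" unfolding incseq_def by (intro allI impI UN_mono) auto
  qed
  moreover have "(\<Union>m. ?V m) = U" unfolding U by auto
  ultimately have "(\<lambda>m. measure N (?V m)) \<longlonglongrightarrow> measure N U" by (simp only:)
  from eventually_happens'[OF sequentially_bot order_tendstoD(1)[OF this assms(2)]]
  obtain m where "c < measure N (?V m)" by blast
  then have "\<forall>\<^sub>F n in sequentially. c < measure (M n) (?V m)"
    by (rule order_tendstoD(1)[OF measure_UN_halfopen_box_tendsto])
  then show ?thesis
  proof eventually_elim
    case (elim n)
    interpret prob_space "M n" by (rule M)
    have "measure (M n) (?V m) \<le> measure (M n) U"
      using \<open>open U\<close> M(2) by (intro finite_measure_mono) (auto simp: U)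
    with elim show ?case by simp
  qed
qed

lemma eventually_measure_closed_less:
  assumes "closed F" "measure N F < c"
  shows "\<forall>\<^sub>F n in sequentially. measure (M n) F < c"
proof -
  have eq: "measure P (- F) = 1 - measure P F" if "prob_space P" "sets P = sets borel" for P
    using prob_space.prob_compl[OF that(1), of F] that(2) \<open>closed F\<close> sets_eq_imp_space_eq[OF that(2)]
    by (simp add: Compl_eq_Diff_UNIV)
  have "\<forall>\<^sub>F n in sequentially. 1 - c < measure (M n) (- F)"
    using assms eq[OF N] by (intro eventually_measure_open_gt) auto
  then show ?thesis by eventually_elim (simp add: eq[OF M])
qed

end

section \<open>Convergence of the perturbed projection problems\<close>

text \<open>The whitened problem for a finite sample size; \<open>\<Psi>\<close> will tend to the identity.\<close>

definition perturbed_solution ::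
  "real ^ 'n ^ 'n::finite \<Rightarrow> ('k \<Rightarrow> real ^ 'n) \<Rightarrow> 'k set \<Rightarrow> ('k \<Rightarrow> real) \<Rightarrow> 'k set \<Rightarrow> real ^ 'n \<Rightarrow> ('k \<Rightarrow> real) \<Rightarrow> real ^ 'n \<Rightarrow> bool" where
  "perturbed_solution \<Psi> a J0 \<mu> J x \<delta> \<rho> \<longleftrightarrow>
     \<Psi> *v \<rho> = x + (\<Sum>j\<in>J0. \<delta> j *\<^sub>R a j) \<and> (\<forall>j\<in>J. a j \<bullet> \<rho> = 0) \<and> (\<forall>j\<in>J0. a j \<bullet> \<rho> \<le> 0) \<and>
     (\<forall>j\<in>J0 - J. \<delta> j = \<mu> j) \<and> (\<forall>j\<in>J. \<delta> j \<le> \<mu> j)"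

lemma perturbed_solutionD:
  assumes "perturbed_solution \<Psi> a J0 \<mu> J x \<delta> \<rho>"
  shows "\<Psi> *v \<rho> = x + (\<Sum>j\<in>J0. \<delta> j *\<^sub>R a j)" "j \<in> J \<Longrightarrow> a j \<bullet> \<rho> = 0" "j \<in> J0 \<Longrightarrow> a j \<bullet> \<rho> \<le> 0"
    "j \<in> J0 \<Longrightarrow> j \<notin> J \<Longrightarrow> \<delta> j = \<mu> j" "j \<in> J \<Longrightarrow> \<delta> j \<le> \<mu> j"
  using assms unfolding perturbed_solution_def by blast+

text \<open>Testing the equation with \<open>\<rho>\<close> removes the multipliers:
  \<open>\<delta> j * (a j \<bullet> \<rho>)\<close> is zero on \<open>J\<close> and nonpositive
  elsewhere. The bound is thus uniform in \<open>\<mu>\<close>, which matters because some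
  \<open>\<mu> j\<close> will tend to infinity.\<close>

lemma perturbed_solution_norm_le:
  assumes "perturbed_solution \<Psi> a J0 \<mu> J x \<delta> \<rho>" and \<mu>: "\<And>j. j \<in> J0 \<Longrightarrow> 0 \<le> \<mu> j"
    and \<Psi>: "norm (\<Psi> - mat 1) \<le> 1 / 2"
  shows "norm \<rho> \<le> 2 * norm x"
proof -
  note D = perturbed_solutionD[OF assms(1)]
  have "\<rho> \<bullet> (\<Psi> *v \<rho>) = \<rho> \<bullet> x + (\<Sum>j\<in>J0. \<delta> j * (a j \<bullet> \<rho>))"
    unfolding D(1) by (simp add: inner_add_right inner_sum_right inner_commute)
  also have "(\<Sum>j\<in>J0. \<delta> j * (a j \<bullet> \<rho>)) \<le> 0"
  proof (rule sum_nonpos)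
    fix j assume j: "j \<in> J0"
    show "\<delta> j * (a j \<bullet> \<rho>) \<le> 0"
      using D(2,3,4)[of j] \<mu> j by (cases "j \<in> J") (auto simp: mult_nonneg_nonpos)
  qed
  finally have 1: "\<rho> \<bullet> (\<Psi> *v \<rho>) \<le> norm \<rho> * norm x"
    using norm_cauchy_schwarz[of \<rho> x] by linarith
  have "\<rho> \<bullet> ((\<Psi> - mat 1) *v \<rho>) = \<rho> \<bullet> (\<Psi> *v \<rho>) - (norm \<rho>)\<^sup>2"
    by (simp add: matrix_vector_mult_diff_rdistrib inner_diff_right power2_norm_eq_inner)
  moreover have "\<bar>\<rho> \<bullet> ((\<Psi> - mat 1) *v \<rho>)\<bar> \<le> norm \<rho> * (1 / 2 * norm \<rho>)"
    by (intro order_trans[OF Cauchy_Schwarz_ineq2] mult_left_mono order_trans[OF norm_matrix_vector_mult_le] mult_right_mono \<Psi>) auto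
  ultimately have "norm \<rho> * norm \<rho> \<le> norm \<rho> * (2 * norm x)"
    using 1 unfolding power2_eq_square by linarith
  then show ?thesis by (cases "\<rho> = 0") (auto simp: mult_le_cancel_left)
qed

text \<open>Residuals are bounded, and then, by independence of the limiting generators, so are the
  multipliers; along a convergent subsequence the weak conditions pass to the limit. A generator in
  \<open>F\<close> must be active: otherwise its multiplier would equal \<open>\<nu> i j\<close>,
  which tends to infinity.\<close>

lemma perturbed_solutions_limit:
  fixes a :: "'k::finite \<Rightarrow> real ^ 'n::finite"
  assumes inj: "inj_on a J0" and indep: "independent (a ` J0)" and J: "J \<subseteq> J0" and F: "F \<subseteq> J0"
    and \<Psi>: "\<Psi> \<longlonglongrightarrow> mat 1" and x: "X \<longlonglongrightarrow> x" and a: "\<And>j. j \<in> J0 \<Longrightarrow> (\<lambda>i. A i j) \<longlonglongrightarrow> a j"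
    and \<nu>: "\<And>i j. j \<in> J0 \<Longrightarrow> 0 \<le> \<nu> i j" "\<And>j. j \<in> F \<Longrightarrow> filterlim (\<lambda>i. \<nu> i j) at_top sequentially"
      "\<And>j. j \<in> J0 - F \<Longrightarrow> (\<lambda>i. \<nu> i j) \<longlonglongrightarrow> \<mu> j"
    and sol: "\<And>i. perturbed_solution (\<Psi> i) (A i) J0 (\<nu> i) J (X i) (\<Delta> i) (r i)"
    and c: "\<And>i. c \<le> r i \<bullet> (\<Psi> i *v r i)"
  shows "F \<subseteq> J \<and> (\<exists>\<delta> \<rho>. active_solution a J0 F \<mu> J x \<delta> \<rho> \<and> c \<le> (norm \<rho>)\<^sup>2)"
proof -
  note D = perturbed_solutionD[OF sol]
  have ev_\<Psi>: "\<forall>\<^sub>F i in sequentially. norm (\<Psi> i - mat 1) \<le> 1 / 2"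
    using tendstoD[OF \<Psi>, of "1/2"] by (auto simp: dist_norm elim: eventually_mono)
  have "Bseq X" using x by (intro convergent_imp_Bseq convergentI)
  then obtain KX where KX: "\<And>i. norm (X i) \<le> KX" by (auto simp: Bseq_def)
  have ev_r: "\<forall>\<^sub>F i in sequentially. norm (r i) \<le> 2 * KX"
    using ev_\<Psi>
  proof eventually_elim
    case (elim i)
    have "norm (r i) \<le> 2 * norm (X i)" by (rule perturbed_solution_norm_le[OF sol \<nu>(1) elim])
    then show ?case using KX[of i] by linarith
  qed
  define d where "d i = (\<chi> j. if j \<in> J0 then \<Delta> i j else 0)" for i
  let ?S = "{y :: real ^ 'k. \<forall>j. j \<notin> J0 \<longrightarrow> y $ j = 0}"
  let ?L = "\<lambda>y :: real ^ 'k. \<Sum>j\<in>J0. y $ j *\<^sub>R a j"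
  have S: "subspace ?S" by (auto simp: subspace_def)
  have linL: "linear ?L"
    by (intro linearI) (simp_all add: scaleR_add_left sum.distrib scaleR_sum_right)
  have injL: "y = 0" if "y \<in> ?S" "?L y = 0" for y
  proof -
    have "(\<Sum>v\<in>a ` J0. (y $ the_inv_into J0 a v) *\<^sub>R v) = 0"
      using that(2) by (simp add: sum.reindex[OF inj] the_inv_into_f_f[OF inj])
    then have "y $ the_inv_into J0 a (a j) = 0" if "j \<in> J0" for j
      using independentD[OF indep, of "a ` J0" "\<lambda>v. y $ the_inv_into J0 a v" "a j"] that by simp
    then have "y $ j = 0" for j using that(1) by (cases "j \<in> J0") (auto simp: the_inv_into_f_f[OF inj])
    then show ?thesis by (simp add: vec_eq_iff)
  qed
  obtain e where e: "e > 0" "\<And>y. y \<in> ?S \<Longrightarrow> e * norm y \<le> norm (?L y)"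
    using injective_imp_isometric[of ?S ?L] closed_subspace[OF S] S linL injL by (auto simp: linear_linear)
  \<comment> \<open>Half of the margin \<open>e\<close> is spent on replacing the generators
    \<open>a j\<close> by \<open>A i j\<close>; the other half still bounds the multipliers.\<close>
  have ev_A: "\<forall>\<^sub>F i in sequentially. (\<Sum>j\<in>J0. norm (A i j - a j)) \<le> e / 2"
  proof -
    have "(\<lambda>i. \<Sum>j\<in>J0. norm (A i j - a j)) \<longlonglongrightarrow> (\<Sum>j\<in>J0. norm (a j - a j))"
      by (intro tendsto_sum tendsto_norm tendsto_diff a tendsto_const)
    from order_tendstoD(2)[OF this, of "e / 2"] show ?thesis using e by (auto elim: eventually_mono)
  qed
  have ev_d: "\<forall>\<^sub>F i in sequentially. norm (d i) \<le> (2 / e) * ((norm (mat 1 :: real ^ 'n ^ 'n) + 1 / 2) * (2 * KX) + KX)"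
    using ev_\<Psi> ev_r ev_A
  proof eventually_elim
    case (elim i)
    have dS: "d i \<in> ?S" by (simp add: d_def)
    have sum_d: "(\<Sum>j\<in>J0. d i $ j *\<^sub>R A i j) = \<Psi> i *v r i - X i"
      using D(1)[of i] by (simp add: d_def algebra_simps)
    have "?L (d i) = (\<Sum>j\<in>J0. d i $ j *\<^sub>R A i j) - (\<Sum>j\<in>J0. d i $ j *\<^sub>R (A i j - a j))"
      by (simp add: scaleR_right_diff_distrib sum_subtractf)
    then have "norm (?L (d i)) \<le> norm (\<Psi> i *v r i - X i) + norm (\<Sum>j\<in>J0. d i $ j *\<^sub>R (A i j - a j))"
      by (simp only: sum_d norm_triangle_ineq4)
    also have "norm (\<Sum>j\<in>J0. d i $ j *\<^sub>R (A i j - a j)) \<le> (\<Sum>j\<in>J0. norm (d i) * norm (A i j - a j))"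
      by (intro sum_norm_le) (simp add: mult_right_mono component_le_norm_cart)
    also have "\<dots> \<le> norm (d i) * (e / 2)"
      unfolding sum_distrib_left[symmetric] using elim(3) by (intro mult_left_mono) auto
    also have "norm (\<Psi> i *v r i - X i) \<le> (norm (mat 1 :: real ^ 'n ^ 'n) + 1 / 2) * (2 * KX) + KX"
    proof -
      have "norm (\<Psi> i) \<le> norm (mat 1 :: real ^ 'n ^ 'n) + 1 / 2"
        using norm_triangle_sub[of "\<Psi> i" "mat 1"] elim(1) by simp
      then have "norm (\<Psi> i *v r i) \<le> (norm (mat 1 :: real ^ 'n ^ 'n) + 1 / 2) * (2 * KX)"
        using elim(2) by (intro order_trans[OF norm_matrix_vector_mult_le] mult_mono) auto
      then show ?thesis using norm_triangle_ineq4[of "\<Psi> i *v r i" "X i"] KX[of i] by linarith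
    qed
    finally have "e * norm (d i) \<le> (norm (mat 1 :: real ^ 'n ^ 'n) + 1 / 2) * (2 * KX) + KX + norm (d i) * (e / 2)"
      using e(2)[OF dS] by linarith
    then have "norm (d i) * (e / 2) \<le> (norm (mat 1 :: real ^ 'n ^ 'n) + 1 / 2) * (2 * KX) + KX"
      by (simp add: mult.commute)
    then show ?case using e(1) by (simp add: field_simps)
  qed
  have "Bseq r" "Bseq d" using ev_r ev_d by (auto intro!: BfunI)
  then have "bounded (range (\<lambda>i. (r i, d i)))"
    unfolding Bseq_eq_bounded by (rule bounded_subset[OF bounded_Times]) auto
  then obtain l s where s: "strict_mono s" and l: "((\<lambda>i. (r i, d i)) \<circ> s) \<longlonglongrightarrow> l"
    using bounded_imp_convergent_subsequence by blast
  define \<rho> where "\<rho> = fst l"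
  define \<delta> where "\<delta> j = snd l $ j" for j
  have r: "(\<lambda>i. r (s i)) \<longlonglongrightarrow> \<rho>" using tendsto_fst[OF l] by (simp add: \<rho>_def o_def)
  have d': "(\<lambda>i. d (s i) $ j) \<longlonglongrightarrow> \<delta> j" for j using tendsto_vec_nth[OF tendsto_snd[OF l], of j] by (simp add: \<delta>_def o_def)
  then have d: "(\<lambda>i. \<Delta> (s i) j) \<longlonglongrightarrow> \<delta> j" if "j \<in> J0" for j using that d'[of j] by (simp add: d_def)
  have \<Psi>s: "(\<lambda>i. \<Psi> (s i)) \<longlonglongrightarrow> mat 1" using LIMSEQ_subseq_LIMSEQ[OF \<Psi> s] by (simp add: o_def)
  have Xs: "(\<lambda>i. X (s i)) \<longlonglongrightarrow> x" using LIMSEQ_subseq_LIMSEQ[OF x s] by (simp add: o_def)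
  have As: "(\<lambda>i. A (s i) j) \<longlonglongrightarrow> a j" if "j \<in> J0" for j using LIMSEQ_subseq_LIMSEQ[OF a[OF that] s] by (simp add: o_def)
  have \<Psi>r: "(\<lambda>i. \<Psi> (s i) *v r (s i)) \<longlonglongrightarrow> \<rho>" using tendsto_matrix_vector_mult[OF \<Psi>s r] by simp
  have ar: "(\<lambda>i. A (s i) j \<bullet> r (s i)) \<longlonglongrightarrow> a j \<bullet> \<rho>" if "j \<in> J0" for j using As[OF that] r by (rule tendsto_inner)
  have F_J: "j \<in> J" if "j \<in> F" for j
  proof (rule ccontr)
    assume "j \<notin> J"
    then have "\<Delta> (s i) j = \<nu> (s i) j" for i using D(4)[of j "s i"] that F by blast
    moreover have "filterlim (\<lambda>i. \<nu> (s i) j) at_top sequentially"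
      using filterlim_compose[OF \<nu>(2)[OF that] filterlim_subseq[OF s]] .
    ultimately have "filterlim (\<lambda>i. \<Delta> (s i) j) at_top sequentially" by simp
    then show False
      using d[of j] that F not_tendsto_and_filterlim_at_infinity[of sequentially "\<lambda>i. \<Delta> (s i) j"]
      by (auto dest: filterlim_at_top_imp_at_infinity)
  qed
  have \<nu>s: "(\<lambda>i. \<nu> (s i) j) \<longlonglongrightarrow> \<mu> j" if "j \<in> J0 - F" for j
    using LIMSEQ_subseq_LIMSEQ[OF \<nu>(3)[OF that] s] by (simp add: o_def)
  have "active_solution a J0 F \<mu> J x \<delta> \<rho>"
    unfolding active_solution_def
  proof (intro conjI ballI)
    have "(\<lambda>i. X (s i) + (\<Sum>j\<in>J0. \<Delta> (s i) j *\<^sub>R A (s i) j)) \<longlonglongrightarrow> x + (\<Sum>j\<in>J0. \<delta> j *\<^sub>R a j)"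
      by (intro tendsto_add Xs tendsto_sum tendsto_scaleR d As)
    then show "\<rho> = x + (\<Sum>j\<in>J0. \<delta> j *\<^sub>R a j)" using \<Psi>r LIMSEQ_unique unfolding D(1) by blast
    show "a j \<bullet> \<rho> = 0" if "j \<in> J" for j
      using ar[of j] that J D(2)[OF that] by (auto simp: LIMSEQ_const_iff)
    show "a j \<bullet> \<rho> \<le> 0" if "j \<in> J0" for j
      using LIMSEQ_le_const2[OF ar[OF that]] D(3)[OF that] by blast
    show "\<delta> j = \<mu> j" if "j \<in> J0 - J" for j
    proof (rule LIMSEQ_unique[OF d])
      have "j \<in> J0 - F" using that F_J by blast
      from \<nu>s[OF this] show "(\<lambda>i. \<Delta> (s i) j) \<longlonglongrightarrow> \<mu> j" using D(4)[of j] that by simp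
    qed (use that in simp)
    show "\<delta> j \<le> \<mu> j" if "j \<in> J - F" for j
      using LIMSEQ_le[OF d \<nu>s] that J D(5)[of j] by blast
  qed
  moreover have "c \<le> (norm \<rho>)\<^sup>2"
    using LIMSEQ_le_const[OF tendsto_inner[OF r \<Psi>r]] c by (auto simp: power2_norm_eq_inner)
  ultimately show ?thesis using F_J by blast
qed

text \<open>\<open>E i\<close> involves the random matrix as well as \<open>X i\<close>.
  \<open>B m\<close> quantifies existentially over all matrices within \<open>1 / Suc m\<close> of
  the identity and all indices from \<open>m\<close> on, so that outside a small event
  \<open>E i\<close> forces \<open>X i\<close> into a fixed set. Its closure admits the portmanteau
  theorem, and a point in all the closures solves the limit problem.\<close>

lemma eventually_prob_perturbed_solution_less:
  fixes a :: "'k::finite \<Rightarrow> real ^ 'n::finite" and P :: "nat \<Rightarrow> 'a measure"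
  assumes inj: "inj_on a J0" and indep: "independent (a ` J0)" and F: "F \<subseteq> J0" and card: "card J0 < CARD('n)"
    and \<alpha>: "0 < \<alpha>" "\<alpha> < 1" "\<alpha> < \<beta>"
    and A: "\<And>j. j \<in> J0 \<Longrightarrow> (\<lambda>i. A i j) \<longlonglongrightarrow> a j"
    and \<nu>: "\<And>i j. j \<in> J0 \<Longrightarrow> 0 \<le> \<nu> i j" "\<And>j. j \<in> F \<Longrightarrow> filterlim (\<lambda>i. \<nu> i j) at_top sequentially"
      "\<And>j. j \<in> J0 - F \<Longrightarrow> (\<lambda>i. \<nu> i j) \<longlonglongrightarrow> \<mu> j"
    and P: "\<And>i. prob_space (P i)"
    and X [measurable]: "\<And>i. X i \<in> borel_measurable (P i)" and \<Psi> [measurable]: "\<And>i. \<Psi> i \<in> borel_measurable (P i)"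
    and cdf: "\<And>t. (\<lambda>i. measure (P i) {\<omega> \<in> space (P i). X i \<omega> \<le> t}) \<longlonglongrightarrow> std_normal_vec_cdf t"
    and \<Psi>_lim: "\<And>\<epsilon>. 0 < \<epsilon> \<Longrightarrow> (\<lambda>i. measure (P i) {\<omega> \<in> space (P i). \<epsilon> < norm (\<Psi> i \<omega> - mat 1)}) \<longlonglongrightarrow> 0"
    and E [measurable]: "\<And>i. E i \<in> sets (P i)"
    and E_sol: "\<And>i \<omega>. \<omega> \<in> E i \<Longrightarrow> \<exists>J \<delta> \<rho>. J \<subseteq> J0 \<and> perturbed_solution (\<Psi> i \<omega>) (A i) J0 (\<nu> i) J (X i \<omega>) \<delta> \<rho> \<and>
        quantile (chi_squared (CARD('n) - card J)) (1 - \<alpha>) \<le> \<rho> \<bullet> (\<Psi> i \<omega> *v \<rho>)"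
  shows "\<forall>\<^sub>F i in sequentially. measure (P i) (E i) < \<beta>"
proof -
  let ?N = "std_normal_vec :: (real ^ 'n) measure"
  interpret N: prob_space ?N by (rule prob_space_std_normal_vec)
  let ?q = "\<lambda>J :: 'k set. quantile (chi_squared (CARD('n) - card J)) (1 - \<alpha>)"
  define S where "S m i x \<Psi>' J \<delta> \<rho> \<longleftrightarrow> norm (\<Psi>' - mat 1) \<le> 1 / real (Suc m) \<and> J \<subseteq> J0 \<and>
     perturbed_solution \<Psi>' (A i) J0 (\<nu> i) J x \<delta> \<rho> \<and> ?q J \<le> \<rho> \<bullet> (\<Psi>' *v \<rho>)" for m i x \<Psi>' J \<delta> \<rho>
  define B where "B m = {x. \<exists>i\<ge>m. \<exists>\<Psi>' J \<delta> \<rho>. S m i x \<Psi>' J \<delta> \<rho>}" for m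
  define Fc where "Fc m = closure (B m)" for m
  have muF: "0 \<le> \<mu> j" if "j \<in> J0 - F" for j
    using LIMSEQ_le_const[OF \<nu>(3)[OF that]] \<nu>(1) that by blast
  \<comment> \<open>Bounds with index in \<open>F\<close> have no finite limit; the default 0 keeps
    all bounds nonnegative, as \<open>measure_active_solutions_le\<close> asks, and free multipliers
    are not compared with it.\<close>
  define \<mu>' where "\<mu>' j = (if j \<in> F then 0 else \<mu> j)" for j
  have \<mu>'0: "0 \<le> \<mu>' j" if "j \<in> J0" for j using muF that by (auto simp: \<mu>'_def)
  have "\<exists>D\<in>sets borel. measure ?N D \<le> \<alpha> \<and>
    (\<forall>J x \<delta> \<rho>. F \<subseteq> J \<longrightarrow> J \<subseteq> J0 \<longrightarrow> active_solution a J0 F \<mu>' J x \<delta> \<rho> \<longrightarrow> ?q J \<le> (norm \<rho>)\<^sup>2 \<longrightarrow> x \<in> D)"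
    by (rule measure_active_solutions_le[OF inj indep card \<mu>'0 \<alpha>(1,2)])
  then obtain D where D: "D \<in> sets borel" "measure ?N D \<le> \<alpha>"
    and D_sol: "\<forall>J x \<delta> \<rho>. F \<subseteq> J \<longrightarrow> J \<subseteq> J0 \<longrightarrow> active_solution a J0 F \<mu>' J x \<delta> \<rho> \<longrightarrow> ?q J \<le> (norm \<rho>)\<^sup>2 \<longrightarrow> x \<in> D"
    by (elim bexE conjE)
  have "(\<Inter>m. Fc m) \<subseteq> D"
  proof
    fix x assume "x \<in> (\<Inter>m. Fc m)"
    then have "\<exists>y\<in>B m. dist y x < 1 / real (Suc m)" for m
      unfolding Fc_def using closure_approachable[of x "B m"] by simp
    then have "\<forall>m. \<exists>i y \<Psi>' J \<delta> \<rho>. m \<le> i \<and> dist y x < 1 / real (Suc m) \<and> S m i y \<Psi>' J \<delta> \<rho>"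
      unfolding B_def by blast
    then obtain i y \<Psi>' J \<delta> \<rho> where i: "\<And>m. m \<le> i m" and y: "\<And>m. dist (y m) x < 1 / real (Suc m)"
      and SS: "\<And>m. S m (i m) (y m) (\<Psi>' m) (J m) (\<delta> m) (\<rho> m)" by metis
    have "finite (range J)" by simp
    \<comment> \<open>With finitely many possible \<open>J\<close>, one recurs infinitely often;
      along that subsequence the quantile, which depends on \<open>card J\<close>, is constant
      too.\<close>
    then obtain J1 where inf: "infinite {m. J m = J1}"
      using pigeonhole_infinite[of UNIV J] by auto
    then obtain s :: "nat \<Rightarrow> nat" where s: "strict_mono s" "\<And>n. s n \<in> {m. J m = J1}"
      using infinite_enumerate by blast
    have sJ: "J (s n) = J1" for n using s(2) by simp
    have lim0: "(\<lambda>n. 1 / real (Suc (s n))) \<longlonglongrightarrow> 0"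
      using LIMSEQ_subseq_LIMSEQ[OF LIMSEQ_Suc[OF lim_inverse_n'] s(1)] by (simp add: o_def)
    have i_s: "filterlim (\<lambda>n. i (s n)) at_top sequentially"
      by (rule filterlim_at_top_mono[OF filterlim_subseq[OF s(1)]]) (use i in auto)
    have ys: "(\<lambda>n. y (s n)) \<longlonglongrightarrow> x"
      by (rule metric_tendsto_imp_tendsto[OF lim0]) (use y in \<open>auto simp: less_imp_le\<close>)
    have \<Psi>s: "(\<lambda>n. \<Psi>' (s n)) \<longlonglongrightarrow> mat 1"
      by (rule metric_tendsto_imp_tendsto[OF lim0]) (use SS in \<open>auto simp: S_def dist_norm\<close>)
    have J1: "J1 \<subseteq> J0" using SS[of "s 0"] sJ[of 0] by (simp add: S_def)
    have "F \<subseteq> J1 \<and> (\<exists>\<delta> \<rho>. active_solution a J0 F \<mu>' J1 x \<delta> \<rho> \<and> ?q J1 \<le> (norm \<rho>)\<^sup>2)"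
    proof (rule perturbed_solutions_limit[OF inj indep J1 F \<Psi>s ys])
      show "(\<lambda>n. A (i (s n)) j) \<longlonglongrightarrow> a j" if "j \<in> J0" for j
        by (rule filterlim_compose[OF A[OF that] i_s])
      show "0 \<le> \<nu> (i (s n)) j" if "j \<in> J0" for n j by (rule \<nu>(1)[OF that])
      show "filterlim (\<lambda>n. \<nu> (i (s n)) j) at_top sequentially" if "j \<in> F" for j
        by (rule filterlim_compose[OF \<nu>(2)[OF that] i_s])
      show "(\<lambda>n. \<nu> (i (s n)) j) \<longlonglongrightarrow> \<mu>' j" if "j \<in> J0 - F" for j
        using filterlim_compose[OF \<nu>(3)[OF that] i_s] that by (simp add: \<mu>'_def)
      show "perturbed_solution (\<Psi>' (s n)) (A (i (s n))) J0 (\<nu> (i (s n))) J1 (y (s n)) (\<delta> (s n)) (\<rho> (s n))" for n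
        using SS[of "s n"] sJ[of n] by (simp add: S_def)
      show "?q J1 \<le> \<rho> (s n) \<bullet> (\<Psi>' (s n) *v \<rho> (s n))" for n
        using SS[of "s n"] sJ[of n] by (simp add: S_def)
    qed
    then obtain \<delta> \<rho> where "F \<subseteq> J1" "active_solution a J0 F \<mu>' J1 x \<delta> \<rho>" "?q J1 \<le> (norm \<rho>)\<^sup>2"
      by (elim conjE exE)
    then show "x \<in> D" using D_sol[rule_format, OF _ J1] by metis
  qed
  moreover have Fc_sets: "Fc m \<in> sets borel" for m unfolding Fc_def by simp
  ultimately have "measure ?N (\<Inter>m. Fc m) \<le> \<alpha>"
    using D(1,2) N.finite_measure_mono[of "\<Inter>m. Fc m" D] by simp
  moreover have "(\<lambda>m. measure ?N (Fc m)) \<longlonglongrightarrow> measure ?N (\<Inter>m. Fc m)"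
  proof (rule N.finite_Lim_measure_decseq)
    show "range Fc \<subseteq> sets ?N" using Fc_sets by auto
    show "decseq Fc"
    proof (rule decseq_SucI)
      fix m
      have "S m i x \<Psi>' J \<delta> \<rho>" if "S (Suc m) i x \<Psi>' J \<delta> \<rho>" for i x \<Psi>' J \<delta> \<rho>
        using that frac_le[of 1 1 "real (Suc m)" "real (Suc (Suc m))"] by (auto simp: S_def)
      then have "B (Suc m) \<subseteq> B m" unfolding B_def using Suc_leD by blast
      then show "Fc (Suc m) \<le> Fc m" unfolding Fc_def by (rule closure_mono)
    qed
  qed
  ultimately have "\<forall>\<^sub>F m in sequentially. measure ?N (Fc m) < (\<alpha> + \<beta>) / 2"
    using \<alpha> by (intro order_tendstoD(2)) auto
  then obtain m where m: "measure ?N (Fc m) < (\<alpha> + \<beta>) / 2"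
    using eventually_happens'[OF sequentially_bot] by blast
  have orthant: "{x :: real ^ 'n. x \<le> t} \<in> sets borel" for t
    unfolding less_eq_vec_def by measurable
  have distr: "measure (distr (P i) borel (X i)) T = measure (P i) {\<omega> \<in> space (P i). X i \<omega> \<in> T}" if "T \<in> sets borel" for i T
    using that by (subst measure_distr) (auto intro!: arg_cong[where f="measure (P i)"])
  have ev1: "\<forall>\<^sub>F i in sequentially. measure (distr (P i) borel (X i)) (Fc m) < (\<alpha> + \<beta>) / 2"
  proof (rule eventually_measure_closed_less[where N = ?N])
    show "prob_space (distr (P i) borel (X i))" for i by (rule prob_space.prob_space_distr[OF P X])
    show "(\<lambda>n. measure (distr (P n) borel (X n)) {x. x \<le> t}) \<longlonglongrightarrow> measure ?N {x. x \<le> t}" for t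
      using cdf[of t] by (simp add: distr[OF orthant] std_normal_vec_cdf_def)
  qed (use m N.prob_space_axioms in \<open>auto simp: Fc_def\<close>)
  \<comment> \<open>The two thresholds \<open>(\<alpha> + \<beta>) / 2\<close> and
    \<open>(\<beta> - \<alpha>) / 2\<close> add up to \<open>\<beta>\<close>.\<close>
  have ev2: "\<forall>\<^sub>F i in sequentially. measure (P i) {\<omega> \<in> space (P i). 1 / real (Suc m) < norm (\<Psi> i \<omega> - mat 1)} < (\<beta> - \<alpha>) / 2"
    using \<alpha> by (intro order_tendstoD(2)[OF \<Psi>_lim]) auto
  show ?thesis
    using ev1 ev2 eventually_ge_at_top[of m]
  proof eventually_elim
    case (elim i)
    interpret prob_space "P i" by (rule P)
    let ?U = "{\<omega> \<in> space (P i). X i \<omega> \<in> Fc m}" and ?V = "{\<omega> \<in> space (P i). 1 / real (Suc m) < norm (\<Psi> i \<omega> - mat 1)}"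
    have U: "?U \<in> sets (P i)" using measurable_sets[OF X Fc_sets, of i m] by (simp add: vimage_def Int_def conj_commute)
    have V: "?V \<in> sets (P i)" by measurable
    have "E i \<subseteq> ?U \<union> ?V"
    proof
      fix \<omega> assume \<omega>: "\<omega> \<in> E i"
      then have sp: "\<omega> \<in> space (P i)" using E sets.sets_into_space by blast
      show "\<omega> \<in> ?U \<union> ?V"
      proof (cases "1 / real (Suc m) < norm (\<Psi> i \<omega> - mat 1)")
        case False
        obtain J \<delta> \<rho> where "J \<subseteq> J0" "perturbed_solution (\<Psi> i \<omega>) (A i) J0 (\<nu> i) J (X i \<omega>) \<delta> \<rho>" "?q J \<le> \<rho> \<bullet> (\<Psi> i \<omega> *v \<rho>)"
          using E_sol[OF \<omega>] by (elim exE conjE)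
        then have "S m i (X i \<omega>) (\<Psi> i \<omega>) J \<delta> \<rho>" using False by (simp add: S_def)
        then have "X i \<omega> \<in> B m" using elim(3) unfolding B_def by blast
        then have "X i \<omega> \<in> Fc m" unfolding Fc_def using closure_subset by blast
        then show ?thesis using sp by blast
      qed (use sp in blast)
    qed
    then have "measure (P i) (E i) \<le> measure (P i) (?U \<union> ?V)" using U V by (intro finite_measure_mono) auto
    also have "\<dots> \<le> measure (P i) ?U + measure (P i) ?V" using U V by (rule measure_Un_le)
    also have "\<dots> < \<beta>" using elim(1,2) unfolding distr[OF Fc_sets] by (simp add: field_simps)
    finally show ?case .
  qed
qed

section \<open>Karush-Kuhn-Tucker description of the confidence set\<close>

lemma independent_family:
  fixes a :: "'k \<Rightarrow> 'v::euclidean_space"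
  assumes "finite J0" and indep: "\<And>c. (\<Sum>j\<in>J0. c j *\<^sub>R a j) = 0 \<Longrightarrow> \<forall>j\<in>J0. c j = 0"
  shows "inj_on a J0" "independent (a ` J0)"
proof -
  show inj: "inj_on a J0"
  proof (rule inj_onI, rule ccontr)
    fix i j assume ij: "i \<in> J0" "j \<in> J0" "a i = a j" "i \<noteq> j"
    let ?c = "\<lambda>k. (if k = i then 1 else 0) - (if k = j then 1 else 0) :: real"
    have "(\<Sum>k\<in>J0. (if k = i then 1 else 0) *\<^sub>R a k) = a i" "(\<Sum>k\<in>J0. (if k = j then 1 else 0) *\<^sub>R a k) = a j"
      using ij(1,2) \<open>finite J0\<close> by (simp_all add: if_distrib[of "\<lambda>c. c *\<^sub>R _"] cong: if_cong)
    then have "(\<Sum>k\<in>J0. ?c k *\<^sub>R a k) = 0"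
      using ij(3) by (simp add: scaleR_left_diff_distrib sum_subtractf)
    from indep[OF this] ij show False by auto
  qed
  show "independent (a ` J0)"
  proof (rule independent_if_scalars_zero)
    fix f x assume f: "(\<Sum>x\<in>a ` J0. f x *\<^sub>R x) = 0" "x \<in> a ` J0"
    have "(\<Sum>j\<in>J0. (f \<circ> a) j *\<^sub>R a j) = 0" using f(1) by (simp add: sum.reindex[OF inj])
    from indep[OF this] f(2) show "f x = 0" by auto
  qed (use \<open>finite J0\<close> in simp)
qed

text \<open>Where the combination has norm above \<open>2 * norm y\<close>, its distance to
  \<open>y\<close> exceeds \<open>norm y\<close>, the value at 0. The remaining coefficient vectors
  form a bounded set by linear independence, hence a compact one.\<close>

lemma nnls_minimizer_exists:
  fixes a :: "'k::finite \<Rightarrow> 'v::euclidean_space"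
  assumes indep: "\<And>c. (\<Sum>j\<in>J0. c j *\<^sub>R a j) = 0 \<Longrightarrow> \<forall>j\<in>J0. c j = 0"
  shows "\<exists>l :: real ^ 'k. 0 \<le> l \<and> (\<forall>j. j \<notin> J0 \<longrightarrow> l $ j = 0) \<and>
    (\<forall>l' :: real ^ 'k. 0 \<le> l' \<longrightarrow> (\<forall>j. j \<notin> J0 \<longrightarrow> l' $ j = 0) \<longrightarrow>
       norm (y - (\<Sum>j\<in>UNIV. l $ j *\<^sub>R a j)) \<le> norm (y - (\<Sum>j\<in>UNIV. l' $ j *\<^sub>R a j)))"
proof -
  let ?S = "{l :: real ^ 'k. \<forall>j. j \<notin> J0 \<longrightarrow> l $ j = 0}"
  let ?L = "\<lambda>l :: real ^ 'k. \<Sum>j\<in>UNIV. l $ j *\<^sub>R a j"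
  have S: "subspace ?S" by (auto simp: subspace_def)
  have linL: "linear ?L"
    by (intro linearI) (simp_all add: scaleR_add_left sum.distrib scaleR_sum_right)
  have injL: "l = 0" if "l \<in> ?S" "?L l = 0" for l
  proof -
    have "(\<Sum>j\<in>J0. l $ j *\<^sub>R a j) = ?L l" using that(1) by (intro sum.mono_neutral_left) auto
    then have "\<forall>j\<in>J0. l $ j = 0" using indep[of "\<lambda>j. l $ j"] that(2) by simp
    then show ?thesis using that(1) by (auto simp: vec_eq_iff)
  qed
  obtain e where e: "e > 0" "\<And>l. l \<in> ?S \<Longrightarrow> e * norm l \<le> norm (?L l)"
    using injective_imp_isometric[of ?S ?L] closed_subspace[OF S] S linL injL by (auto simp: linear_linear)
  define C where "C = {l :: real ^ 'k. (\<forall>j. 0 \<le> l $ j) \<and> (\<forall>j. j \<notin> J0 \<longrightarrow> l $ j = 0) \<and> norm (?L l) \<le> 2 * norm y}"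
  have clC: "closed C" unfolding C_def
    by (intro closed_Collect_conj closed_Collect_all closed_Collect_imp closed_Collect_le closed_Collect_eq
        open_Collect_const continuous_intros)
  moreover have "C \<subseteq> cball 0 (2 * norm y / e)"
  proof
    fix l assume "l \<in> C"
    then have "e * norm l \<le> 2 * norm y" using e(2)[of l] by (auto simp: C_def)
    then show "l \<in> cball 0 (2 * norm y / e)" using e(1) by (simp add: field_simps)
  qed
  ultimately have "compact C" using bounded_cball bounded_subset compact_eq_bounded_closed by blast
  moreover have C0: "0 \<in> C" by (simp add: C_def)
  moreover have "continuous_on C (\<lambda>l. norm (y - ?L l))" by (intro continuous_intros)
  ultimately obtain l where l: "l \<in> C" "\<And>l'. l' \<in> C \<Longrightarrow> norm (y - ?L l) \<le> norm (y - ?L l')"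
    using continuous_attains_inf[of C "\<lambda>l. norm (y - ?L l)"] by blast
  show ?thesis
  proof (intro exI[of _ l] conjI allI impI)
    show "0 \<le> l" using l(1) by (simp add: C_def less_eq_vec_def)
    show "l $ j = 0" if "j \<notin> J0" for j using l(1) that by (simp add: C_def)
    fix l' :: "real ^ 'k" assume l': "0 \<le> l'" "\<forall>j. j \<notin> J0 \<longrightarrow> l' $ j = 0"
    show "norm (y - ?L l) \<le> norm (y - ?L l')"
    proof (cases "norm (?L l') \<le> 2 * norm y")
      case True
      then show ?thesis using l' by (intro l(2)) (simp add: C_def less_eq_vec_def)
    next
      case False
      have "norm (y - ?L l) \<le> norm y" using l(2)[OF C0] by simp
      also have "\<dots> \<le> norm (?L l') - norm y" using False by simp
      also have "\<dots> \<le> norm (y - ?L l')" by (metis norm_minus_commute norm_triangle_ineq2)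
      finally show ?thesis .
    qed
  qed
qed

lemma inner_nonpos_of_norm_le:
  fixes r d :: "'v::real_inner"
  assumes "\<And>t. 0 < t \<Longrightarrow> t \<le> 1 \<Longrightarrow> norm r \<le> norm (r - t *\<^sub>R d)"
  shows "d \<bullet> r \<le> 0"
proof (rule ccontr)
  assume "\<not> d \<bullet> r \<le> 0"
  then have pos: "0 < d \<bullet> r" by simp
  then have "d \<noteq> 0" by auto
  then have dd: "0 < d \<bullet> d" by simp
  define t where "t = min 1 (d \<bullet> r / (d \<bullet> d))"
  have t: "0 < t" "t \<le> 1" "t * (d \<bullet> d) \<le> d \<bullet> r"
    using pos dd by (auto simp: t_def min_def field_simps)
  have "(norm r)\<^sup>2 \<le> (norm (r - t *\<^sub>R d))\<^sup>2" using assms[OF t(1,2)] by (intro power_mono) auto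
  then have "2 * t * (d \<bullet> r) \<le> t * (t * (d \<bullet> d))"
    by (simp add: power2_norm_eq_inner inner_diff_left inner_diff_right inner_commute algebra_simps)
  also have "\<dots> \<le> t * (d \<bullet> r)" using t by (intro mult_left_mono) auto
  finally show False using t(1) pos by (simp add: mult.assoc)
qed

text \<open>Moving one coordinate of the minimizer up gives \<open>a j \<bullet> r \<le> 0\<close>;
  moving a positive one down gives equality. In the notation of the limit problem the multiplier is
  \<open>- l $ j\<close>, with bound 0 and no free generators.\<close>

lemma nnls_active_solution:
  fixes a :: "'k::finite \<Rightarrow> 'v::euclidean_space" and l :: "real ^ 'k"
  assumes l: "0 \<le> l" "\<And>j. j \<notin> J0 \<Longrightarrow> l $ j = 0"
    and min: "\<And>l' :: real ^ 'k. 0 \<le> l' \<Longrightarrow> (\<And>j. j \<notin> J0 \<Longrightarrow> l' $ j = 0) \<Longrightarrow>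
       norm (y - (\<Sum>j\<in>UNIV. l $ j *\<^sub>R a j)) \<le> norm (y - (\<Sum>j\<in>UNIV. l' $ j *\<^sub>R a j))"
  defines "r \<equiv> y - (\<Sum>j\<in>UNIV. l $ j *\<^sub>R a j)"
  shows "active_solution a J0 {} (\<lambda>_. 0) {j \<in> J0. a j \<bullet> r = 0} y (\<lambda>j. - l $ j) r"
proof -
  let ?L = "\<lambda>l :: real ^ 'k. \<Sum>j\<in>UNIV. l $ j *\<^sub>R a j"
  have shift: "y - ?L (l + t *\<^sub>R axis j s) = r - t *\<^sub>R (s *\<^sub>R a j)" for t j s
  proof -
    have "?L (l + t *\<^sub>R axis j s) = ?L l + (\<Sum>i\<in>UNIV. (if i = j then t * s else 0) *\<^sub>R a i)"
    proof -
      have "(l + t *\<^sub>R axis j s) $ i = l $ i + (if i = j then t * s else 0)" for i by (simp add: axis_def)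
      then show ?thesis by (simp only: scaleR_add_left sum.distrib)
    qed
    also have "(\<Sum>i\<in>UNIV. (if i = j then t * s else 0) *\<^sub>R a i) = (t * s) *\<^sub>R a j"
      by (simp add: if_distrib[of "\<lambda>c. c *\<^sub>R _"] cong: if_cong)
    finally show ?thesis by (simp add: r_def)
  qed
  have le0: "a j \<bullet> r \<le> 0" if "j \<in> J0" for j
  proof (rule inner_nonpos_of_norm_le)
    fix t :: real assume t: "0 < t" "t \<le> 1"
    have "norm r \<le> norm (y - ?L (l + t *\<^sub>R axis j 1))"
      unfolding r_def using l t that by (intro min) (auto simp: less_eq_vec_def axis_def)
    then show "norm r \<le> norm (r - t *\<^sub>R a j)" unfolding shift by simp
  qed
  have ge0: "0 \<le> a j \<bullet> r" if "j \<in> J0" "l $ j \<noteq> 0" for j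
  proof -
    have lj: "0 < l $ j" using l(1) that(2) by (simp add: less_eq_vec_def less_le)
    \<comment> \<open>Along this direction the coordinate becomes \<open>(1 - t) * l $ j\<close>,
      which stays nonnegative for \<open>t \<le> 1\<close>.\<close>
    have "((- l $ j) *\<^sub>R a j) \<bullet> r \<le> 0"
    proof (rule inner_nonpos_of_norm_le)
      fix t :: real assume t: "0 < t" "t \<le> 1"
      have tl: "t * l $ j \<le> l $ j" using t(2) lj by (simp add: mult_left_le_one_le)
      have "norm r \<le> norm (y - ?L (l + t *\<^sub>R axis j (- l $ j)))"
        unfolding r_def using l that tl by (intro min) (auto simp: less_eq_vec_def axis_def)
      then show "norm r \<le> norm (r - t *\<^sub>R ((- l $ j) *\<^sub>R a j))" unfolding shift .
    qed
    then show ?thesis using lj by (simp add: zero_le_mult_iff)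
  qed
  have "?L l = (\<Sum>j\<in>J0. l $ j *\<^sub>R a j)" using l(2) by (intro sum.mono_neutral_right) auto
  then have "r = y + (\<Sum>j\<in>J0. (- l $ j) *\<^sub>R a j)" by (simp add: r_def sum_negf)
  moreover have "l $ j = 0" if "j \<in> J0" "a j \<bullet> r \<noteq> 0" for j using le0[OF that(1)] ge0[OF that(1)] that(2) by force
  ultimately show ?thesis using le0 l(1) by (auto simp: active_solution_def less_eq_vec_def)
qed

text \<open>Whitening by the substitution \<open>p = R *v \<rho>\<close>: inner products with
  generators and the quadratic form are unchanged, so active set, multipliers and bounds carry over
  as they are.\<close>

lemma perturbed_solution_congruence:
  fixes R \<Psi> :: "real ^ 'n::finite ^ 'n"
  assumes R: "sym_pos_def R" and sol: "perturbed_solution \<Psi> a J0 \<mu> J z \<delta> p"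
  shows "perturbed_solution (R ** \<Psi> ** R) (\<lambda>j. R *v a j) J0 \<mu> J (R *v z) \<delta> (matrix_inv R *v p)"
    and "(matrix_inv R *v p) \<bullet> ((R ** \<Psi> ** R) *v (matrix_inv R *v p)) = p \<bullet> (\<Psi> *v p)"
    and "(R *v b) \<bullet> (matrix_inv R *v p) = b \<bullet> p"
proof -
  let ?\<rho> = "matrix_inv R *v p"
  have R\<rho>: "R *v ?\<rho> = p" using sym_pos_def_invertible[OF R] by (simp add: matrix_vector_mul_assoc)
  have \<Psi>\<rho>: "(R ** \<Psi> ** R) *v ?\<rho> = R *v (\<Psi> *v p)" by (simp add: matrix_vector_mul_assoc[symmetric] R\<rho>)
  have inner: "(R *v b) \<bullet> ?\<rho> = b \<bullet> p" for b
    using symmetric_inner[OF sym_pos_defD(1)[OF R], of b ?\<rho>] R\<rho> by simp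
  then show "(R *v b) \<bullet> ?\<rho> = b \<bullet> p" .
  show "?\<rho> \<bullet> ((R ** \<Psi> ** R) *v ?\<rho>) = p \<bullet> (\<Psi> *v p)"
    using inner[of "\<Psi> *v p"] by (simp add: \<Psi>\<rho> inner_commute)
  have "R *v (\<Psi> *v p) = R *v z + (\<Sum>j\<in>J0. \<delta> j *\<^sub>R (R *v a j))"
    unfolding perturbed_solutionD(1)[OF sol]
    by (simp add: matrix_vector_right_distrib linear_sum[OF matrix_vector_mul_linear] matrix_vector_mult_scaleR)
  then show "perturbed_solution (R ** \<Psi> ** R) (\<lambda>j. R *v a j) J0 \<mu> J (R *v z) \<delta> ?\<rho>"
    using sol by (simp add: perturbed_solution_def \<Psi>\<rho> inner)
qed

text \<open>The image of \<open>stack (axis j 1) 0\<close> under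
  \<open>transpose (B2_tilde B2)\<close>: up to sign, the direction in which coordinate
  \<open>j\<close> of \<lambda> moves the score.\<close>

definition score_col :: "(nat \<Rightarrow> real ^ 'k::finite) \<Rightarrow> 'k \<Rightarrow> real ^ ('k, 'l::finite) coord" where
  "score_col B2 j = stack_coord (\<lambda>i. B2 i $ j) 0"

lemma stack_coord_eqI:
  assumes "\<And>i. i < CARD('k) - 1 \<Longrightarrow> u i = u' i" "v = v'"
  shows "(stack_coord u v :: real ^ ('k::finite, 'l::finite) coord) = stack_coord u' v'"
proof -
  have "(stack_coord u v :: real ^ ('k, 'l) coord) $ c = stack_coord u' v' $ c" for c
  proof (cases "Rep_coord c")
    case (Inl i)
    then have "i < CARD('k) - 1" using Rep_coord[of c] by auto
    then show ?thesis using Inl assms(1) by (simp add: stack_coord_def)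
  qed (simp add: stack_coord_def assms(2))
  then show ?thesis by (simp add: vec_eq_iff)
qed

lemma stack_coord_Inl: "i < CARD('k) - 1 \<Longrightarrow> (stack_coord u v :: real ^ ('k::finite, 'l::finite) coord) $ Abs_coord (Inl i) = u i"
  using Abs_coord_inverse[of "Inl i :: nat + 'l", where 'k = 'k] by (simp add: stack_coord_def InlI)

lemma stack_coord_add: "stack_coord u v + stack_coord u' v' = stack_coord (\<lambda>i. u i + u' i) (v + v')"
  by (auto simp: stack_coord_def vec_eq_iff split: sum.split)

lemma sum_score_col:
  "(\<Sum>j\<in>UNIV. l $ j *\<^sub>R score_col B2 j) = stack_coord (\<lambda>i. B2 i \<bullet> l) 0"
  by (auto simp: score_col_def stack_coord_def vec_eq_iff inner_vec_def mult.commute split: sum.split)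

lemma transpose_B2_tilde_mult:
  "transpose (B2_tilde B2) *v stack u v = stack_coord (\<lambda>i. B2 i \<bullet> u) v"
proof (subst vec_eq_iff, rule allI)
  fix c :: "('a, 'b) coord"
  have sum_Plus': "(\<Sum>x\<in>UNIV. h x) = (\<Sum>k\<in>UNIV. h (Inl k)) + (\<Sum>m\<in>UNIV. h (Inr m))" for h :: "'a + 'b \<Rightarrow> real"
    unfolding UNIV_Plus_UNIV[symmetric] by (subst sum.Plus) auto
  show "(transpose (B2_tilde B2) *v stack u v) $ c = (stack_coord (\<lambda>i. B2 i \<bullet> u) v :: real ^ ('a, 'b) coord) $ c"
    by (cases "Rep_coord c")
       (simp_all add: matrix_vector_mult_def transpose_def B2_tilde_def stack_def stack_coord_def sum_Plus' inner_vec_def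
         if_distrib[of "\<lambda>c. c * _"] cong: if_cong del: transpose_matrix_vector)
qed

lemma transpose_B2_tilde_s_hat:
  "transpose (B2_tilde B2) *v s_hat f g w \<theta> l =
     stack_coord (\<lambda>i. B2 i \<bullet> f w) (g w - \<theta>) - (\<Sum>j\<in>UNIV. l $ j *\<^sub>R score_col B2 j)"
  unfolding s_hat_def transpose_B2_tilde_mult sum_score_col
  by (auto simp: stack_coord_def vec_eq_iff inner_diff_right split: sum.split)

lemma criterion_eq:
  fixes B2 :: "nat \<Rightarrow> real ^ 'k::finite" and g :: "real ^ 'k \<Rightarrow> real ^ 'l::finite" and f :: "real ^ 'k \<Rightarrow> real ^ 'k"
    and w :: "real ^ 'k" and \<theta> :: "real ^ 'l"
  defines "r l \<equiv> stack_coord (\<lambda>i. B2 i \<bullet> f w) (g w - \<theta>) - (\<Sum>j\<in>UNIV. l $ j *\<^sub>R score_col B2 j) :: real ^ ('k, 'l) coord"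
  shows "criterion B2 f g Om w \<theta> l = r l \<bullet> (matrix_inv (Om w) *v r l)"
  unfolding criterion_def r_def transpose_B2_tilde_s_hat[symmetric] matrix_vector_mul_assoc[symmetric]
  by (metis dot_lmul_matrix transpose_matrix_vector)

lemma gamma_hat_eq:
  fixes B2 :: "nat \<Rightarrow> real ^ 'k::finite" and g :: "real ^ 'k \<Rightarrow> real ^ 'l::finite" and f :: "real ^ 'k \<Rightarrow> real ^ 'k"
    and w :: "real ^ 'k" and \<theta> :: "real ^ 'l"
  defines "r l \<equiv> stack_coord (\<lambda>i. B2 i \<bullet> f w) (g w - \<theta>) - (\<Sum>j\<in>UNIV. l $ j *\<^sub>R score_col B2 j) :: real ^ ('k, 'l) coord"
  shows "gamma_hat B2 f g Om w \<theta> $ j = score_col B2 j \<bullet> (matrix_inv (Om w) *v r (lambda_hat B2 f g Om w \<theta>))"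
proof -
  have "(B_mat B2 *v x) $ j = score_col B2 j \<bullet> x" for x :: "real ^ ('k, 'l) coord"
    unfolding matrix_vector_mult_def inner_vec_def
    by (auto simp: B_mat_def score_col_def stack_coord_def intro!: sum.cong split: sum.split)
  then show ?thesis
    unfolding gamma_hat_def r_def transpose_B2_tilde_s_hat[symmetric] matrix_vector_mul_assoc[symmetric] .
qed

text \<open>The columns and the vector 1 are \<open>CARD('k)\<close> nonzero orthogonal vectors,
  hence span the space; a vector orthogonal to all columns is left with its component along
  1.\<close>

lemma orthonormal_contrasts_kernel:
  fixes B2 :: "nat \<Rightarrow> real ^ 'k::finite"
  assumes B2: "orthonormal_contrasts B2" and c: "\<And>i. i < CARD('k) - 1 \<Longrightarrow> B2 i \<bullet> c = 0"
  obtains t where "c = t *\<^sub>R 1"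
proof -
  let ?B = "insert 1 (B2 ` {..<CARD('k) - 1})"
  have on: "B2 i \<bullet> B2 j = (if i = j then 1 else 0)" "B2 i \<bullet> 1 = 0" if "i < CARD('k) - 1" "j < CARD('k) - 1" for i j
    using B2 that by (auto simp: orthonormal_contrasts_def)
  have one: "(1 :: real ^ 'k) \<bullet> 1 = real CARD('k)" by (simp add: inner_vec_def)
  have inj: "inj_on B2 {..<CARD('k) - 1}" by (intro inj_onI) (metis lessThan_iff on(1) zero_neq_one)
  have "1 \<notin> B2 ` {..<CARD('k) - 1}" using on(2) one by force
  then have card: "card ?B = CARD('k)" using card_image[OF inj] by simp
  have "pairwise orthogonal ?B"
    using on by (auto simp: pairwise_def orthogonal_def inner_commute)
  moreover have "0 \<notin> ?B" using on(1) by force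
  ultimately have "independent ?B" by (rule pairwise_orthogonal_independent)
  moreover have "dim (UNIV :: (real ^ 'k) set) \<le> card ?B" unfolding card by simp
  ultimately have "UNIV \<subseteq> span ?B" by (intro card_ge_dim_independent subset_UNIV)
  then have span: "x \<in> span ?B" for x by blast
  define t where "t = (c \<bullet> 1) / real CARD('k)"
  have "orthogonal (c - t *\<^sub>R 1) b" if b: "b \<in> ?B" for b
  proof (cases "b = 1")
    case True
    then show ?thesis by (simp add: orthogonal_def inner_diff_left t_def one)
  next
    case False
    then obtain i where i: "i < CARD('k) - 1" "b = B2 i" using b by blast
    then have "b \<bullet> c = 0" "b \<bullet> 1 = 0" using c on(2)[OF i(1) i(1)] by simp_all
    then show ?thesis by (simp add: orthogonal_def inner_diff_right inner_commute[of _ b])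
  qed
  then have "orthogonal (c - t *\<^sub>R 1) (c - t *\<^sub>R 1)" using orthogonal_to_span span by blast
  then have "c = t *\<^sub>R 1" by (simp add: orthogonal_def)
  then show ?thesis by (rule that)
qed

text \<open>The coefficients of a relation, extended by 0, form a vector orthogonal to all columns
  of \<open>B2\<close>, so a multiple of 1. It vanishes at an index outside \<open>J0\<close>, hence
  everywhere.\<close>

lemma score_col_independent:
  fixes B2 :: "nat \<Rightarrow> real ^ 'k::finite"
  assumes B2: "orthonormal_contrasts B2" and J0: "J0 \<noteq> UNIV"
    and c: "(\<Sum>j\<in>J0. c j *\<^sub>R (score_col B2 j :: real ^ ('k, 'l::finite) coord)) = 0"
  shows "\<forall>j\<in>J0. c j = 0"
proof -
  define v where "v = (\<chi> j. if j \<in> J0 then c j else 0)"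
  have "(\<Sum>j\<in>UNIV. v $ j *\<^sub>R (score_col B2 j :: real ^ ('k, 'l) coord)) = (\<Sum>j\<in>J0. c j *\<^sub>R score_col B2 j)"
    by (rule sum.mono_neutral_cong_right) (auto simp: v_def)
  then have "(stack_coord (\<lambda>i. B2 i \<bullet> v) 0 :: real ^ ('k, 'l) coord) = 0" using c unfolding sum_score_col by simp
  then have "B2 i \<bullet> v = 0" if "i < CARD('k) - 1" for i
    using stack_coord_Inl[OF that, of "\<lambda>i. B2 i \<bullet> v" "0 :: real ^ 'l"] by simp
  then obtain t where t: "v = t *\<^sub>R 1" using orthonormal_contrasts_kernel[OF B2] by blast
  obtain j0 where "j0 \<notin> J0" using J0 by blast
  then have "v $ j0 = 0" by (simp add: v_def)
  then have "t = 0" using t by simp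
  then have "v = 0" using t by simp
  then show ?thesis by (auto simp: v_def vec_eq_iff split: if_splits)
qed

text \<open>The feasible set of \<open>lambda_hat\<close> thus consists of the nonnegative vectors
  supported on the zeros of \<open>w\<close>, and these zeros form a proper subset, as
  \<open>score_col_independent\<close> requires.\<close>

lemma simplex_wts_zeros:
  fixes w :: "real ^ 'k::finite"
  assumes w: "w \<in> simplex_wts"
  shows "{j. w $ j = 0} \<noteq> UNIV" "0 \<le> l \<Longrightarrow> w \<bullet> l = 0 \<longleftrightarrow> (\<forall>j. j \<notin> {j. w $ j = 0} \<longrightarrow> l $ j = 0)"
proof -
  have w0: "0 \<le> w $ j" for j using w by (simp add: simplex_wts_def less_eq_vec_def)
  show "{j. w $ j = 0} \<noteq> UNIV"
  proof
    assume "{j. w $ j = 0} = UNIV"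
    then have "w = 0" by (auto simp: vec_eq_iff)
    then show False using w by (simp add: simplex_wts_def)
  qed
  assume l: "0 \<le> l"
  then have "0 \<le> l $ j" for j by (simp add: less_eq_vec_def)
  then have "w \<bullet> l = 0 \<longleftrightarrow> (\<forall>j\<in>UNIV. w $ j * l $ j = 0)"
    unfolding inner_vec_def inner_real_def using w0 by (subst sum_nonneg_eq_0_iff) auto
  then show "w \<bullet> l = 0 \<longleftrightarrow> (\<forall>j. j \<notin> {j. w $ j = 0} \<longrightarrow> l $ j = 0)" by auto
qed

text \<open>For invertible \<open>\<Omega>\<close>, \<open>p\<close> is its inverse applied to the
  residual, \<open>\<delta>\<close> is minus the multiplier, and
  \<open>score_col B2 j \<bullet> p\<close> is coordinate \<open>j\<close> of
  \<open>gamma_hat\<close>. Strictness off \<open>J\<close> determines \<open>J\<close>, so that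
  \<open>card J\<close> equals \<open>d_hat\<close>. Stating the equation for
  \<open>\<Omega> *v p\<close> avoids the inverse, which helps with measurability.\<close>

definition kkt_solution ::
  "(nat \<Rightarrow> real ^ 'k::finite) \<Rightarrow> real ^ 'k \<Rightarrow> real ^ ('k, 'l::finite) coord ^ ('k, 'l) coord \<Rightarrow>
   real ^ ('k, 'l) coord \<Rightarrow> 'k set \<Rightarrow> ('k \<Rightarrow> real) \<Rightarrow> real ^ ('k, 'l) coord \<Rightarrow> bool" where
  "kkt_solution B2 w \<Omega> y J \<delta> p \<longleftrightarrow> J \<subseteq> {j. w $ j = 0} \<and>
     perturbed_solution \<Omega> (score_col B2) {j. w $ j = 0} (\<lambda>_. 0) J y \<delta> p \<and>
     (\<forall>j\<in>{j. w $ j = 0} - J. score_col B2 j \<bullet> p < 0)"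

lemma active_solution_of_perturbed_mat_1:
  "perturbed_solution (mat 1) a J0 (\<lambda>_. 0) J x \<delta> \<rho> \<Longrightarrow> active_solution a J0 {} (\<lambda>_. 0) J x \<delta> \<rho>"
  unfolding perturbed_solution_def active_solution_def matrix_vector_mul_lid by blast

text \<open>In whitened coordinates the criterion is a squared distance, so
  \<open>lambda_hat\<close> is a nonnegative least squares solution and satisfies the optimality
  conditions. Uniqueness of the residual carries the statistic and the active set over to any other
  solution, so membership may be tested on an arbitrary witness.\<close>

lemma C_joint_iff_kkt_solution:
  fixes B2 :: "nat \<Rightarrow> real ^ 'k::finite" and g :: "real ^ 'k \<Rightarrow> real ^ 'l::finite" and f :: "real ^ 'k \<Rightarrow> real ^ 'k"
    and w :: "real ^ 'k" and \<theta> :: "real ^ 'l"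
  assumes B2: "orthonormal_contrasts B2" and w: "w \<in> simplex_wts" and \<theta>: "\<theta> \<in> \<Theta>" and Om: "sym_pos_def (Om w)"
  defines "y \<equiv> stack_coord (\<lambda>i. B2 i \<bullet> f w) (g w - \<theta>)"
  shows "\<exists>J \<delta> p. kkt_solution B2 w (Om w) y J \<delta> p"
    and "kkt_solution B2 w (Om w) y J \<delta> p \<Longrightarrow> (w, \<theta>) \<in> C_joint \<alpha> \<Theta> n B2 f g Om \<longleftrightarrow>
      real n * (p \<bullet> (Om w *v p)) \<le> quantile (chi_squared (CARD(('k, 'l) coord) - card J)) (1 - \<alpha>)"
proof -
  define J0 where "J0 = {j. w $ j = 0}"
  define R where "R = inv_sqrt_mat (Om w)"
  let ?a = "score_col B2 :: 'k \<Rightarrow> real ^ ('k, 'l) coord"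
  let ?b = "\<lambda>j. R *v ?a j"
  let ?V = "matrix_inv (Om w)"
  have R: "sym_pos_def R" and RR: "R ** R = ?V" using inv_sqrt_mat[OF Om] by (simp_all add: R_def)
  note invR = sym_pos_def_invertible[OF R] and invOm = sym_pos_def_invertible[OF Om]
  have symR: "x \<bullet> (R *v z) = (R *v x) \<bullet> z" for x z by (rule symmetric_inner[OF sym_pos_defD(1)[OF R]])
  have J0: "J0 \<noteq> UNIV" using simplex_wts_zeros(1)[OF w] by (simp add: J0_def)
  have indep: "\<forall>j\<in>J0. c j = 0" if "(\<Sum>j\<in>J0. c j *\<^sub>R ?b j) = 0" for c
  proof -
    have "R *v (\<Sum>j\<in>J0. c j *\<^sub>R ?a j) = 0"
      using that by (simp add: linear_sum[OF matrix_vector_mul_linear] matrix_vector_mult_scaleR)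
    then have "matrix_inv R *v (R *v (\<Sum>j\<in>J0. c j *\<^sub>R ?a j)) = 0" by simp
    then have "(\<Sum>j\<in>J0. c j *\<^sub>R ?a j) = 0" by (simp only: matrix_vector_mul_assoc invR(3) matrix_vector_mul_lid)
    then show ?thesis by (rule score_col_independent[OF B2 J0])
  qed
  define res where "res l = y - (\<Sum>j\<in>UNIV. l $ j *\<^sub>R ?a j)" for l :: "real ^ 'k"
  have Rres: "R *v res l = R *v y - (\<Sum>j\<in>UNIV. l $ j *\<^sub>R ?b j)" for l
    by (simp add: res_def matrix_vector_mult_diff_distrib linear_sum[OF matrix_vector_mul_linear] matrix_vector_mult_scaleR)
  have crit: "criterion B2 f g Om w \<theta> l = (norm (R *v res l))\<^sup>2" for l
    unfolding criterion_eq y_def[symmetric] res_def[symmetric] RR[symmetric] matrix_vector_mul_assoc[symmetric]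
    by (simp add: symR power2_norm_eq_inner)
  let ?feas = "\<lambda>l :: real ^ 'k. w \<bullet> l = 0 \<and> 0 \<le> l"
  have feas: "?feas l \<longleftrightarrow> 0 \<le> l \<and> (\<forall>j. j \<notin> J0 \<longrightarrow> l $ j = 0)" for l
    using simplex_wts_zeros(2)[OF w, of l] by (auto simp: J0_def)
  have "\<exists>l0 :: real ^ 'k. 0 \<le> l0 \<and> (\<forall>j. j \<notin> J0 \<longrightarrow> l0 $ j = 0) \<and>
    (\<forall>l' :: real ^ 'k. 0 \<le> l' \<longrightarrow> (\<forall>j. j \<notin> J0 \<longrightarrow> l' $ j = 0) \<longrightarrow>
       norm (R *v y - (\<Sum>j\<in>UNIV. l0 $ j *\<^sub>R ?b j)) \<le> norm (R *v y - (\<Sum>j\<in>UNIV. l' $ j *\<^sub>R ?b j)))"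
    by (rule nnls_minimizer_exists) (rule indep)
  then obtain l0 :: "real ^ 'k" where l0: "0 \<le> l0" "\<forall>j. j \<notin> J0 \<longrightarrow> l0 $ j = 0"
    "\<forall>l' :: real ^ 'k. 0 \<le> l' \<longrightarrow> (\<forall>j. j \<notin> J0 \<longrightarrow> l' $ j = 0) \<longrightarrow>
       norm (R *v y - (\<Sum>j\<in>UNIV. l0 $ j *\<^sub>R ?b j)) \<le> norm (R *v y - (\<Sum>j\<in>UNIV. l' $ j *\<^sub>R ?b j))"
    by (elim exE conjE)
  have "?feas l0" using l0(1,2) feas[of l0] by blast
  moreover have "criterion B2 f g Om w \<theta> l0 \<le> criterion B2 f g Om w \<theta> l'" if "?feas l'" for l'
  proof -
    have "norm (R *v y - (\<Sum>j\<in>UNIV. l0 $ j *\<^sub>R ?b j)) \<le> norm (R *v y - (\<Sum>j\<in>UNIV. l' $ j *\<^sub>R ?b j))"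
      using l0(3) that feas[of l'] by blast
    then show ?thesis unfolding crit Rres by (intro power_mono norm_ge_zero)
  qed
  ultimately have "is_arg_min (criterion B2 f g Om w \<theta>) ?feas l0"
    unfolding is_arg_min_linorder by blast
  then have am: "is_arg_min (criterion B2 f g Om w \<theta>) ?feas (lambda_hat B2 f g Om w \<theta>)"
    unfolding lambda_hat_def arg_min_def by (rule someI)
  define l where "l = lambda_hat B2 f g Om w \<theta>"
  define r where "r = R *v res l"
  define Jh where "Jh = {j \<in> J0. ?b j \<bullet> r = 0}"
  have l: "0 \<le> l" "\<And>j. j \<notin> J0 \<Longrightarrow> l $ j = 0" using am feas[of l] unfolding is_arg_min_def l_def by blast+
  have lmin: "norm (R *v y - (\<Sum>j\<in>UNIV. l $ j *\<^sub>R ?b j)) \<le> norm (R *v y - (\<Sum>j\<in>UNIV. l' $ j *\<^sub>R ?b j))"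
    if "0 \<le> l'" "\<And>j. j \<notin> J0 \<Longrightarrow> l' $ j = 0" for l'
  proof -
    have "\<not> criterion B2 f g Om w \<theta> l' < criterion B2 f g Om w \<theta> l"
      using am that feas[of l'] unfolding is_arg_min_def l_def by blast
    then have "(norm (R *v res l))\<^sup>2 \<le> (norm (R *v res l'))\<^sup>2" unfolding crit not_less .
    then show ?thesis unfolding Rres by (rule power2_le_imp_le) simp
  qed
  have act: "active_solution ?b J0 {} (\<lambda>_. 0) Jh (R *v y) (\<lambda>j. - l $ j) r"
    using nnls_active_solution[OF l lmin] by (simp add: Jh_def r_def Rres)
  note actD = active_solutionD[OF act]
  have bp: "?b j \<bullet> x = ?a j \<bullet> (R *v x)" for j x by (simp add: symR)
  have "Om w *v (R *v r) = y + (\<Sum>j\<in>J0. (- l $ j) *\<^sub>R ?a j)"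
  proof -
    have "Om w *v (R *v r) = res l"
      by (simp add: r_def matrix_vector_mul_assoc matrix_mul_assoc[symmetric] RR invOm(2))
    also have "(\<Sum>j\<in>UNIV. l $ j *\<^sub>R ?a j) = (\<Sum>j\<in>J0. l $ j *\<^sub>R ?a j)"
      using l(2) by (intro sum.mono_neutral_right) auto
    then have "res l = y + (\<Sum>j\<in>J0. (- l $ j) *\<^sub>R ?a j)" by (simp add: res_def sum_negf)
    finally show ?thesis .
  qed
  moreover have "\<forall>j\<in>Jh. ?a j \<bullet> (R *v r) = 0" unfolding Jh_def bp by blast
  moreover have nonpos: "\<forall>j\<in>J0. ?a j \<bullet> (R *v r) \<le> 0" using actD(3) unfolding bp by blast
  moreover have "\<forall>j\<in>J0 - Jh. - l $ j = 0" "\<forall>j\<in>Jh. - l $ j \<le> 0" using actD(4,5) by blast+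
  moreover have "\<forall>j\<in>J0 - Jh. ?a j \<bullet> (R *v r) < 0"
    using nonpos unfolding Jh_def bp by (simp add: less_le)
  moreover have "Jh \<subseteq> J0" by (simp add: Jh_def)
  ultimately have "kkt_solution B2 w (Om w) y Jh (\<lambda>j. - l $ j) (R *v r)"
    unfolding kkt_solution_def J0_def[symmetric] perturbed_solution_def by blast
  then show "\<exists>J \<delta> p. kkt_solution B2 w (Om w) y J \<delta> p" by blast
  assume sol: "kkt_solution B2 w (Om w) y J \<delta> p"
  define \<rho> where "\<rho> = matrix_inv R *v p"
  have J: "J \<subseteq> J0" and psol: "perturbed_solution (Om w) ?a J0 (\<lambda>_. 0) J y \<delta> p" and strict: "\<forall>j\<in>J0 - J. ?a j \<bullet> p < 0"
    using sol by (auto simp: kkt_solution_def J0_def)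
  have ROR: "R ** Om w ** R = mat 1" unfolding R_def by (rule inv_sqrt_mat_congruence[OF Om])
  note cong = perturbed_solution_congruence[OF R psol, unfolded ROR, folded \<rho>_def]
  have "active_solution ?b J0 {} (\<lambda>_. 0) J (R *v y) \<delta> \<rho>"
    by (rule active_solution_of_perturbed_mat_1[OF cong(1)])
  from active_solution_unique[OF _ _ _ J _ this act] have \<rho>r: "\<rho> = r" by (simp add: Jh_def)
  have bj: "?b j \<bullet> r = ?a j \<bullet> p" for j using cong(3) \<rho>r by simp
  have "j \<in> J \<longleftrightarrow> j \<in> J0 \<and> ?a j \<bullet> p = 0" for j
    using J strict perturbed_solutionD(2)[OF psol] by (metis DiffI less_irrefl subsetD)
  then have JJ: "J = Jh" unfolding Jh_def bj by blast
  have val: "p \<bullet> (Om w *v p) = (norm r)\<^sup>2" using cong(2) \<rho>r by (simp add: power2_norm_eq_inner)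
  have T: "T_stat n B2 f g Om w \<theta> = real n * (p \<bullet> (Om w *v p))"
    unfolding T_stat_def crit l_def[symmetric] r_def[symmetric] val ..
  have "gamma_hat B2 f g Om w \<theta> $ j = ?b j \<bullet> r" for j
    unfolding gamma_hat_eq l_def[symmetric] y_def[symmetric] res_def[symmetric] RR[symmetric] matrix_vector_mul_assoc[symmetric] r_def
    by (simp add: symR)
  then have "{j. gamma_hat B2 f g Om w \<theta> $ j = 0 \<and> w $ j = 0} = J" unfolding JJ Jh_def J0_def by (simp add: conj_commute)
  then have d: "d_hat B2 f g Om w \<theta> = card J" by (simp add: d_hat_def)
  \<comment> \<open>\<open>J\<close> misses an index of positive weight, so
    \<open>CARD('k) + CARD('l) - 1 - card J\<close> is at least \<open>CARD('l)\<close>, hence at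
    least 1, which evaluates the maximum in \<open>k_hat\<close>.\<close>
  have "J \<subset> UNIV" using J J0 by blast
  then have "card J < CARD('k)" by (intro psubset_card_mono) auto
  moreover have "0 < CARD('l)" by simp
  ultimately have "k_hat B2 f g Om w \<theta> = CARD(('k, 'l) coord) - card J" unfolding k_hat_def d card_coord by linarith
  then show "(w, \<theta>) \<in> C_joint \<alpha> \<Theta> n B2 f g Om \<longleftrightarrow>
      real n * (p \<bullet> (Om w *v p)) \<le> quantile (chi_squared (CARD(('k, 'l) coord) - card J)) (1 - \<alpha>)"
    using w \<theta> by (simp add: C_joint_def T)
qed

text \<open>A closed set is a countable union of compact ones, whose projections are compact.
  Projections of arbitrary Borel sets need not be Borel.\<close>

lemma sets_borel_fst_closed:
  fixes S :: "('a::euclidean_space \<times> 'b::euclidean_space) set"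
  assumes "closed S"
  shows "fst ` S \<in> sets borel"
proof -
  have "S = (\<Union>n::nat. S \<inter> cball 0 (real n))"
  proof (intro equalityI subsetI)
    fix x assume "x \<in> S"
    obtain n :: nat where "norm x \<le> real n" using real_arch_simple by blast
    then show "x \<in> (\<Union>n::nat. S \<inter> cball 0 (real n))" using \<open>x \<in> S\<close> by (intro UN_I[of n]) auto
  qed auto
  from arg_cong[OF this, of "image fst"]
  have eq: "fst ` S = (\<Union>n::nat. fst ` (S \<inter> cball 0 (real n)))" by (simp only: image_UN)
  have "compact (fst ` (S \<inter> cball 0 (real n)))" for n
    using assms by (intro compact_continuous_image closed_Int_compact continuous_on_fst continuous_on_id compact_cball)
  then have "fst ` (S \<inter> cball 0 (real n)) \<in> sets borel" for n by (rule borel_compact)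
  then show ?thesis unfolding eq by (intro sets.countable_UN image_subsetI)
qed

text \<open>The set is a countable union of projections of closed sets, hence Borel.\<close>

lemma sets_kkt_solution:
  fixes B2 :: "nat \<Rightarrow> real ^ 'k::finite" and w :: "real ^ 'k"
  shows "{(y :: real ^ ('k, 'l::finite) coord, \<Omega>). \<exists>J \<delta> p. kkt_solution B2 w \<Omega> y J \<delta> p \<and> real n * (p \<bullet> (\<Omega> *v p)) \<le> q (card J)} \<in> sets borel"
proof -
  let ?a = "score_col B2 :: 'k \<Rightarrow> real ^ ('k, 'l) coord"
  let ?J0 = "{j. w $ j = 0}"
  \<comment> \<open>For fixed \<open>J\<close> the conditions become closed once the strict
    inequality is replaced by the margin \<open>1 / Suc m\<close>. The multipliers enter as a
    vector, so that the witnesses range over a Euclidean space.\<close>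
  define S where "S J m = {z :: ((real ^ ('k, 'l) coord) \<times> (real ^ ('k, 'l) coord ^ ('k, 'l) coord)) \<times> ((real ^ ('k, 'l) coord) \<times> (real ^ 'k)).
     snd (fst z) *v fst (snd z) = fst (fst z) + (\<Sum>j\<in>?J0. snd (snd z) $ j *\<^sub>R ?a j) \<and>
     (\<forall>j\<in>J. ?a j \<bullet> fst (snd z) = 0) \<and> (\<forall>j\<in>?J0 - J. ?a j \<bullet> fst (snd z) \<le> - (1 / real (Suc m))) \<and>
     (\<forall>j\<in>?J0 - J. snd (snd z) $ j = 0) \<and> (\<forall>j\<in>J. snd (snd z) $ j \<le> 0) \<and>
     real n * (fst (snd z) \<bullet> (snd (fst z) *v fst (snd z))) \<le> q (card J)}" for J m
  have "closed (S J m)" for J m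
    unfolding S_def Ball_def
    by (intro closed_Collect_conj closed_Collect_all closed_Collect_imp closed_Collect_le closed_Collect_eq
        open_Collect_const continuous_intros continuous_on_matrix_vector_mult)
  then have "(\<Union>J\<in>{J. J \<subseteq> ?J0}. \<Union>m. fst ` S J m) \<in> sets borel"
    by (intro sets.finite_UN sets.countable_UN) (auto intro: sets_borel_fst_closed)
  also have "(\<Union>J\<in>{J. J \<subseteq> ?J0}. \<Union>m. fst ` S J m) =
      {(y, \<Omega>). \<exists>J \<delta> p. kkt_solution B2 w \<Omega> y J \<delta> p \<and> real n * (p \<bullet> (\<Omega> *v p)) \<le> q (card J)}" (is "?A = ?B")
  proof (intro equalityI subsetI)
    fix z assume "z \<in> ?A"
    then obtain J m where J: "J \<subseteq> ?J0" and "z \<in> fst ` S J m" by blast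
    then obtain x where x: "x \<in> S J m" "z = fst x" by blast
    define p d where "p = fst (snd x)" and "d = snd (snd x)"
    have z: "snd z *v p = fst z + (\<Sum>j\<in>?J0. d $ j *\<^sub>R ?a j)" "\<forall>j\<in>J. ?a j \<bullet> p = 0"
      "\<forall>j\<in>?J0 - J. ?a j \<bullet> p \<le> - (1 / real (Suc m))" "\<forall>j\<in>?J0 - J. d $ j = 0" "\<forall>j\<in>J. d $ j \<le> 0"
      "real n * (p \<bullet> (snd z *v p)) \<le> q (card J)"
      using x(1) unfolding S_def x(2) p_def d_def mem_Collect_eq by blast+
    have neg: "?a j \<bullet> p < 0" if "j \<in> ?J0 - J" for j
    proof -
      have "(0::real) < 1 / real (Suc m)" by simp
      then show ?thesis using bspec[OF z(3) that] by linarith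
    qed
    have "?a j \<bullet> p \<le> 0" if "j \<in> ?J0" for j
      using neg[of j] z(2) that by (cases "j \<in> J") (auto intro: less_imp_le)
    then have "kkt_solution B2 w (snd z) (fst z) J (($) d) p"
      using z J neg unfolding kkt_solution_def perturbed_solution_def by blast
    then show "z \<in> ?B" using z(6) unfolding case_prod_unfold by blast
  next
    fix z assume "z \<in> ?B"
    then obtain J \<delta> p where k: "kkt_solution B2 w (snd z) (fst z) J \<delta> p" and q: "real n * (p \<bullet> (snd z *v p)) \<le> q (card J)"
      unfolding case_prod_unfold by blast
    have J: "J \<subseteq> ?J0" and sol: "perturbed_solution (snd z) ?a ?J0 (\<lambda>_. 0) J (fst z) \<delta> p"
      and strict: "\<forall>j\<in>?J0 - J. ?a j \<bullet> p < 0" using k by (simp_all add: kkt_solution_def)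
    have "\<forall>j\<in>?J0 - J. \<forall>\<^sub>F m in sequentially. ?a j \<bullet> p \<le> - (1 / real (Suc m))"
    proof
      fix j assume "j \<in> ?J0 - J"
      then have "0 < - (?a j \<bullet> p)" using strict by simp
      then have "\<forall>\<^sub>F m in sequentially. 1 / real (Suc m) < - (?a j \<bullet> p)"
        using order_tendstoD(2)[OF LIMSEQ_Suc[OF lim_inverse_n']] by blast
      then show "\<forall>\<^sub>F m in sequentially. ?a j \<bullet> p \<le> - (1 / real (Suc m))" by eventually_elim simp
    qed
    then have "\<forall>\<^sub>F m in sequentially. \<forall>j\<in>?J0 - J. ?a j \<bullet> p \<le> - (1 / real (Suc m))"
      by (intro eventually_ball_finite) auto
    then obtain m where m: "\<forall>j\<in>?J0 - J. ?a j \<bullet> p \<le> - (1 / real (Suc m))"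
      using eventually_happens'[OF sequentially_bot] by blast
    have "(z, (p, \<chi> j. \<delta> j)) \<in> S J m"
      using m q sol by (simp add: S_def perturbed_solution_def)
    from imageI[OF this, of fst] have "z \<in> fst ` S J m" by (simp only: fst_conv)
    then show "z \<in> ?A" using J by blast
  qed
  finally show ?thesis .
qed

lemma continuous_on_stack_coord:
  "continuous_on S u \<Longrightarrow> continuous_on S v \<Longrightarrow> continuous_on S (\<lambda>z. stack_coord (\<lambda>i. B2 i \<bullet> u z) (v z) :: real ^ ('k::finite, 'l::finite) coord)"
  unfolding stack_coord_def
proof (rule continuous_on_vec_lambda)
  fix c :: "('k, 'l) coord"
  assume "continuous_on S u" "continuous_on S v"
  then show "continuous_on S (\<lambda>z. case Rep_coord c of Inl i \<Rightarrow> B2 i \<bullet> u z | Inr l \<Rightarrow> v z $ l)"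
    by (cases "Rep_coord c") (auto intro!: continuous_intros)
qed

text \<open>The event is the preimage of the set of data admitting a \<open>kkt_solution\<close>
  with value below the quantile; this sidesteps the measurability of the choice made in
  \<open>lambda_hat\<close>.\<close>

lemma sets_C_joint:
  fixes B2 :: "nat \<Rightarrow> real ^ 'k::finite" and \<theta> :: "real ^ 'l::finite"
  assumes B2: "orthonormal_contrasts B2" and w: "w \<in> simplex_wts" and \<theta>: "\<theta> \<in> \<Theta>"
    and spd: "\<And>\<omega>. \<omega> \<in> space P \<Longrightarrow> sym_pos_def (\<Omega>h w \<omega>)"
    and [measurable]: "\<phi>h w \<in> borel_measurable P" "\<theta>h w \<in> borel_measurable P" "\<Omega>h w \<in> borel_measurable P"
  shows "{\<omega> \<in> space P. (w, \<theta>) \<in> C_joint \<alpha> \<Theta> n B2 (\<lambda>v. \<phi>h v \<omega>) (\<lambda>v. \<theta>h v \<omega>) (\<lambda>v. \<Omega>h v \<omega>)} \<in> sets P"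
proof -
  define y where "y \<omega> = (stack_coord (\<lambda>i. B2 i \<bullet> \<phi>h w \<omega>) (\<theta>h w \<omega> - \<theta>) :: real ^ ('k, 'l) coord)" for \<omega>
  let ?q = "\<lambda>d. quantile (chi_squared (CARD(('k, 'l) coord) - d)) (1 - \<alpha>)"
  let ?B = "{(y :: real ^ ('k, 'l) coord, \<Omega>). \<exists>J \<delta> p. kkt_solution B2 w \<Omega> y J \<delta> p \<and> real n * (p \<bullet> (\<Omega> *v p)) \<le> ?q (card J)}"
  have "(\<lambda>z. stack_coord (\<lambda>i. B2 i \<bullet> fst z) (snd z - \<theta>) :: real ^ ('k, 'l) coord) \<in> borel_measurable borel"
    by (intro borel_measurable_continuous_onI continuous_on_stack_coord continuous_intros)
  then have "(\<lambda>\<omega>. (\<lambda>z. stack_coord (\<lambda>i. B2 i \<bullet> fst z) (snd z - \<theta>) :: real ^ ('k, 'l) coord) (\<phi>h w \<omega>, \<theta>h w \<omega>)) \<in> borel_measurable P"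
    by (rule measurable_compose[rotated]) (intro borel_measurable_Pair, measurable)
  then have [measurable]: "y \<in> borel_measurable P" by (simp add: y_def[abs_def])
  have "(\<lambda>\<omega>. (y \<omega>, \<Omega>h w \<omega>)) \<in> borel_measurable P" by (intro borel_measurable_Pair) measurable
  from measurable_sets[OF this sets_kkt_solution[of B2 w n ?q]]
  have "(\<lambda>\<omega>. (y \<omega>, \<Omega>h w \<omega>)) -` ?B \<inter> space P \<in> sets P" .
  moreover have "{\<omega> \<in> space P. (w, \<theta>) \<in> C_joint \<alpha> \<Theta> n B2 (\<lambda>v. \<phi>h v \<omega>) (\<lambda>v. \<theta>h v \<omega>) (\<lambda>v. \<Omega>h v \<omega>)} = (\<lambda>\<omega>. (y \<omega>, \<Omega>h w \<omega>)) -` ?B \<inter> space P"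
  proof -
    have "(w, \<theta>) \<in> C_joint \<alpha> \<Theta> n B2 (\<lambda>v. \<phi>h v \<omega>) (\<lambda>v. \<theta>h v \<omega>) (\<lambda>v. \<Omega>h v \<omega>) \<longleftrightarrow> (y \<omega>, \<Omega>h w \<omega>) \<in> ?B"
      if \<omega>: "\<omega> \<in> space P" for \<omega>
    proof -
      note char = C_joint_iff_kkt_solution[OF B2 w \<theta>, of "\<lambda>v. \<Omega>h v \<omega>" "\<lambda>v. \<phi>h v \<omega>" "\<lambda>v. \<theta>h v \<omega>", folded y_def, OF spd[OF \<omega>]]
      show ?thesis
      proof
        assume C: "(w, \<theta>) \<in> C_joint \<alpha> \<Theta> n B2 (\<lambda>v. \<phi>h v \<omega>) (\<lambda>v. \<theta>h v \<omega>) (\<lambda>v. \<Omega>h v \<omega>)"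
        obtain J \<delta> p where k: "kkt_solution B2 w (\<Omega>h w \<omega>) (y \<omega>) J \<delta> p" using char(1) by (elim exE)
        moreover have "real n * (p \<bullet> (\<Omega>h w \<omega> *v p)) \<le> ?q (card J)" using C by (simp only: char(2)[OF k])
        ultimately show "(y \<omega>, \<Omega>h w \<omega>) \<in> ?B" by (intro CollectI case_prodI exI conjI)
      next
        assume "(y \<omega>, \<Omega>h w \<omega>) \<in> ?B"
        then obtain J \<delta> p where k: "kkt_solution B2 w (\<Omega>h w \<omega>) (y \<omega>) J \<delta> p"
          and "real n * (p \<bullet> (\<Omega>h w \<omega> *v p)) \<le> ?q (card J)" by (elim CollectE case_prodE exE conjE) simp
        then show "(w, \<theta>) \<in> C_joint \<alpha> \<Theta> n B2 (\<lambda>v. \<phi>h v \<omega>) (\<lambda>v. \<theta>h v \<omega>) (\<lambda>v. \<Omega>h v \<omega>)"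
          by (simp only: char(2)[OF k])
      qed
    qed
    then show ?thesis unfolding vimage_def by (auto simp only: mem_Collect_eq Int_iff)
  qed
  ultimately show ?thesis by (simp only:)
qed

section \<open>First-order conditions for optimal weights\<close>

text \<open>Passes from the data \<open>y\<close>, with all bounds 0, to the centered and scaled
  data \<open>z\<close>: the drift along the generators is absorbed into the multipliers, whose
  bounds become \<open>\<mu>\<close>.\<close>

lemma perturbed_solution_rescale:
  assumes sol: "perturbed_solution \<Omega> a J0 (\<lambda>_. 0) J y \<delta> p" and s: "0 \<le> s"
    and y: "s *\<^sub>R y = z + (\<Sum>j\<in>J0. \<mu> j *\<^sub>R a j)"
  shows "perturbed_solution \<Omega> a J0 \<mu> J z (\<lambda>j. s * \<delta> j + \<mu> j) (s *\<^sub>R p)"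
proof -
  note D = perturbed_solutionD[OF sol]
  have "\<Omega> *v (s *\<^sub>R p) = s *\<^sub>R y + (\<Sum>j\<in>J0. (s * \<delta> j) *\<^sub>R a j)"
    by (simp add: matrix_vector_mult_scaleR D(1) scaleR_right_distrib scaleR_sum_right)
  also have "\<dots> = z + (\<Sum>j\<in>J0. (s * \<delta> j + \<mu> j) *\<^sub>R a j)"
    unfolding y by (simp add: scaleR_left_distrib sum.distrib)
  finally show ?thesis
    using D(2-5) s by (auto simp: perturbed_solution_def mult_nonneg_nonpos)
qed

lemma compact_simplex_wts: "compact (simplex_wts :: (real ^ 'k::finite) set)"
proof -
  have eq: "simplex_wts = {w :: real ^ 'k. (\<forall>j. 0 \<le> w $ j) \<and> w \<bullet> 1 = 1}"
    by (simp add: simplex_wts_def less_eq_vec_def)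
  have "closed (simplex_wts :: (real ^ 'k) set)"
    unfolding eq by (intro closed_Collect_conj closed_Collect_all closed_Collect_le closed_Collect_eq continuous_intros)
  moreover have "norm w \<le> 1" if "w \<in> simplex_wts" for w :: "real ^ 'k"
    using norm_le_l1_cart[of w] that by (simp add: eq inner_vec_def)
  then have "bounded (simplex_wts :: (real ^ 'k) set)" by (auto intro: boundedI)
  ultimately show ?thesis by (simp add: compact_eq_bounded_closed)
qed

lemma axis_in_simplex_wts: "axis j 1 \<in> simplex_wts"
  by (auto simp: simplex_wts_def less_eq_vec_def axis_def inner_vec_def if_distrib cong: if_cong)

lemma opt_wts_le:
  fixes q :: "real ^ 'k::finite \<Rightarrow> real"
  assumes q: "continuous_on UNIV q"
  shows "opt_wts q \<noteq> {}" and "w \<in> opt_wts q \<Longrightarrow> v \<in> simplex_wts \<Longrightarrow> q w \<le> q v"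
proof -
  have ne: "(simplex_wts :: (real ^ 'k) set) \<noteq> {}" using axis_in_simplex_wts by blast
  obtain w0 where w0: "w0 \<in> simplex_wts" "\<forall>v\<in>simplex_wts. q w0 \<le> q v"
    using continuous_attains_inf[OF compact_simplex_wts ne continuous_on_subset[OF q subset_UNIV]] by blast
  then have bdd: "bdd_below (q ` simplex_wts)" by (auto intro: bdd_belowI)
  have "(INF v\<in>simplex_wts. q v) = q w0"
    using w0 ne by (intro antisym cINF_lower[OF bdd] cINF_greatest) auto
  then show "opt_wts q \<noteq> {}" using w0(1) by (auto simp: opt_wts_def)
  show "q w \<le> q v" if "w \<in> opt_wts q" "v \<in> simplex_wts"
    using that cINF_lower[OF bdd that(2)] by (simp add: opt_wts_def)
qed

text \<open>Testing optimality against the vertices of the simplex gives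
  \<open>\<phi> w $ j \<ge> w \<bullet> \<phi> w\<close> for every \<open>j\<close>. The constant
  \<open>c = w \<bullet> \<phi> w\<close> is forced by \<open>w \<bullet> l = 0\<close> and
  \<open>w \<bullet> 1 = 1\<close>.\<close>

lemma opt_wts_multipliers:
  fixes q :: "real ^ 'k::finite \<Rightarrow> real"
  assumes q: "\<And>w. GDERIV q w :> \<phi> w" and w: "w \<in> opt_wts q"
  shows "\<exists>l c. 0 \<le> l \<and> (\<forall>j. w $ j \<noteq> 0 \<longrightarrow> l $ j = 0) \<and> \<phi> w = l + c *\<^sub>R 1"
proof -
  have "continuous_on UNIV q"
    using q by (auto simp: continuous_on_eq_continuous_at gderiv_def intro: has_derivative_continuous)
  note le = opt_wts_le(2)[OF this w]
  have ws: "w \<in> simplex_wts" using w by (simp add: opt_wts_def)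
  have w0: "0 \<le> w $ j" for j using ws by (simp add: simplex_wts_def less_eq_vec_def)
  have w1: "w \<bullet> 1 = 1" using ws by (simp add: simplex_wts_def)
  have dir: "0 \<le> (v - w) \<bullet> \<phi> w" if v: "v \<in> simplex_wts" for v
  proof (rule ccontr)
    assume neg: "\<not> 0 \<le> (v - w) \<bullet> \<phi> w"
    have "((\<lambda>t. w + t *\<^sub>R (v - w)) has_derivative (\<lambda>t. t *\<^sub>R (v - w))) (at 0)"
      by (auto intro!: derivative_eq_intros)
    moreover have "(q has_derivative (\<lambda>h. h \<bullet> \<phi> w)) (at (w + 0 *\<^sub>R (v - w)))"
      using q[of w] by (simp add: gderiv_def)
    ultimately have "((\<lambda>t. q (w + t *\<^sub>R (v - w))) has_derivative (\<lambda>t. (t *\<^sub>R (v - w)) \<bullet> \<phi> w)) (at 0)"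
      by (rule has_derivative_compose)
    then have "DERIV (\<lambda>t. q (w + t *\<^sub>R (v - w))) 0 :> (v - w) \<bullet> \<phi> w"
      by (simp add: has_field_derivative_def mult_commute_abs)
    from DERIV_neg_dec_right[OF this] neg obtain d where d: "d > 0" "\<And>h. 0 < h \<Longrightarrow> h < d \<Longrightarrow> q (w + h *\<^sub>R (v - w)) < q w"
      by auto
    define h where "h = min (d / 2) 1"
    have h: "0 < h" "h < d" "h \<le> 1" using d(1) by (auto simp: h_def)
    have "w + h *\<^sub>R (v - w) \<in> simplex_wts"
    proof -
      have eq: "w + h *\<^sub>R (v - w) = (1 - h) *\<^sub>R w + h *\<^sub>R v" by (simp add: algebra_simps)
      have "0 \<le> v $ j" for j using v by (simp add: simplex_wts_def less_eq_vec_def)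
      then show ?thesis unfolding eq using w0 w1 v h by (simp add: simplex_wts_def less_eq_vec_def inner_add_left)
    qed
    from le[OF this] d(2)[OF h(1,2)] show False by simp
  qed
  define c where "c = w \<bullet> \<phi> w"
  define l where "l = \<phi> w - c *\<^sub>R 1"
  have "0 \<le> l $ j" for j
    using dir[OF axis_in_simplex_wts, of j] by (simp add: l_def c_def inner_diff_left inner_axis')
  then have l0: "0 \<le> l" by (simp add: less_eq_vec_def)
  moreover have "w \<bullet> l = 0" using w1 by (simp add: l_def c_def inner_diff_right)
  then have "\<forall>j. w $ j \<noteq> 0 \<longrightarrow> l $ j = 0" using simplex_wts_zeros(2)[OF ws l0] by simp
  moreover have "\<phi> w = l + c *\<^sub>R 1" by (simp add: l_def)
  ultimately show ?thesis by blast
qed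

text \<open>The columns of \<open>B2\<close> annihilate the multiple of 1 in the gradient; what
  remains is the centered score plus the multipliers times the generators.\<close>

lemma stack_coord_centered:
  fixes B2 :: "nat \<Rightarrow> real ^ 'k::finite" and v \<theta> :: "real ^ 'l::finite"
  assumes B2: "orthonormal_contrasts B2" and \<phi>: "\<phi> = l + c *\<^sub>R 1" and l: "\<And>j. j \<notin> J0 \<Longrightarrow> l $ j = 0"
  shows "s *\<^sub>R (stack_coord (\<lambda>i. B2 i \<bullet> u) (v - \<theta>) :: real ^ ('k, 'l) coord) =
    s *\<^sub>R stack_coord (\<lambda>i. B2 i \<bullet> (u - \<phi>)) (v - \<theta>) + (\<Sum>j\<in>J0. (s * l $ j) *\<^sub>R score_col B2 j)"
proof -
  have "(\<Sum>j\<in>J0. (s * l $ j) *\<^sub>R (score_col B2 j :: real ^ ('k, 'l) coord)) = s *\<^sub>R (\<Sum>j\<in>J0. l $ j *\<^sub>R score_col B2 j)"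
    by (simp add: scaleR_sum_right)
  also have "(\<Sum>j\<in>J0. l $ j *\<^sub>R (score_col B2 j :: real ^ ('k, 'l) coord)) = (\<Sum>j\<in>UNIV. l $ j *\<^sub>R score_col B2 j)"
    using l by (intro sum.mono_neutral_left) auto
  also have "\<dots> = stack_coord (\<lambda>i. B2 i \<bullet> l) 0" by (rule sum_score_col)
  finally have sum: "(\<Sum>j\<in>J0. (s * l $ j) *\<^sub>R (score_col B2 j :: real ^ ('k, 'l) coord)) = s *\<^sub>R stack_coord (\<lambda>i. B2 i \<bullet> l) 0" .
  have "(stack_coord (\<lambda>i. B2 i \<bullet> u) (v - \<theta>) :: real ^ ('k, 'l) coord) = stack_coord (\<lambda>i. B2 i \<bullet> (u - \<phi>) + B2 i \<bullet> l) (v - \<theta> + 0)"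
    using B2 by (intro stack_coord_eqI) (auto simp: \<phi> orthonormal_contrasts_def inner_diff_right inner_add_right)
  then show ?thesis unfolding sum stack_coord_add[symmetric] by (simp add: scaleR_right_distrib)
qed

section \<open>Coverage\<close>

text \<open>The map \<open>m / (1 + m)\<close> embeds the half-line in the unit interval, with 1
  standing for infinity, so that subsequences can be extracted by compactness even for unbounded
  multipliers.\<close>

lemma tendsto_odds:
  fixes m :: "nat \<Rightarrow> real"
  assumes m: "\<And>i. 0 \<le> m i" and lim: "(\<lambda>i. m i / (1 + m i)) \<longlonglongrightarrow> L"
  shows "L = 1 \<Longrightarrow> filterlim m at_top sequentially" and "L \<noteq> 1 \<Longrightarrow> m \<longlonglongrightarrow> L / (1 - L)"
proof -
  have inv: "1 - m i / (1 + m i) = inverse (1 + m i)" for i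
    using m[of i] by (simp add: field_simps)
  show "filterlim m at_top sequentially" if "L = 1"
  proof -
    have "(\<lambda>i. 1 - m i / (1 + m i)) \<longlonglongrightarrow> 1 - L" by (intro tendsto_intros lim)
    then have "(\<lambda>i. inverse (1 + m i)) \<longlonglongrightarrow> 0" unfolding inv using that by simp
    then have "filterlim (\<lambda>i. inverse (inverse (1 + m i))) at_top sequentially"
      by (rule filterlim_inverse_at_top) (use m in \<open>auto simp: add_pos_nonneg\<close>)
    then have "filterlim (\<lambda>i. 1 + m i) at_top sequentially" by simp
    from filterlim_tendsto_add_at_top[OF tendsto_const[of "- 1"] this] show ?thesis by simp
  qed
  show "m \<longlonglongrightarrow> L / (1 - L)" if "L \<noteq> 1"
  proof -
    have "(\<lambda>i. (m i / (1 + m i)) / (1 - m i / (1 + m i))) \<longlonglongrightarrow> L / (1 - L)"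
      using that by (intro tendsto_intros lim) simp
    moreover have "(m i / (1 + m i)) / (1 - m i / (1 + m i)) = m i" for i
      unfolding inv using m[of i] by (simp add: field_simps add_nonneg_eq_0_iff)
    ultimately show ?thesis by simp
  qed
qed

lemma infinite_image_constant_subset:
  assumes "infinite A" "finite (range (f :: 'a \<Rightarrow> 'b))"
  obtains c where "infinite {a \<in> A. f a = c}"
proof -
  have "finite (f ` A)" using assms(2) by (rule finite_subset[rotated]) auto
  from pigeonhole_infinite[OF assms(1) this] show ?thesis using that by blast
qed

theorem theorem3p1:
  fixes B2 :: "nat \<Rightarrow> real ^ 'k::finite"
    and \<Theta> :: "(real ^ 'l::finite) set"
    and \<P> :: "nat \<Rightarrow> 'a measure set"
    and Q :: "'a measure \<Rightarrow> real ^ 'k \<Rightarrow> real"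
    and \<phi> :: "'a measure \<Rightarrow> real ^ 'k \<Rightarrow> real ^ 'k"
    and \<theta> :: "'a measure \<Rightarrow> real ^ 'k \<Rightarrow> real ^ 'l"
    and \<phi>h :: "nat \<Rightarrow> real ^ 'k \<Rightarrow> 'a \<Rightarrow> real ^ 'k"
    and \<theta>h :: "nat \<Rightarrow> real ^ 'k \<Rightarrow> 'a \<Rightarrow> real ^ 'l"
    and \<Omega>h :: "nat \<Rightarrow> real ^ 'k \<Rightarrow> 'a \<Rightarrow> real ^ ('k, 'l) coord ^ ('k, 'l) coord"
    and \<alpha> :: real
  assumes B2: "orthonormal_contrasts B2"
    and P_nonempty: "\<And>n. n \<ge> 1 \<Longrightarrow> \<P> n \<noteq> {}"
    and P_prob: "\<And>n P. n \<ge> 1 \<Longrightarrow> P \<in> \<P> n \<Longrightarrow> prob_space P"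
    and Q_convex: "\<And>n P. n \<ge> 1 \<Longrightarrow> P \<in> \<P> n \<Longrightarrow> convex_on UNIV (Q P)"
    and Q_gradient: "\<And>n P w. n \<ge> 1 \<Longrightarrow> P \<in> \<P> n \<Longrightarrow> GDERIV (Q P) w :> \<phi> P w"
    and \<theta>_range: "\<And>n P w. n \<ge> 1 \<Longrightarrow> P \<in> \<P> n \<Longrightarrow> w \<in> simplex_wts \<Longrightarrow> \<theta> P w \<in> \<Theta>"
    and \<phi>h_meas: "\<And>n P w. n \<ge> 1 \<Longrightarrow> P \<in> \<P> n \<Longrightarrow> w \<in> simplex_wts \<Longrightarrow> \<phi>h n w \<in> borel_measurable P"
    and \<theta>h_meas: "\<And>n P w. n \<ge> 1 \<Longrightarrow> P \<in> \<P> n \<Longrightarrow> w \<in> simplex_wts \<Longrightarrow> \<theta>h n w \<in> borel_measurable P"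
    and \<Omega>h_meas: "\<And>n P w. n \<ge> 1 \<Longrightarrow> P \<in> \<P> n \<Longrightarrow> w \<in> simplex_wts \<Longrightarrow> \<Omega>h n w \<in> borel_measurable P"
    and \<Omega>h_spd: "\<And>n P w \<omega>. n \<ge> 1 \<Longrightarrow> P \<in> \<P> n \<Longrightarrow> w \<in> simplex_wts \<Longrightarrow> \<omega> \<in> space P \<Longrightarrow>
                   sym_pos_def (\<Omega>h n w \<omega>)"
    and asymptotics: "\<And>P :: nat \<Rightarrow> 'a measure. (\<forall>n\<ge>1. P n \<in> \<P> n) \<Longrightarrow>
      \<exists>\<Omega> :: nat \<Rightarrow> real ^ 'k \<Rightarrow> real ^ ('k, 'l) coord ^ ('k, 'l) coord.
        (\<forall>n\<ge>1. \<forall>w\<in>simplex_wts. sym_pos_def (\<Omega> n w)) \<and>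
        (\<forall>w :: nat \<Rightarrow> real ^ 'k. (\<forall>n\<ge>1. w n \<in> opt_wts (Q (P n))) \<longrightarrow>
          (\<forall>t. (\<lambda>n. measure (P n) {\<omega> \<in> space (P n).
                  inv_sqrt_mat (\<Omega> n (w n)) *v
                    (sqrt (real n) *\<^sub>R
                      stack_coord (\<lambda>i. B2 i \<bullet> (\<phi>h n (w n) \<omega> - \<phi> (P n) (w n)))
                                  (\<theta>h n (w n) \<omega> - \<theta> (P n) (w n))) \<le> t})
                \<longlonglongrightarrow> std_normal_vec_cdf t) \<and>
          limsup (\<lambda>n. ereal (norm (\<Omega> n (w n)))) < \<infinity> \<and>
          liminf (\<lambda>n. ereal (lambda_min (\<Omega> n (w n)))) > 0 \<and>
          (\<forall>\<epsilon>>0. \<forall>v :: nat \<Rightarrow> real ^ 'k. (\<forall>n\<ge>1. v n \<in> simplex_wts) \<longrightarrow>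
            (\<lambda>n. measure (P n) {\<omega> \<in> space (P n). norm (\<Omega>h n (v n) \<omega> - \<Omega> n (v n)) > \<epsilon>})
              \<longlonglongrightarrow> 0))"
    and \<alpha>: "0 < \<alpha>" "\<alpha> < 1"
  shows "liminf (\<lambda>n. INF P\<in>\<P> n. INF w\<in>opt_wts (Q P).
           ereal (measure P {\<omega> \<in> space P.
             (w, \<theta> P w) \<in> C_joint \<alpha> \<Theta> n B2
               (\<lambda>v. \<phi>h n v \<omega>) (\<lambda>v. \<theta>h n v \<omega>) (\<lambda>v. \<Omega>h n v \<omega>)}))
         \<ge> ereal (1 - \<alpha>)"
proof (rule ccontr)

  \<comment> \<open>Indices with deficient coverage\<close>
  assume neg: "\<not> ?thesis"
  define cov where "cov n P w = measure P {\<omega> \<in> space P. (w, \<theta> P w) \<in> C_joint \<alpha> \<Theta> n B2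
      (\<lambda>v. \<phi>h n v \<omega>) (\<lambda>v. \<theta>h n v \<omega>) (\<lambda>v. \<Omega>h n v \<omega>)}" for n P w
  let ?F = "\<lambda>n. INF P\<in>\<P> n. INF w\<in>opt_wts (Q P). ereal (cov n P w)"
  obtain y where y: "y < ereal (1 - \<alpha>)" "\<not> (\<forall>\<^sub>F n in sequentially. y < ?F n)"
    using neg unfolding le_Liminf_iff cov_def by blast
  \<comment> \<open>On the bad indices noncoverage has probability above \<open>1 - b\<close>, which
    exceeds \<open>\<alpha>\<close> by a fixed amount.\<close>
  obtain b where b: "y < ereal b" "ereal b < ereal (1 - \<alpha>)" using ereal_dense2[OF y(1)] by blast
  define Bad where "Bad n P w \<longleftrightarrow> P \<in> \<P> n \<and> w \<in> opt_wts (Q P) \<and> cov n P w < b" for n P w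
  define I where "I = {n. 1 \<le> n \<and> (\<exists>P w. Bad n P w)}"
  have infI: "infinite I"
    unfolding infinite_nat_iff_unbounded_le
  proof
    fix m
    obtain n where n: "n \<ge> max m 1" "\<not> y < ?F n"
      using y(2) unfolding eventually_sequentially by blast
    then have "?F n < ereal b" using b(1) by (simp add: not_less)
    then obtain P w where "P \<in> \<P> n" "w \<in> opt_wts (Q P)" "ereal (cov n P w) < ereal b"
      unfolding INF_less_iff by blast
    then have "n \<in> I" using n(1) by (auto simp: I_def Bad_def)
    then show "\<exists>n\<ge>m. n \<in> I" using n(1) by auto
  qed
  have cont: "continuous_on UNIV (Q P)" if "n \<ge> 1" "P \<in> \<P> n" for n P
    using Q_gradient[OF that] by (auto simp: continuous_on_eq_continuous_at gderiv_def intro: has_derivative_continuous)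
  \<comment> \<open>The hypothesis is about sequences defined for every \<open>n \<ge> 1\<close>, so
    indices outside \<open>I\<close> are filled with arbitrary distributions and optimal
    weights.\<close>
  have "\<exists>P w. 1 \<le> n \<longrightarrow> P \<in> \<P> n \<and> w \<in> opt_wts (Q P) \<and> (n \<in> I \<longrightarrow> cov n P w < b)" for n
  proof (cases "n \<in> I")
    case True
    then show ?thesis by (auto simp: I_def Bad_def)
  next
    case False
    show ?thesis
    proof (cases "1 \<le> n")
      case True
      then obtain P where P: "P \<in> \<P> n" using P_nonempty by blast
      obtain w where "w \<in> opt_wts (Q P)" using opt_wts_le(1)[OF cont[OF True P]] by blast
      with P False show ?thesis by blast
    qed simp
  qed
  then obtain P w where Pw: "\<And>n. 1 \<le> n \<Longrightarrow> P n \<in> \<P> n" "\<And>n. 1 \<le> n \<Longrightarrow> w n \<in> opt_wts (Q (P n))"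
    "\<And>n. 1 \<le> n \<Longrightarrow> n \<in> I \<Longrightarrow> cov n (P n) (w n) < b" by metis
  have I1: "1 \<le> n" if "n \<in> I" for n using that by (simp add: I_def)
  have ws: "w n \<in> simplex_wts" if "1 \<le> n" for n using Pw(2)[OF that] by (simp add: opt_wts_def)
  define N where "N = CARD(('k, 'l) coord)"
  define Z where "Z n \<omega> = sqrt (real n) *\<^sub>R
    (stack_coord (\<lambda>i. B2 i \<bullet> (\<phi>h n (w n) \<omega> - \<phi> (P n) (w n))) (\<theta>h n (w n) \<omega> - \<theta> (P n) (w n)) :: real ^ ('k, 'l) coord)" for n \<omega>

  \<comment> \<open>Whitening matrices and their bounds\<close>
  have "\<forall>n\<ge>1. P n \<in> \<P> n" using Pw(1) by blast
  from asymptotics[OF this] obtain \<Omega> where spd0: "\<forall>n\<ge>1. \<forall>w\<in>simplex_wts. sym_pos_def (\<Omega> n w)"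
    and all: "\<forall>w :: nat \<Rightarrow> real ^ 'k. (\<forall>n\<ge>1. w n \<in> opt_wts (Q (P n))) \<longrightarrow>
          (\<forall>t. (\<lambda>n. measure (P n) {\<omega> \<in> space (P n).
                  inv_sqrt_mat (\<Omega> n (w n)) *v
                    (sqrt (real n) *\<^sub>R
                      stack_coord (\<lambda>i. B2 i \<bullet> (\<phi>h n (w n) \<omega> - \<phi> (P n) (w n)))
                                  (\<theta>h n (w n) \<omega> - \<theta> (P n) (w n))) \<le> t})
                \<longlonglongrightarrow> std_normal_vec_cdf t) \<and>
          limsup (\<lambda>n. ereal (norm (\<Omega> n (w n)))) < \<infinity> \<and>
          liminf (\<lambda>n. ereal (lambda_min (\<Omega> n (w n)))) > 0 \<and>
          (\<forall>\<epsilon>>0. \<forall>v :: nat \<Rightarrow> real ^ 'k. (\<forall>n\<ge>1. v n \<in> simplex_wts) \<longrightarrow>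
            (\<lambda>n. measure (P n) {\<omega> \<in> space (P n). norm (\<Omega>h n (v n) \<omega> - \<Omega> n (v n)) > \<epsilon>})
              \<longlonglongrightarrow> 0)"
    by (elim exE conjE)
  define W where "W n = \<Omega> n (w n)" for n
  define R where "R n = inv_sqrt_mat (W n)" for n
  have spd: "sym_pos_def (W n)" if "1 \<le> n" for n using spd0 that ws[OF that] by (simp add: W_def)
  note Rspd = inv_sqrt_mat(1)[OF spd, folded R_def]
  have opt: "\<forall>n\<ge>1. w n \<in> opt_wts (Q (P n))" using Pw(2) by blast
  note asy = all[rule_format, OF opt[rule_format], folded Z_def W_def, folded R_def]
  have cdf: "(\<lambda>n. measure (P n) {\<omega> \<in> space (P n). R n *v Z n \<omega> \<le> t}) \<longlonglongrightarrow> std_normal_vec_cdf t" for t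
    using asy by blast
  have \<Omega>_lim: "(\<lambda>n. measure (P n) {\<omega> \<in> space (P n). \<epsilon> < norm (\<Omega>h n (w n) \<omega> - W n)}) \<longlonglongrightarrow> 0" if "0 < \<epsilon>" for \<epsilon>
    using asy ws that unfolding W_def by blast
  obtain C where C: "limsup (\<lambda>n. ereal (norm (W n))) < ereal C"
    using asy ereal_dense2[of "limsup (\<lambda>n. ereal (norm (W n)))" \<infinity>] by blast
  obtain c where c: "0 < ereal c" "ereal c < liminf (\<lambda>n. ereal (lambda_min (W n)))"
    using asy ereal_dense2[of 0 "liminf (\<lambda>n. ereal (lambda_min (W n)))"] by blast
  have "\<forall>\<^sub>F n in sequentially. ereal (norm (W n)) < ereal C \<and> ereal c < ereal (lambda_min (W n))"
    using Limsup_lessD[OF C] less_LiminfD[OF c(2)] by eventually_elim blast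
  then obtain n0 where n0: "\<And>n. n \<ge> n0 \<Longrightarrow> norm (W n) < C \<and> c < lambda_min (W n)"
    unfolding eventually_sequentially by auto
  define K where "K = real N * (1 / sqrt c)"
  have c0: "0 < c" using c(1) by simp
  have R_le: "norm (R n) \<le> K" and R_low: "norm x \<le> C * K * norm (R n *v x)" if "1 \<le> n" "n0 \<le> n" for n x
  proof -
    have cl: "c \<le> lambda_min (W n)" "norm (W n) \<le> C" using n0[OF that(2)] by simp_all
    note bnd = inv_sqrt_mat_bounds[OF spd[OF that(1)] c0 cl(1), folded R_def]
    show RK: "norm (R n) \<le> K" using bnd(1) by (simp add: K_def N_def)
    have "norm (W n) * norm (R n) * norm (R n *v x) \<le> C * K * norm (R n *v x)"
      using cl(2) RK by (intro mult_right_mono mult_mono) (auto intro: order_trans[OF norm_ge_zero])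
    with bnd(2)[of x] show "norm x \<le> C * K * norm (R n *v x)" by linarith
  qed

  \<comment> \<open>Multipliers on the scale of the data\<close>
  have "\<exists>l c. 1 \<le> n \<longrightarrow> 0 \<le> l \<and> (\<forall>j. w n $ j \<noteq> 0 \<longrightarrow> l $ j = 0) \<and> \<phi> (P n) (w n) = l + c *\<^sub>R 1" for n
    using opt_wts_multipliers[OF Q_gradient[OF _ Pw(1)] Pw(2)] by blast
  then obtain l cc where l: "\<And>n. 1 \<le> n \<Longrightarrow> 0 \<le> l n" "\<And>n j. 1 \<le> n \<Longrightarrow> w n $ j \<noteq> 0 \<Longrightarrow> l n $ j = 0"
    "\<And>n. 1 \<le> n \<Longrightarrow> \<phi> (P n) (w n) = l n + cc n *\<^sub>R 1" by metis
  \<comment> \<open>These will be the bounds of the centered problem. The value 0 at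
    \<open>n = 0\<close>, where no multiplier is given, makes \<open>m\<close> nonnegative
    throughout.\<close>
  define m where "m n j = (if 1 \<le> n then sqrt (real n) * l n $ j else 0)" for n j
  have m0: "0 \<le> m n j" for n j using l(1)[of n] by (simp add: m_def less_eq_vec_def)

  \<comment> \<open>Extraction of a convergent subsequence\<close>
  obtain J0 where "infinite {n \<in> I. {j. w n $ j = 0} = J0}"
    using infinite_image_constant_subset[OF infI, of "\<lambda>n. {j. w n $ j = 0}"] by auto
  \<comment> \<open>Discarding the finitely many \<open>n < n0\<close> makes the matrix bounds valid
    along the whole subsequence.\<close>
  then have "infinite ({n \<in> I. {j. w n $ j = 0} = J0} - {..<n0})" by simp
  then obtain s1 :: "nat \<Rightarrow> nat" where s1: "strict_mono s1" "\<And>i. s1 i \<in> {n \<in> I. {j. w n $ j = 0} = J0} - {..<n0}"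
    using infinite_enumerate by blast
  define \<nu> where "\<nu> n = (\<chi> j. m n j / (1 + m n j))" for n
  have \<nu>_le: "norm (\<nu> n) \<le> real CARD('k)" for n
  proof -
    have "\<bar>\<nu> n $ j\<bar> \<le> 1" for j using m0[of n j] by (simp add: \<nu>_def divide_le_eq_1)
    then have "(\<Sum>j\<in>UNIV. \<bar>\<nu> n $ j\<bar>) \<le> (\<Sum>j\<in>(UNIV :: 'k set). 1)" by (intro sum_mono)
    then show ?thesis using norm_le_l1_cart[of "\<nu> n"] by simp
  qed
  have "bounded (range (\<lambda>i. (\<nu> (s1 i), R (s1 i))))"
  proof (rule bounded_subset[OF bounded_Times[OF bounded_cball bounded_cball]])
    show "range (\<lambda>i. (\<nu> (s1 i), R (s1 i))) \<subseteq> cball 0 (real CARD('k)) \<times> cball 0 K"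
      using s1(2) I1 R_le \<nu>_le by (auto simp: not_less)
  qed
  then obtain L s2 where s2: "strict_mono s2" and L: "((\<lambda>i. (\<nu> (s1 i), R (s1 i))) \<circ> s2) \<longlonglongrightarrow> L"
    using bounded_imp_convergent_subsequence by blast
  define s where "s i = s1 (s2 i)" for i
  have s: "strict_mono s" unfolding s_def[abs_def] using s1(1) s2 by (auto simp: strict_mono_def)
  have sI: "s i \<in> I" and sJ: "{j. w (s i) $ j = 0} = J0" and sn0: "n0 \<le> s i" for i
    using s1(2)[of "s2 i"] by (auto simp: s_def)
  have s_ge: "1 \<le> s i" for i using I1[OF sI] .
  have \<nu>s: "(\<lambda>i. m (s i) j / (1 + m (s i) j)) \<longlonglongrightarrow> fst L $ j" for j
    using tendsto_vec_nth[OF tendsto_fst[OF L], of j] by (simp add: \<nu>_def s_def o_def)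
  have Rs: "(\<lambda>i. R (s i)) \<longlonglongrightarrow> snd L" using tendsto_snd[OF L] by (simp add: s_def o_def)
  note sub = LIMSEQ_subseq_LIMSEQ[OF _ s, unfolded o_def]

  \<comment> \<open>Generators in the limit\<close>
  let ?a = "score_col B2 :: 'k \<Rightarrow> real ^ ('k, 'l) coord"
  let ?b = "\<lambda>j. snd L *v ?a j"
  have J0: "J0 \<noteq> UNIV" using simplex_wts_zeros(1)[OF ws[OF s_ge[of 0]]] sJ[of 0] by simp
  \<comment> \<open>The lower bound on the whitening matrices persists in the limit, so
    \<open>snd L\<close> is injective and the limiting generators remain independent.\<close>
  have L_low: "norm x \<le> C * K * norm (snd L *v x)" for x
  proof (rule LIMSEQ_le_const)
    show "(\<lambda>i. C * K * norm (R (s i) *v x)) \<longlonglongrightarrow> C * K * norm (snd L *v x)"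
      by (intro tendsto_intros tendsto_matrix_vector_mult Rs)
    show "\<exists>N. \<forall>n\<ge>N. norm x \<le> C * K * norm (R (s n) *v x)" using R_low[OF s_ge sn0] by blast
  qed
  have indep0: "\<forall>j\<in>J0. d j = 0" if "(\<Sum>j\<in>J0. d j *\<^sub>R ?b j) = 0" for d
  proof -
    have "snd L *v (\<Sum>j\<in>J0. d j *\<^sub>R ?a j) = 0"
      using that by (simp add: linear_sum[OF matrix_vector_mul_linear] matrix_vector_mult_scaleR)
    then have "(\<Sum>j\<in>J0. d j *\<^sub>R ?a j) = 0" using L_low[of "\<Sum>j\<in>J0. d j *\<^sub>R ?a j"] by simp
    then show ?thesis by (rule score_col_independent[OF B2 J0])
  qed
  have fJ0: "finite J0" by simp
  note indep = independent_family[OF fJ0 indep0]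
  have "J0 \<subset> UNIV" using J0 by blast
  then have "card J0 < CARD('k)" by (intro psubset_card_mono) auto
  moreover have "0 < CARD('l)" by simp
  ultimately have cardJ0: "card J0 < CARD(('k, 'l) coord)" unfolding card_coord by linarith
  have prob: "prob_space (P (s i))" for i by (rule P_prob[OF s_ge Pw(1)[OF s_ge]])

  \<comment> \<open>Whitened data and noncoverage events\<close>
  define X where "X i \<omega> = R (s i) *v Z (s i) \<omega>" for i \<omega>
  define \<Psi> where "\<Psi> i \<omega> = R (s i) ** \<Omega>h (s i) (w (s i)) \<omega> ** R (s i)" for i \<omega>
  define Cov where "Cov i = {\<omega> \<in> space (P (s i)). (w (s i), \<theta> (P (s i)) (w (s i))) \<in> C_joint \<alpha> \<Theta> (s i) B2
      (\<lambda>v. \<phi>h (s i) v \<omega>) (\<lambda>v. \<theta>h (s i) v \<omega>) (\<lambda>v. \<Omega>h (s i) v \<omega>)}" for i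
  define E where "E i = space (P (s i)) - Cov i" for i
  note meas = \<phi>h_meas[OF s_ge Pw(1)[OF s_ge] ws[OF s_ge]] \<theta>h_meas[OF s_ge Pw(1)[OF s_ge] ws[OF s_ge]]
    \<Omega>h_meas[OF s_ge Pw(1)[OF s_ge] ws[OF s_ge]]
  have spdh: "sym_pos_def (\<Omega>h (s i) (w (s i)) \<omega>)" if "\<omega> \<in> space (P (s i))" for i \<omega>
    using that by (rule \<Omega>h_spd[OF s_ge Pw(1)[OF s_ge] ws[OF s_ge]])
  have \<theta>\<Theta>: "\<theta> (P (s i)) (w (s i)) \<in> \<Theta>" for i
    by (rule \<theta>_range[OF s_ge Pw(1)[OF s_ge] ws[OF s_ge]])
  have Cov_sets: "Cov i \<in> sets (P (s i))" for i
    unfolding Cov_def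
    by (rule sets_C_joint[where \<Omega>h = "\<Omega>h (s i)" and \<phi>h = "\<phi>h (s i)" and \<theta>h = "\<theta>h (s i)"])
       (intro B2 ws s_ge \<theta>\<Theta> spdh meas; assumption)+
  have X_meas: "X i \<in> borel_measurable (P (s i))" for i
  proof -
    have "(\<lambda>z. R (s i) *v (sqrt (real (s i)) *\<^sub>R (stack_coord (\<lambda>j. B2 j \<bullet> (fst z - \<phi> (P (s i)) (w (s i))))
       (snd z - \<theta> (P (s i)) (w (s i))) :: real ^ ('k, 'l) coord))) \<in> borel_measurable borel"
      by (intro borel_measurable_continuous_onI continuous_on_matrix_vector_mult continuous_on_scaleR
        continuous_on_stack_coord continuous_intros)
    from measurable_compose[OF borel_measurable_Pair[OF meas(1,2)] this]
    show ?thesis by (simp add: X_def[abs_def] Z_def)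
  qed
  have \<Psi>_meas: "\<Psi> i \<in> borel_measurable (P (s i))" for i
  proof -
    have "continuous_on UNIV (\<lambda>A. R (s i) ** A ** R (s i))"
      unfolding continuous_on_def by (intro ballI tendsto_matrix_matrix_mult tendsto_const tendsto_ident_at)
    from measurable_compose[OF meas(3) borel_measurable_continuous_onI[OF this]]
    show ?thesis by (simp add: \<Psi>_def[abs_def])
  qed

  \<comment> \<open>The level \<open>1 - b\<close> plays the role of \<open>\<beta>\<close>; the
    free generators are those whose transformed multiplier tends to 1.\<close>
  have "\<forall>\<^sub>F i in sequentially. measure (P (s i)) (E i) < 1 - b"
  proof (rule eventually_prob_perturbed_solution_less[where a = ?b and A = "\<lambda>i j. R (s i) *v ?a j"
        and \<nu> = "\<lambda>i. m (s i)" and \<mu> = "\<lambda>j. fst L $ j / (1 - fst L $ j)" and F = "{j \<in> J0. fst L $ j = 1}"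
        and X = X and \<Psi> = \<Psi>, OF indep _ cardJ0 \<alpha>])
    show "\<alpha> < 1 - b" using b(2) by simp
    show "(\<lambda>i. R (s i) *v ?a j) \<longlonglongrightarrow> ?b j" for j by (intro tendsto_matrix_vector_mult Rs tendsto_const)
    show "0 \<le> m (s i) j" for i j by (rule m0)
    show "filterlim (\<lambda>i. m (s i) j) at_top sequentially" if "j \<in> {j \<in> J0. fst L $ j = 1}" for j
      using tendsto_odds(1)[OF m0 \<nu>s] that by simp
    show "(\<lambda>i. m (s i) j) \<longlonglongrightarrow> fst L $ j / (1 - fst L $ j)" if "j \<in> J0 - {j \<in> J0. fst L $ j = 1}" for j
      using tendsto_odds(2)[OF m0 \<nu>s] that by simp
    show "(\<lambda>i. measure (P (s i)) {\<omega> \<in> space (P (s i)). X i \<omega> \<le> t}) \<longlonglongrightarrow> std_normal_vec_cdf t" for t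
      using sub[OF cdf[of t]] by (simp add: X_def)
    show "(\<lambda>i. measure (P (s i)) {\<omega> \<in> space (P (s i)). \<epsilon> < norm (\<Psi> i \<omega> - mat 1)}) \<longlonglongrightarrow> 0" if \<epsilon>: "0 < \<epsilon>" for \<epsilon>
    proof (rule tendsto_sandwich[OF _ _ tendsto_const])
      \<comment> \<open>\<open>K * K\<close> bounds the effect of multiplying by the whitening
        matrix on both sides; the summand 1 makes the divisor visibly positive.\<close>
      define e where "e = \<epsilon> / (K * K + 1)"
      have "0 < K * K + 1" by (rule add_nonneg_pos) auto
      then have e: "0 < e" "e * (K * K + 1) = \<epsilon>" using \<epsilon> by (simp_all add: e_def)
      show "(\<lambda>i. measure (P (s i)) {\<omega> \<in> space (P (s i)). e < norm (\<Omega>h (s i) (w (s i)) \<omega> - W (s i))}) \<longlonglongrightarrow> 0"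
        by (rule sub[OF \<Omega>_lim[OF e(1)]])
      show "\<forall>\<^sub>F i in sequentially. measure (P (s i)) {\<omega> \<in> space (P (s i)). \<epsilon> < norm (\<Psi> i \<omega> - mat 1)} \<le>
          measure (P (s i)) {\<omega> \<in> space (P (s i)). e < norm (\<Omega>h (s i) (w (s i)) \<omega> - W (s i))}"
      proof (intro always_eventually allI)
        fix i
        interpret prob_space "P (s i)" by (rule prob)
        have le: "norm (\<Psi> i \<omega> - mat 1) \<le> K * K * norm (\<Omega>h (s i) (w (s i)) \<omega> - W (s i))" for \<omega>
        proof -
          have "R (s i) ** W (s i) ** R (s i) = mat 1"
            unfolding R_def by (rule inv_sqrt_mat_congruence[OF spd[OF s_ge]])
          then have "\<Psi> i \<omega> - mat 1 = R (s i) ** (\<Omega>h (s i) (w (s i)) \<omega> - W (s i)) ** R (s i)"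
            unfolding \<Psi>_def matrix_diff_ldistrib matrix_diff_rdistrib by simp
          then have "norm (\<Psi> i \<omega> - mat 1) \<le> norm (R (s i)) * norm (\<Omega>h (s i) (w (s i)) \<omega> - W (s i)) * norm (R (s i))"
            by (metis (no_types, lifting) mult_right_mono norm_ge_zero norm_matrix_matrix_mult_le order_trans)
          also have "\<dots> \<le> K * norm (\<Omega>h (s i) (w (s i)) \<omega> - W (s i)) * K"
            using R_le[OF s_ge sn0] c0 by (intro mult_mono) (auto simp: K_def)
          finally show ?thesis by (simp add: mult_ac)
        qed
        show "measure (P (s i)) {\<omega> \<in> space (P (s i)). \<epsilon> < norm (\<Psi> i \<omega> - mat 1)} \<le>
          measure (P (s i)) {\<omega> \<in> space (P (s i)). e < norm (\<Omega>h (s i) (w (s i)) \<omega> - W (s i))}"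
        proof (rule finite_measure_mono)
          note [measurable] = meas(3)[of i]
          show "{\<omega> \<in> space (P (s i)). e < norm (\<Omega>h (s i) (w (s i)) \<omega> - W (s i))} \<in> sets (P (s i))" by measurable
          show "{\<omega> \<in> space (P (s i)). \<epsilon> < norm (\<Psi> i \<omega> - mat 1)} \<subseteq> {\<omega> \<in> space (P (s i)). e < norm (\<Omega>h (s i) (w (s i)) \<omega> - W (s i))}"
          proof (intro Collect_mono impI conjI; elim conjE)
            fix \<omega> assume "\<epsilon> < norm (\<Psi> i \<omega> - mat 1)"
            then have "\<epsilon> < K * K * norm (\<Omega>h (s i) (w (s i)) \<omega> - W (s i))" using le[of \<omega>] by linarith
            also have "\<dots> \<le> (K * K + 1) * norm (\<Omega>h (s i) (w (s i)) \<omega> - W (s i))" by (intro mult_right_mono) auto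
            finally have "(K * K + 1) * e < (K * K + 1) * norm (\<Omega>h (s i) (w (s i)) \<omega> - W (s i))"
              unfolding e(2)[symmetric] by (simp only: mult.commute)
            then show "e < norm (\<Omega>h (s i) (w (s i)) \<omega> - W (s i))"
              using \<open>0 < K * K + 1\<close> by (simp only: mult_less_cancel_left_pos)
          qed
        qed
      qed
    qed simp
    \<comment> \<open>A sample point outside the confidence set has a \<open>kkt_solution\<close>
      whose value exceeds the quantile. Centering, scaling by \<open>sqrt n\<close> and whitening
      turn it into a solution of the perturbed problem.\<close>
    show "\<exists>J \<delta> \<rho>. J \<subseteq> J0 \<and> perturbed_solution (\<Psi> i \<omega>) (\<lambda>j. R (s i) *v ?a j) J0 (m (s i)) J (X i \<omega>) \<delta> \<rho> \<and>
        quantile (chi_squared (CARD(('k, 'l) coord) - card J)) (1 - \<alpha>) \<le> \<rho> \<bullet> (\<Psi> i \<omega> *v \<rho>)" if \<omega>: "\<omega> \<in> E i" for i \<omega>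
    proof -
      let ?n = "s i"
      let ?w = "w ?n" and ?\<Omega> = "\<Omega>h ?n (w ?n) \<omega>"
      let ?y = "stack_coord (\<lambda>j. B2 j \<bullet> \<phi>h ?n ?w \<omega>) (\<theta>h ?n ?w \<omega> - \<theta> (P ?n) ?w) :: real ^ ('k, 'l) coord"
      have sp: "\<omega> \<in> space (P ?n)" and nc: "\<omega> \<notin> Cov i" using \<omega> by (auto simp: E_def)
      note char = C_joint_iff_kkt_solution[OF B2 ws[OF s_ge[of i]] \<theta>\<Theta>[of i], of "\<lambda>v. \<Omega>h ?n v \<omega>" "\<lambda>v. \<phi>h ?n v \<omega>" "\<lambda>v. \<theta>h ?n v \<omega>", OF spdh[OF sp]]
      obtain J \<delta> p where k: "kkt_solution B2 ?w ?\<Omega> ?y J \<delta> p" using char(1) by (elim exE)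
      have J: "J \<subseteq> J0" and sol: "perturbed_solution ?\<Omega> ?a J0 (\<lambda>_. 0) J ?y \<delta> p"
        using k unfolding kkt_solution_def sJ by simp_all
      have big: "quantile (chi_squared (CARD(('k, 'l) coord) - card J)) (1 - \<alpha>) \<le> real ?n * (p \<bullet> (?\<Omega> *v p))"
        using nc sp char(2)[OF k, of \<alpha> ?n] unfolding Cov_def by simp
      have yZ: "sqrt (real ?n) *\<^sub>R ?y = Z ?n \<omega> + (\<Sum>j\<in>J0. m ?n j *\<^sub>R ?a j)"
      proof -
        have "l ?n $ j = 0" if "j \<notin> J0" for j using l(2)[OF s_ge, of i j] that unfolding sJ[of i, symmetric] by simp
        from stack_coord_centered[OF B2 l(3)[OF s_ge] this] show ?thesis
          using s_ge[of i] by (simp add: Z_def m_def)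
      qed
      let ?p = "sqrt (real ?n) *\<^sub>R p"
      have sol': "perturbed_solution ?\<Omega> ?a J0 (m ?n) J (Z ?n \<omega>) (\<lambda>j. sqrt (real ?n) * \<delta> j + m ?n j) ?p"
        by (rule perturbed_solution_rescale[OF sol _ yZ]) simp
      note cong = perturbed_solution_congruence[OF Rspd[OF s_ge] sol']
      have "?p \<bullet> (?\<Omega> *v ?p) = real ?n * (p \<bullet> (?\<Omega> *v p))"
        by (simp add: matrix_vector_mult_scaleR mult.assoc[symmetric])
      then have "quantile (chi_squared (CARD(('k, 'l) coord) - card J)) (1 - \<alpha>) \<le>
          (matrix_inv (R ?n) *v ?p) \<bullet> (\<Psi> i \<omega> *v (matrix_inv (R ?n) *v ?p))"
        using big cong(2) by (simp add: \<Psi>_def)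
      then show ?thesis using J cong(1) unfolding \<Psi>_def X_def by blast
    qed
    show "E i \<in> sets (P (s i))" for i unfolding E_def using Cov_sets by blast
  qed (use prob X_meas \<Psi>_meas in auto)
  then obtain i where "measure (P (s i)) (E i) < 1 - b"
    using eventually_happens'[OF sequentially_bot] by blast
  moreover have "measure (P (s i)) (E i) = 1 - measure (P (s i)) (Cov i)"
    unfolding E_def by (rule prob_space.prob_compl[OF prob Cov_sets])
  moreover have "measure (P (s i)) (Cov i) < b" using Pw(3)[OF s_ge sI] unfolding cov_def Cov_def by blast
  ultimately show False by linarith
qed

end
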